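(* If Assumptions 1 and 2 hold, then for almost all $x,y\in\mathbb{X}$, \[ |\hat Z(x,y)|\le e^{a(y)+2b(y)}\Bigl[|\zeta(x,y)|e^{a(x)+2b(x)}+\sum_{m\ge1}\int\mathrm{d}|\mu|(x_1)\cdots\int\mathrm{d}|\mu|(x_m)\prod_{i=0}^m|\zeta(x_i,x_{i+1})|\,e^{a(x_i)+2b(x_i)}\Bigr], \] where $x_0\equiv x$ and $x_{m+1}\equiv y$. If Assumptions 1 and 2' hold, the same bound holds with $|\overline u(\cdot,\cdot)|$ in place of $|\zeta(\cdot,\cdot)|$ and $e^{b(\cdot)}$ in place of $e^{2b(\cdot)}$.
   Context: Let $(\mathbb{X},\mathcal{X},\mu)$ be a measure space with $\mu$ a complex measure, and $|\mu|$ its total variation. Let $u,\zeta$ be complex measurable symmetric functions on $\mathbb{X}\times\mathbb{X}$ with $\zeta(x,y)=e^{-u(x,y)}-1$; $\mathrm{Re}\,u$ may equal $+\infty$, in which case $\zeta=-1$. Let $\overline u(x,y)=u(x,y)$ if $\mathrm{Re}\,u(x,y)\ne\infty$ and $\overline u(x,y)=1$ otherwise. Assumption 1: there is $b\ge0$ on $\mathbb{X}$ with $\prod_{1\le i<j\le n}|1+\zeta(x_i,x_j)|\le\prod_{i=1}^n e^{b(x_i)}$ for all $n$ and $\otimes^n\mu$-almost all $x_1,\dots,x_n$. Assumption 2: there is $a\ge0$ on $\mathbb{X}$ with $\int\mathrm{d}|\mu|(y)|\zeta(x,y)|e^{a(y)+2b(y)}\le a(x)$ for almost all $x$. Assumption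 2': there is $a\ge0$ on $\mathbb{X}$ with $\int\mathrm{d}|\mu|(y)|\overline u(x,y)|e^{a(y)+b(y)}\le a(x)$ for almost all $x$. With $\mathcal{C}_n$ the set of connected graphs on $\{1,\dots,n\}$, let $\varphi(x_1,\dots,x_n)=\frac1{n!}\sum_{G\in\mathcal{C}_n}\prod_{\{i,j\}\in G}\zeta(x_i,x_j)$ for $n\ge2$, and $\hat Z(x_1,x_2)=\sum_{n\ge2}n(n-1)\int\mathrm{d}\mu(x_3)\cdots\int\mathrm{d}\mu(x_n)\,\varphi(x_1,\dots,x_n)$ (the $n=2$ term being $2\varphi(x_1,x_2)=\zeta(x_1,x_2)$). *)

theory Defs
  imports "HOL-Analysis.Analysis"
begin

text \<open>The pair potential u, with the value None encoding Re u = +infinity.\<close>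

definition zeta :: "('a \<Rightarrow> 'a \<Rightarrow> complex option) \<Rightarrow> 'a \<Rightarrow> 'a \<Rightarrow> complex" where
  "zeta u x y = (case u x y of None \<Rightarrow> -1 | Some v \<Rightarrow> exp (- v) - 1)"

definition ubar :: "('a \<Rightarrow> 'a \<Rightarrow> complex option) \<Rightarrow> 'a \<Rightarrow> 'a \<Rightarrow> complex" where
  "ubar u x y = (case u x y of None \<Rightarrow> 1 | Some v \<Rightarrow> v)"

text \<open>Simple graphs on the vertex set {1..n}: sets of 2-element subsets.\<close>

definition edges_on :: "nat \<Rightarrow> nat set set" where
  "edges_on n = {{i, j} | i j. i \<in> {1..n} \<and> j \<in> {1..n} \<and> i \<noteq> j}"

definition connected_graph :: "nat \<Rightarrow> nat set set \<Rightarrow> bool" where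
  "connected_graph n G \<longleftrightarrow> G \<subseteq> edges_on n \<and>
     (\<forall>i\<in>{1..n}. \<forall>j\<in>{1..n}. (i, j) \<in> {(p, q). {p, q} \<in> G}\<^sup>*)"

definition conn_graphs :: "nat \<Rightarrow> nat set set set" where
  "conn_graphs n = {G. connected_graph n G}"

text \<open>Ursell function phi(x_1,...,x_n) (points given as xs i, i = 1..n).\<close>

definition phi :: "('a \<Rightarrow> 'a \<Rightarrow> complex) \<Rightarrow> nat \<Rightarrow> (nat \<Rightarrow> 'a) \<Rightarrow> complex" where
  "phi z n xs = (1 / fact n) * (\<Sum>G\<in>conn_graphs n. \<Prod>e\<in>G. z (xs (Min e)) (xs (Max e)))"

text \<open>The complex measure mu is represented by its total variation M = |mu| and
  a density h with |h| = 1, i.e. d mu = h d|mu|.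
  Iterated integrals over coordinates k, k+1, ..., k+m-1 (outermost = coordinate k).\<close>

primrec cint_iter :: "'a measure \<Rightarrow> ('a \<Rightarrow> complex) \<Rightarrow> nat \<Rightarrow> nat \<Rightarrow>
    ((nat \<Rightarrow> 'a) \<Rightarrow> complex) \<Rightarrow> (nat \<Rightarrow> 'a) \<Rightarrow> complex" where
  "cint_iter M h 0 k F xs = F xs"
| "cint_iter M h (Suc m) k F xs =
     (LINT z|M. h z * cint_iter M h m (Suc k) F (xs(k := z)))"

primrec nn_iter :: "'a measure \<Rightarrow> nat \<Rightarrow> nat \<Rightarrow>
    ((nat \<Rightarrow> 'a) \<Rightarrow> ennreal) \<Rightarrow> (nat \<Rightarrow> 'a) \<Rightarrow> ennreal" where
  "nn_iter M 0 k F xs = F xs"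
| "nn_iter M (Suc m) k F xs = (\<integral>\<^sup>+ z. nn_iter M m (Suc k) F (xs(k := z)) \<partial>M)"

text \<open>n-th term (n = j + 2) of the series defining Zhat(x,y):
  n(n-1) int d mu(x_3) ... int d mu(x_n) phi(x, y, x_3, ..., x_n).\<close>

definition Zterm :: "'a measure \<Rightarrow> ('a \<Rightarrow> complex) \<Rightarrow> ('a \<Rightarrow> 'a \<Rightarrow> complex) \<Rightarrow>
    'a \<Rightarrow> 'a \<Rightarrow> nat \<Rightarrow> complex" where
  "Zterm M h z x y j =
     of_nat ((j + 2) * (j + 1)) * cint_iter M h j 3 (phi z (j + 2)) ((\<lambda>_. x)(2 := y))"

definition Zhat :: "'a measure \<Rightarrow> ('a \<Rightarrow> complex) \<Rightarrow> ('a \<Rightarrow> 'a \<Rightarrow> complex) \<Rightarrow>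
    'a \<Rightarrow> 'a \<Rightarrow> complex" where
  "Zhat M h z x y = (\<Sum>j. Zterm M h z x y j)"

text \<open>chain_term M K w x y m =
  int d|mu|(x_1) ... int d|mu|(x_m) prod_{i=0}^m K(x_i,x_{i+1}) e^{w(x_i)},
  with x_0 = x and x_{m+1} = y.\<close>

definition chain_term :: "'a measure \<Rightarrow> ('a \<Rightarrow> 'a \<Rightarrow> real) \<Rightarrow> ('a \<Rightarrow> real) \<Rightarrow>
    'a \<Rightarrow> 'a \<Rightarrow> nat \<Rightarrow> ennreal" where
  "chain_term M K w x y m =
     nn_iter M m 1 (\<lambda>xs. \<Prod>i\<in>{0..m}. ennreal (K (xs i) (xs (Suc i)) * exp (w (xs i))))
       ((\<lambda>_. x)(Suc m := y))"

end

theory Submission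
  imports Defs
begin

text \<open>
  Both bounds come from a tree-graph inequality: up to the factor \<open>\<Prod>i. exp (2 * b (x i))\<close>
  (respectively \<open>\<Prod>i. exp (b (x i))\<close>) the sum over connected graphs is dominated by the sum over
  spanning trees with edge weights \<open>|\<zeta>|\<close> (respectively \<open>|u|\<close>).
  For \<open>\<zeta>\<close> one iterates the Kirkwood--Salsburg recursion, always removing a vertex whose
  interaction with the remaining roots is at most \<open>exp (2 * b)\<close>; for \<open>u\<close> one integrates the
  Brydges--Kennedy differential equation in the inverse temperature, after replacing hard cores by a
  large finite repulsion \<open>N\<close>, and lets \<open>N\<close> tend to infinity.

  A tree containing \<open>x\<close> and \<open>y\<close> is the path from \<open>x\<close> to \<open>y\<close> with rooted trees attached to its
  vertices. Assumption 2 bounds the integrated sum of the trees attached at a vertex \<open>s\<close> by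
  \<open>exp (a s)\<close>, and the path produces the chain of integrals on the right-hand side.
\<close>

section \<open>Weighted sums over rooted forests\<close>

text \<open>The vertex removed by the Kirkwood--Salsburg recursion depends on the configuration, so
  the bound has to be an object that remembers no order of removal. The forest sum is one: any root
  may be removed first (\<open>forest_step\<close>), and it is measurable in the points, hence can
  be integrated. With hard cores, an edge of strength N enters the flow with weight N. The Boltzmann
  factor of the cluster damps a hard pair essentially by exp(-(t - s) N), and the integral of N
  exp(-(t - s) N) over s stays below 1. This is the origin of the value 1 of \<open>ubar\<close> at
  infinite repulsion. Distributing integrated vertices over subtrees would produce multinomial
  coefficients. They are avoided by drawing the vertices from a finite pool of n labels with weight
  1/n per label. The sum C(s) of all chains from s to y solves C(s) = K(s,y) + int K(s,t) exp(a(t) +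
  c(t)) C(t), where c is 2b or b. The induction over forests uses it only as a supersolution, so it
  survives when the kernel is set to 0 at the points where the integral assumption fails.\<close>

lemma sum_Pow_disjoint_swap:
  assumes "finite Y"
  shows "(\<Sum>S\<in>Pow Y. \<Sum>Z\<in>Pow (Y - S). h S Z) = (\<Sum>Z\<in>Pow Y. \<Sum>S\<in>Pow (Y - Z). h S Z)"
proof -
  have *: "Pow (Y - S) = {Z \<in> Pow Y. S \<inter> Z = {}}" if "S \<in> Pow Y" for S using that by auto
  have **: "Pow (Y - Z) = {S \<in> Pow Y. S \<inter> Z = {}}" if "Z \<in> Pow Y" for Z using that by auto
  have "(\<Sum>S\<in>Pow Y. \<Sum>Z\<in>Pow (Y - S). h S Z) = (\<Sum>S\<in>Pow Y. \<Sum>Z | Z \<in> Pow Y \<and> S \<inter> Z = {}. h S Z)"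
    by (intro sum.cong refl) (simp only: *)
  also have "\<dots> = (\<Sum>Z\<in>Pow Y. \<Sum>S | S \<in> Pow Y \<and> S \<inter> Z = {}. h S Z)"
    using assms by (intro sum.swap_restrict) auto
  also have "\<dots> = (\<Sum>Z\<in>Pow Y. \<Sum>S\<in>Pow (Y - Z). h S Z)"
    by (intro sum.cong refl) (simp only: **)
  finally show ?thesis .
qed

lemma sum_Pow_disjoint_union:
  assumes "finite Y"
  shows "(\<Sum>Z\<in>Pow Y. \<Sum>W\<in>Pow (Y - Z). h Z W) = (\<Sum>A\<in>Pow Y. \<Sum>W\<in>Pow A. h (A - W) W)"
proof -
  have "(\<Sum>Z\<in>Pow Y. \<Sum>W\<in>Pow (Y - Z). h Z W) = (\<Sum>(Z,W)\<in>(SIGMA Z:Pow Y. Pow (Y - Z)). h Z W)"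
    using assms by (subst sum.Sigma) auto
  also have "\<dots> = (\<Sum>(A,W)\<in>(SIGMA A:Pow Y. Pow A). h (A - W) W)"
    by (rule sum.reindex_bij_witness[where i="\<lambda>(A,W). (A - W, W)" and j="\<lambda>(Z,W). (Z \<union> W, W)"])
       (auto intro!: arg_cong2[where f=h])
  also have "\<dots> = (\<Sum>A\<in>Pow Y. \<Sum>W\<in>Pow A. h (A - W) W)"
    using assms by (subst sum.Sigma) (auto dest: finite_subset)
  finally show ?thesis .
qed

lemma sum_Pow_mem:
  assumes "finite Y"
  shows "(\<Sum>S\<in>Pow Y. \<Sum>j\<in>S. h S j) = (\<Sum>j\<in>Y. \<Sum>Z\<in>Pow (Y - {j}). h (insert j Z) j)"
proof -
  have "(\<Sum>S\<in>Pow Y. \<Sum>j\<in>S. h S j) = (\<Sum>(S,j)\<in>(SIGMA S:Pow Y. S). h S j)"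
    using assms by (subst sum.Sigma) (auto dest: finite_subset)
  also have "\<dots> = (\<Sum>(j,Z)\<in>(SIGMA j:Y. Pow (Y - {j})). h (insert j Z) j)"
    by (rule sum.reindex_bij_witness[where i="\<lambda>(j,Z). (insert j Z, j)" and j="\<lambda>(S,j). (j, S - {j})"])
       (auto simp: insert_absorb)
  also have "\<dots> = (\<Sum>j\<in>Y. \<Sum>Z\<in>Pow (Y - {j}). h (insert j Z) j)"
    using assms by (subst sum.Sigma) auto
  finally show ?thesis .
qed

lemma sum_Pow_insert:
  assumes "finite Y" "q \<notin> Y"
  shows "(\<Sum>S\<in>Pow (insert q Y). h S) = (\<Sum>S\<in>Pow Y. h S + h (insert q S))"
proof -
  have "(\<Sum>S\<in>Pow (insert q Y). h S) = (\<Sum>S\<in>Pow Y. h S) + (\<Sum>S\<in>insert q ` Pow Y. h S)"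
    unfolding Pow_insert using assms by (intro sum.union_disjoint) auto
  also have "(\<Sum>S\<in>insert q ` Pow Y. h S) = (\<Sum>S\<in>Pow Y. h (insert q S))"
    using assms by (subst sum.reindex) (auto simp: inj_on_def)
  finally show ?thesis by (simp add: sum.distrib)
qed

lemma sum_Pow_remove_empty:
  assumes "finite Y"
  shows "(\<Sum>S\<in>Pow Y. h S) = h {} + (\<Sum>S\<in>Pow Y - {{}}. h S)"
  using assms by (subst sum.remove[of _ "{}"]) auto

lemma prod_one_plus_Pow:
  fixes f :: "'i \<Rightarrow> 'b::comm_semiring_1"
  assumes "finite A"
  shows "(\<Prod>i\<in>A. 1 + f i) = (\<Sum>S\<in>Pow A. \<Prod>i\<in>S. f i)"
  using assms
proof (induction A rule: finite_induct)
  case (insert x A)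
  have "(\<Sum>S\<in>Pow (insert x A). \<Prod>i\<in>S. f i) = (\<Sum>S\<in>Pow A. (\<Prod>i\<in>S. f i) + (\<Prod>i\<in>insert x S. f i))"
    using insert by (intro sum_Pow_insert) auto
  also have "\<dots> = (\<Sum>S\<in>Pow A. (1 + f x) * (\<Prod>i\<in>S. f i))"
  proof (intro sum.cong refl)
    fix S assume "S \<in> Pow A"
    then have "finite S" "x \<notin> S" using insert by (auto dest: finite_subset)
    then show "(\<Prod>i\<in>S. f i) + (\<Prod>i\<in>insert x S. f i) = (1 + f x) * (\<Prod>i\<in>S. f i)"
      by (simp add: algebra_simps)
  qed
  finally show ?case using insert by (simp add: sum_distrib_left)
qed simp

text \<open>The number \<open>card X + card Y\<close> drops because i disappears while S only
  changes sides. This is the scheme of root removal, with the children S of i becoming roots; as i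
  is arbitrary, a proof may remove whichever root suits it.\<close>

lemma finite_disjoint_pair_induct [consumes 3, case_names empty step]:
  assumes "finite X" "finite Y" "X \<inter> Y = {}"
    and empty: "\<And>Y. finite Y \<Longrightarrow> P {} Y"
    and step: "\<And>X Y. finite X \<Longrightarrow> finite Y \<Longrightarrow> X \<inter> Y = {} \<Longrightarrow> X \<noteq> {} \<Longrightarrow>
        (\<And>i S. i \<in> X \<Longrightarrow> S \<subseteq> Y \<Longrightarrow> P (X - {i} \<union> S) (Y - S)) \<Longrightarrow> P X Y"
  shows "P X Y"
  using assms(1-3)
proof (induction "card X + card Y" arbitrary: X Y rule: less_induct)
  case less
  show ?case
  proof (cases "X = {}")
    case True
    then show ?thesis using less empty by auto
  next
    case False
    show ?thesis
    proof (rule step[OF less.prems False])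
      fix i S assume i: "i \<in> X" and S: "S \<subseteq> Y"
      have finS: "finite S" using S less.prems finite_subset by auto
      have "card (X - {i} \<union> S) \<le> card (X - {i}) + card S" by (rule card_Un_le)
      moreover have "card (X - {i}) < card X" using i less.prems by (intro card_Diff1_less) auto
      moreover have "card (Y - S) = card Y - card S" using S finS by (simp add: card_Diff_subset)
      moreover have "card S \<le> card Y" using S less.prems by (intro card_mono) auto
      ultimately have "card (X - {i} \<union> S) + card (Y - S) < card X + card Y" by linarith
      then show "P (X - {i} \<union> S) (Y - S)"
        using less.prems S finS by (intro less.hyps) auto
    qed
  qed
qed

text \<open>For \<open>ch = Min\<close> and \<open>p = 1\<close> this is the sum, over the forests on \<open>X \<union> Y\<close> in which
  every tree contains exactly one vertex of \<open>X\<close>, of the products of the edge weights \<open>w\<close>;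
  the recursion removes the root \<open>ch X\<close> and turns its children \<open>S\<close> into roots.
  The prefactor \<open>p\<close> accommodates the Kirkwood--Salsburg recursion.\<close>

function gforest :: "(nat set \<Rightarrow> nat) \<Rightarrow> (nat \<Rightarrow> nat set \<Rightarrow> 'b) \<Rightarrow> (nat \<Rightarrow> nat \<Rightarrow> 'b) \<Rightarrow>
    nat set \<Rightarrow> nat set \<Rightarrow> 'b::comm_semiring_1" where
  "gforest ch p w X Y =
    (if finite X \<and> finite Y \<and> ch X \<in> X
     then p (ch X) (X - {ch X}) *
       (\<Sum>S\<in>Pow Y. (\<Prod>s\<in>S. w (ch X) s) * gforest ch p w (X - {ch X} \<union> S) (Y - S))
     else if Y = {} then 1 else 0)"
  by auto
termination
proof (relation "Wellfounded.measure (\<lambda>(ch, p, w, X, Y). card X + card Y)", goal_cases)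
  case (2 ch p w X Y S)
  then have S: "S \<subseteq> Y" "finite S" by (auto dest: finite_subset)
  have "card (X - {ch X} \<union> S) \<le> card (X - {ch X}) + card S" by (rule card_Un_le)
  moreover have "card (X - {ch X}) < card X" using 2 by (intro card_Diff1_less) auto
  moreover have "card (Y - S) = card Y - card S" using S by (simp add: card_Diff_subset)
  moreover have "card S \<le> card Y" using S 2 by (intro card_mono) auto
  ultimately show ?case by simp
qed simp

declare gforest.simps [simp del]

text \<open>\<open>Min\<close> is just one concrete choice of root; by \<open>forest_step\<close>
  the value does not depend on it.\<close>

definition forest :: "(nat \<Rightarrow> nat \<Rightarrow> 'b) \<Rightarrow> nat set \<Rightarrow> nat set \<Rightarrow> 'b::comm_semiring_1" where
  "forest = gforest Min (\<lambda>_ _. 1)"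

text \<open>Vertices that no root can reach admit no forest, and the empty forest has the empty
  product as its weight.\<close>

lemma forest_empty: "forest w {} Y = (if Y = {} then 1 else 0)"
  unfolding forest_def by (subst gforest.simps) simp

lemma forest_Min:
  assumes "finite X" "finite Y" "X \<noteq> {}"
  shows "forest w X Y =
    (\<Sum>S\<in>Pow Y. (\<Prod>s\<in>S. w (Min X) s) * forest w (X - {Min X} \<union> S) (Y - S))"
  unfolding forest_def using assms by (subst gforest.simps) simp

text \<open>Removing k = \<open>Min X\<close> and then i, or i and then k, gives the two roots
  disjoint sets of children and leaves the same forest behind. The induction hypothesis supplies the
  second removal in both orders, and exchanging the sums over disjoint pairs of child sets
  identifies them.\<close>

lemma forest_step:
  assumes "finite X" "finite Y" "X \<inter> Y = {}" "i \<in> X"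
  shows "forest w X Y = (\<Sum>S\<in>Pow Y. (\<Prod>s\<in>S. w i s) * forest w (X - {i} \<union> S) (Y - S))"
  using assms
proof (induction X Y arbitrary: i rule: finite_disjoint_pair_induct)
  case (step X Y)
  show ?case
  proof (cases "i = Min X")
    case True
    then show ?thesis using step forest_Min by blast
  next
    case False
    define k where "k = Min X"
    have k: "k \<in> X" "k \<noteq> i" using step False by (auto simp: k_def)
    have "forest w X Y = (\<Sum>S\<in>Pow Y. (\<Prod>s\<in>S. w k s) * forest w (X - {k} \<union> S) (Y - S))"
      using forest_Min step unfolding k_def by blast
    also have "\<dots> = (\<Sum>S\<in>Pow Y. \<Sum>Z\<in>Pow (Y - S). (\<Prod>s\<in>S. w k s) * ((\<Prod>s\<in>Z. w i s) *
         forest w (X - {k} \<union> S - {i} \<union> Z) (Y - S - Z)))"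
      using step k by (intro sum.cong refl, subst step.IH[of k _ i]) (auto simp: sum_distrib_left)
    also have "\<dots> = (\<Sum>Z\<in>Pow Y. \<Sum>S\<in>Pow (Y - Z). (\<Prod>s\<in>S. w k s) * ((\<Prod>s\<in>Z. w i s) *
         forest w (X - {k} \<union> S - {i} \<union> Z) (Y - S - Z)))"
      using step by (intro sum_Pow_disjoint_swap)
    also have "\<dots> = (\<Sum>Z\<in>Pow Y. (\<Prod>s\<in>Z. w i s) * forest w (X - {i} \<union> Z) (Y - Z))"
    proof (intro sum.cong refl)
      fix Z assume Z: "Z \<in> Pow Y"
      have eq: "X - {k} \<union> S - {i} \<union> Z = X - {i} \<union> Z - {k} \<union> S" "Y - S - Z = Y - Z - S"
        if "S \<in> Pow (Y - Z)" for S
        using that Z step k by auto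
      have "forest w (X - {i} \<union> Z) (Y - Z) = (\<Sum>S\<in>Pow (Y - Z). (\<Prod>s\<in>S. w k s) *
          forest w (X - {i} \<union> Z - {k} \<union> S) (Y - Z - S))"
        using Z step k by (intro step.IH) auto
      then show "(\<Sum>S\<in>Pow (Y - Z). (\<Prod>s\<in>S. w k s) * ((\<Prod>s\<in>Z. w i s) *
         forest w (X - {k} \<union> S - {i} \<union> Z) (Y - S - Z))) = (\<Prod>s\<in>Z. w i s) * forest w (X - {i} \<union> Z) (Y - Z)"
        by (auto simp: sum_distrib_left mult.left_commute eq intro!: sum.cong)
    qed
    finally show ?thesis .
  qed
qed simp

lemma forest_no_children:
  assumes "finite X" shows "forest w X {} = 1"
  using assms
proof (induction X rule: finite_induct)
  case (insert x X)
  then have "insert x X - {x} = X" by auto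
  then show ?case using insert by (subst forest_step[of _ _ x]) auto
qed (simp add: forest_empty)

text \<open>The trees of a forest are disjoint, and Z is the set of vertices below j in the tree
  rooted at j. Removing a root i other than j does not touch this division, which is the induction
  step.\<close>

lemma forest_insert_root:
  assumes "finite X" "finite Y" "X \<inter> Y = {}" "j \<notin> X" "j \<notin> Y"
  shows "forest w (insert j X) Y = (\<Sum>Z\<in>Pow Y. forest w X (Y - Z) * forest w {j} Z)"
  using assms
proof (induction X Y rule: finite_disjoint_pair_induct)
  case (empty Y)
  have "(\<Sum>Z\<in>Pow Y. forest w {} (Y - Z) * forest w {j} Z) = (\<Sum>Z\<in>Pow Y. if Z = Y then forest w {j} Y else 0)"
    by (intro sum.cong refl) (auto simp: forest_empty)
  then show ?case using empty by simp
next
  case (step X Y)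
  then obtain i where i: "i \<in> X" by auto
  have "forest w (insert j X) Y
      = (\<Sum>S\<in>Pow Y. (\<Prod>s\<in>S. w i s) * forest w (insert j X - {i} \<union> S) (Y - S))"
    using step i by (intro forest_step) auto
  also have "\<dots> = (\<Sum>S\<in>Pow Y. (\<Prod>s\<in>S. w i s) *
      (\<Sum>Z\<in>Pow (Y - S). forest w (X - {i} \<union> S) (Y - S - Z) * forest w {j} Z))"
  proof (intro sum.cong refl)
    fix S assume "S \<in> Pow Y"
    then have eq: "insert j X - {i} \<union> S = insert j (X - {i} \<union> S)" using step i by auto
    have "forest w (insert j (X - {i} \<union> S)) (Y - S) =
      (\<Sum>Z\<in>Pow (Y - S). forest w (X - {i} \<union> S) (Y - S - Z) * forest w {j} Z)"
      using step i \<open>S \<in> Pow Y\<close> by (intro step.IH) auto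
    then show "(\<Prod>s\<in>S. w i s) * forest w (insert j X - {i} \<union> S) (Y - S) = (\<Prod>s\<in>S. w i s) *
      (\<Sum>Z\<in>Pow (Y - S). forest w (X - {i} \<union> S) (Y - S - Z) * forest w {j} Z)"
      unfolding eq by simp
  qed
  also have "\<dots> = (\<Sum>S\<in>Pow Y. \<Sum>Z\<in>Pow (Y - S). (\<Prod>s\<in>S. w i s) *
      (forest w (X - {i} \<union> S) (Y - S - Z) * forest w {j} Z))"
    by (simp add: sum_distrib_left)
  also have "\<dots> = (\<Sum>Z\<in>Pow Y. \<Sum>S\<in>Pow (Y - Z). (\<Prod>s\<in>S. w i s) *
      (forest w (X - {i} \<union> S) (Y - S - Z) * forest w {j} Z))"
    using step by (intro sum_Pow_disjoint_swap)
  also have "\<dots> = (\<Sum>Z\<in>Pow Y. forest w X (Y - Z) * forest w {j} Z)"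
  proof (intro sum.cong refl)
    fix Z assume Z: "Z \<in> Pow Y"
    have "forest w X (Y - Z) = (\<Sum>S\<in>Pow (Y - Z). (\<Prod>s\<in>S. w i s) * forest w (X - {i} \<union> S) (Y - Z - S))"
      using Z step i by (intro forest_step) auto
    moreover have "Y - S - Z = Y - Z - S" for S by auto
    ultimately show "(\<Sum>S\<in>Pow (Y - Z). (\<Prod>s\<in>S. w i s) *
      (forest w (X - {i} \<union> S) (Y - S - Z) * forest w {j} Z)) = forest w X (Y - Z) * forest w {j} Z"
      by (simp add: sum_distrib_right mult.assoc)
  qed
  finally show ?case .
qed

lemma forest_nonneg:
  fixes w :: "nat \<Rightarrow> nat \<Rightarrow> real"
  assumes "finite X" "finite Y" "X \<inter> Y = {}" "\<And>i j. 0 \<le> w i j"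
  shows "0 \<le> forest w X Y"
  using assms(1-3)
proof (induction X Y rule: finite_disjoint_pair_induct)
  case (empty Y) then show ?case by (simp add: forest_empty)
next
  case (step X Y)
  then obtain i where i: "i \<in> X" by auto
  show ?case using step i assms
    by (subst forest_step[of _ _ i]) (auto intro!: sum_nonneg mult_nonneg_nonneg prod_nonneg)
qed

lemma ennreal_forest:
  fixes w :: "nat \<Rightarrow> nat \<Rightarrow> real"
  assumes "finite X" "finite Y" "X \<inter> Y = {}" "\<And>i j. 0 \<le> w i j"
  shows "ennreal (forest w X Y) = forest (\<lambda>i j. ennreal (w i j)) X Y"
  using assms(1-3)
proof (induction X Y rule: finite_disjoint_pair_induct)
  case (empty Y) then show ?case by (simp add: forest_empty)
next
  case (step X Y)
  then obtain i where i: "i \<in> X" by auto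
  have *: "ennreal ((\<Prod>s\<in>S. w i s) * forest w (X - {i} \<union> S) (Y - S)) =
     (\<Prod>s\<in>S. ennreal (w i s)) * forest (\<lambda>i j. ennreal (w i j)) (X - {i} \<union> S) (Y - S)" if "S \<in> Pow Y" for S
    using that i step assms(4)
    by (subst ennreal_mult) (auto simp: prod_ennreal intro!: prod_nonneg forest_nonneg dest: finite_subset)
  have "ennreal (forest w X Y) = (\<Sum>S\<in>Pow Y. ennreal ((\<Prod>s\<in>S. w i s) * forest w (X - {i} \<union> S) (Y - S)))"
    using step i assms(4) 
    by (subst forest_step[of _ _ i])
      (auto intro!: sum_ennreal[symmetric] mult_nonneg_nonneg prod_nonneg forest_nonneg dest: finite_subset)
  also have "\<dots> = forest (\<lambda>i j. ennreal (w i j)) X Y"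
    using step i by (subst (2) forest_step[of _ _ i]) (auto intro!: sum.cong *)
  finally show ?case .
qed

lemma forest_cong:
  assumes "finite X" "finite Y" "X \<inter> Y = {}"
    and "\<And>i j. i \<in> X \<union> Y \<Longrightarrow> j \<in> Y \<Longrightarrow> w i j = w' i j"
  shows "forest w X Y = forest w' X Y"
  using assms
proof (induction X Y rule: finite_disjoint_pair_induct)
  case (empty Y) then show ?case by (simp add: forest_empty)
next
  case (step X Y)
  then obtain i where i: "i \<in> X" by auto
  show ?case using step i
    by (subst (1 2) forest_step[of _ _ i]) (auto intro!: sum.cong arg_cong2[where f="(*)"] prod.cong step.IH)
qed

text \<open>An injection need not preserve \<open>Min\<close>, but by \<open>forest_step\<close> the
  image of any chosen root can be removed, so the two recursions run in parallel.\<close>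

lemma forest_image:
  assumes "finite X" "finite Y" "X \<inter> Y = {}" "inj_on \<pi> (X \<union> Y)"
  shows "forest w (\<pi> ` X) (\<pi> ` Y) = forest (\<lambda>i j. w (\<pi> i) (\<pi> j)) X Y"
  using assms
proof (induction X Y rule: finite_disjoint_pair_induct)
  case (empty Y) then show ?case by (simp add: forest_empty)
next
  case (step X Y)
  then obtain i where i: "i \<in> X" by auto
  have inj: "inj_on \<pi> Y" "\<pi> ` X \<inter> \<pi> ` Y = {}"
    using step.prems step.hyps by (auto simp: inj_on_def)
  have "forest w (\<pi> ` X) (\<pi> ` Y) = (\<Sum>S\<in>Pow (\<pi> ` Y). (\<Prod>s\<in>S. w (\<pi> i) s) *
      forest w (\<pi> ` X - {\<pi> i} \<union> S) (\<pi> ` Y - S))"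
    using step inj i by (intro forest_step) auto
  also have "Pow (\<pi> ` Y) = image \<pi> ` Pow Y" by (simp add: image_Pow_surj)
  also have "(\<Sum>S\<in>image \<pi> ` Pow Y. (\<Prod>s\<in>S. w (\<pi> i) s) * forest w (\<pi> ` X - {\<pi> i} \<union> S) (\<pi> ` Y - S))
      = (\<Sum>S\<in>Pow Y. (\<Prod>s\<in>\<pi> ` S. w (\<pi> i) s) * forest w (\<pi> ` X - {\<pi> i} \<union> \<pi> ` S) (\<pi> ` Y - \<pi> ` S))"
    by (subst sum.reindex) (use inj inj_on_image_Pow in auto)
  also have "\<dots> = (\<Sum>S\<in>Pow Y. (\<Prod>s\<in>S. w (\<pi> i) (\<pi> s)) *
      forest (\<lambda>i j. w (\<pi> i) (\<pi> j)) (X - {i} \<union> S) (Y - S))"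
  proof (intro sum.cong refl)
    fix S assume "S \<in> Pow Y"
    then have S: "S \<subseteq> Y" by auto
    have "inj_on \<pi> S" using inj S inj_on_subset by blast
    then have 1: "(\<Prod>s\<in>\<pi> ` S. w (\<pi> i) s) = (\<Prod>s\<in>S. w (\<pi> i) (\<pi> s))" by (simp add: prod.reindex)
    have 2: "\<pi> ` X - {\<pi> i} \<union> \<pi> ` S = \<pi> ` (X - {i} \<union> S)" "\<pi> ` Y - \<pi> ` S = \<pi> ` (Y - S)"
      using i S step.prems by (auto simp: inj_on_def)
    have "forest w (\<pi> ` (X - {i} \<union> S)) (\<pi> ` (Y - S)) = forest (\<lambda>i j. w (\<pi> i) (\<pi> j)) (X - {i} \<union> S) (Y - S)"
      using i S step.prems by (intro step.IH) (auto intro: inj_on_subset)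
    then show "(\<Prod>s\<in>\<pi> ` S. w (\<pi> i) s) * forest w (\<pi> ` X - {\<pi> i} \<union> \<pi> ` S) (\<pi> ` Y - \<pi> ` S)
      = (\<Prod>s\<in>S. w (\<pi> i) (\<pi> s)) * forest (\<lambda>i j. w (\<pi> i) (\<pi> j)) (X - {i} \<union> S) (Y - S)"
      by (simp only: 1 2)
  qed
  also have "\<dots> = forest (\<lambda>i j. w (\<pi> i) (\<pi> j)) X Y"
    using step i by (intro forest_step[symmetric]) auto
  finally show ?case .
qed

lemma tendsto_forest:
  fixes w :: "'n \<Rightarrow> nat \<Rightarrow> nat \<Rightarrow> real"
  assumes "finite X" "finite Y" "X \<inter> Y = {}"
    and lim: "\<And>i j. ((\<lambda>n. w n i j) \<longlongrightarrow> w' i j) F"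
  shows "((\<lambda>n. forest (w n) X Y) \<longlongrightarrow> forest w' X Y) F"
  using assms(1-3)
proof (induction X Y rule: finite_disjoint_pair_induct)
  case (empty Y) then show ?case by (simp add: forest_empty)
next
  case (step X Y)
  then obtain i where i: "i \<in> X" by auto
  show ?case using step i
    by (subst (1 2) forest_step[of _ _ i]) (auto intro!: tendsto_sum tendsto_mult tendsto_prod lim)
qed

text \<open>The product rule marks one edge of the forest. Let j be its lower endpoint and Z the set
  of vertices below j. Deleting the edge cuts off the tree of j with vertices Z, and the upper
  endpoint i can be any vertex of what is left, a root or not.\<close>

lemma has_real_derivative_forest:
  fixes w :: "real \<Rightarrow> nat \<Rightarrow> nat \<Rightarrow> real"
  assumes "finite X" "finite Y" "X \<inter> Y = {}"
    and der: "\<And>i j. ((\<lambda>s. w s i j) has_real_derivative w' i j) (at s)"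
  shows "((\<lambda>s. forest (w s) X Y) has_real_derivative
     (\<Sum>j\<in>Y. \<Sum>Z\<in>Pow (Y - {j}). (\<Sum>i\<in>X \<union> (Y - {j} - Z). w' i j) *
        (forest (w s) X (Y - {j} - Z) * forest (w s) {j} Z))) (at s)"
  using assms(1-3)
proof (induction X Y rule: finite_disjoint_pair_induct)
  case (empty Y)
  \<comment> \<open>Without roots, either vertices are left over and the forest factor vanishes, or
    none is left and there is no i to sum over.\<close>
  have zero: "(\<Sum>i\<in>Y - {j} - Z. w' i j) * (forest (w s) {} (Y - {j} - Z) * forest (w s) {j} Z) = 0" for j Z
  proof (cases "Y - {j} - Z = {}")
    case True
    then show ?thesis by (simp only: sum.empty mult_zero_left)
  qed (simp add: forest_empty)
  show ?case by (simp only: zero Un_empty_left sum.neutral_const) (simp add: forest_empty)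
next
  case (step X Y)
  then obtain r where r: "r \<in> X" by auto
  let ?f = "\<lambda>X Y. forest (w s) X Y"
  let ?D = "\<lambda>X Y. (\<Sum>j\<in>Y. \<Sum>Z\<in>Pow (Y - {j}). (\<Sum>i\<in>X \<union> (Y - {j} - Z). w' i j) * (?f X (Y - {j} - Z) * ?f {j} Z))"
  have "((\<lambda>s. \<Sum>S\<in>Pow Y. (\<Prod>k\<in>S. w s r k) * forest (w s) (X - {r} \<union> S) (Y - S)) has_real_derivative
     (\<Sum>S\<in>Pow Y. (\<Sum>j\<in>S. w' r j * (\<Prod>k\<in>S - {j}. w s r k)) * ?f (X - {r} \<union> S) (Y - S)
         + ?D (X - {r} \<union> S) (Y - S) * (\<Prod>k\<in>S. w s r k))) (at s)"
  proof (intro DERIV_sum DERIV_mult)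
    fix S assume "S \<in> Pow Y"
    show "((\<lambda>s. \<Prod>k\<in>S. w s r k) has_real_derivative (\<Sum>j\<in>S. w' r j * (\<Prod>k\<in>S - {j}. w s r k))) (at s)"
      by (rule has_field_derivative_prod) (rule der)
    show "((\<lambda>s. forest (w s) (X - {r} \<union> S) (Y - S)) has_real_derivative ?D (X - {r} \<union> S) (Y - S)) (at s)"
      using \<open>S \<in> Pow Y\<close> r by (intro step.IH) auto
  qed
  also have "(\<lambda>s. \<Sum>S\<in>Pow Y. (\<Prod>k\<in>S. w s r k) * forest (w s) (X - {r} \<union> S) (Y - S)) = (\<lambda>s. forest (w s) X Y)"
    using step r by (intro ext forest_step[symmetric])
  also have "(\<Sum>S\<in>Pow Y. (\<Sum>j\<in>S. w' r j * (\<Prod>k\<in>S - {j}. w s r k)) * ?f (X - {r} \<union> S) (Y - S)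
         + ?D (X - {r} \<union> S) (Y - S) * (\<Prod>k\<in>S. w s r k)) = ?D X Y"
  proof -
    \<comment> \<open>The marked edge joins the removed root r to one of its children j.
      \<open>forest_insert_root\<close> separates the tree of j, and the sum over the other children
      of r reassembles a forest with root set X.\<close>
    have A: "(\<Sum>S\<in>Pow Y. (\<Sum>j\<in>S. w' r j * (\<Prod>k\<in>S - {j}. w s r k)) * ?f (X - {r} \<union> S) (Y - S))
      = (\<Sum>j\<in>Y. \<Sum>Z\<in>Pow (Y - {j}). w' r j * (?f X (Y - {j} - Z) * ?f {j} Z))"
    proof -
      have "(\<Sum>S\<in>Pow Y. (\<Sum>j\<in>S. w' r j * (\<Prod>k\<in>S - {j}. w s r k)) * ?f (X - {r} \<union> S) (Y - S))
        = (\<Sum>S\<in>Pow Y. \<Sum>j\<in>S. w' r j * (\<Prod>k\<in>S - {j}. w s r k) * ?f (X - {r} \<union> S) (Y - S))"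
        by (simp add: sum_distrib_right)
      also have "\<dots> = (\<Sum>j\<in>Y. \<Sum>Z\<in>Pow (Y - {j}). w' r j * (\<Prod>k\<in>insert j Z - {j}. w s r k) *
          ?f (X - {r} \<union> insert j Z) (Y - insert j Z))"
        using step by (intro sum_Pow_mem)
      also have "\<dots> = (\<Sum>j\<in>Y. w' r j * (\<Sum>S\<in>Pow (Y - {j}). (\<Prod>k\<in>S. w s r k) *
          (\<Sum>Z\<in>Pow (Y - {j} - S). ?f (X - {r} \<union> S) (Y - {j} - S - Z) * ?f {j} Z)))"
      proof (intro sum.cong refl, unfold sum_distrib_left[of "w' r _"], intro sum.cong refl)
        fix j S assume j: "j \<in> Y" and S: "S \<in> Pow (Y - {j})"
        have f: "?f (insert j (X - {r} \<union> S)) (Y - {j} - S) =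
           (\<Sum>Z\<in>Pow (Y - {j} - S). ?f (X - {r} \<union> S) (Y - {j} - S - Z) * ?f {j} Z)"
        proof (rule forest_insert_root)
          show "finite (X - {r} \<union> S)" using step.hyps S finite_subset[of S Y] by auto
        qed (use j S step.hyps in auto)
        have eq: "X - {r} \<union> insert j S = insert j (X - {r} \<union> S)" "Y - insert j S = Y - {j} - S"
          "insert j S - {j} = S" using j S by auto
        show "w' r j * (\<Prod>k\<in>insert j S - {j}. w s r k) * ?f (X - {r} \<union> insert j S) (Y - insert j S)
          = w' r j * ((\<Prod>k\<in>S. w s r k) *
          (\<Sum>Z\<in>Pow (Y - {j} - S). ?f (X - {r} \<union> S) (Y - {j} - S - Z) * ?f {j} Z))"
          unfolding eq f by (simp only: mult.assoc)
      qed
      also have "\<dots> = (\<Sum>j\<in>Y. w' r j * (\<Sum>Z\<in>Pow (Y - {j}). ?f X (Y - {j} - Z) * ?f {j} Z))"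
      proof (rule sum.cong[OF refl], rule arg_cong2[where f="(*)", OF refl])
        fix j assume j: "j \<in> Y"
        have "(\<Sum>S\<in>Pow (Y - {j}). (\<Prod>k\<in>S. w s r k) *
            (\<Sum>Z\<in>Pow (Y - {j} - S). ?f (X - {r} \<union> S) (Y - {j} - S - Z) * ?f {j} Z))
          = (\<Sum>S\<in>Pow (Y - {j}). \<Sum>Z\<in>Pow (Y - {j} - S). (\<Prod>k\<in>S. w s r k) *
              (?f (X - {r} \<union> S) (Y - {j} - S - Z) * ?f {j} Z))"
          by (simp add: sum_distrib_left)
        also have "\<dots> = (\<Sum>Z\<in>Pow (Y - {j}). \<Sum>S\<in>Pow (Y - {j} - Z). (\<Prod>k\<in>S. w s r k) *
              (?f (X - {r} \<union> S) (Y - {j} - S - Z) * ?f {j} Z))"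
          using step by (intro sum_Pow_disjoint_swap) auto
        also have "\<dots> = (\<Sum>Z\<in>Pow (Y - {j}). ?f X (Y - {j} - Z) * ?f {j} Z)"
        proof (intro sum.cong refl)
          fix Z assume Z: "Z \<in> Pow (Y - {j})"
          have "?f X (Y - {j} - Z) = (\<Sum>S\<in>Pow (Y - {j} - Z). (\<Prod>k\<in>S. w s r k) *
             ?f (X - {r} \<union> S) (Y - {j} - Z - S))"
            using step r by (intro forest_step) auto
          moreover have "Y - {j} - Z - S = Y - {j} - S - Z" for S by auto
          ultimately show "(\<Sum>S\<in>Pow (Y - {j} - Z). (\<Prod>k\<in>S. w s r k) *
              (?f (X - {r} \<union> S) (Y - {j} - S - Z) * ?f {j} Z)) = ?f X (Y - {j} - Z) * ?f {j} Z"
            by (simp add: sum_distrib_right mult.assoc)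
        qed
        finally show "(\<Sum>S\<in>Pow (Y - {j}). (\<Prod>k\<in>S. w s r k) *
            (\<Sum>Z\<in>Pow (Y - {j} - S). ?f (X - {r} \<union> S) (Y - {j} - S - Z) * ?f {j} Z)) =
            (\<Sum>Z\<in>Pow (Y - {j}). ?f X (Y - {j} - Z) * ?f {j} Z)" .
      qed
      finally show ?thesis by (simp add: sum_distrib_left)
    qed
    \<comment> \<open>The marked edge does not start at r. Its upper endpoint then lies in X - {r},
      among the children S or below, and the sum over S is reassembled with the marked edge held
      fixed.\<close>
    have B: "(\<Sum>S\<in>Pow Y. ?D (X - {r} \<union> S) (Y - S) * (\<Prod>k\<in>S. w s r k))
      = (\<Sum>j\<in>Y. \<Sum>Z\<in>Pow (Y - {j}). (\<Sum>i\<in>X - {r} \<union> (Y - {j} - Z). w' i j) * (?f X (Y - {j} - Z) * ?f {j} Z))"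
    proof -
      let ?t = "\<lambda>S j Z. (\<Sum>i\<in>X - {r} \<union> (Y - {j} - Z). w' i j) *
          ((\<Prod>k\<in>S. w s r k) * ?f (X - {r} \<union> S) (Y - {j} - Z - S) * ?f {j} Z)"
      have "(\<Sum>S\<in>Pow Y. ?D (X - {r} \<union> S) (Y - S) * (\<Prod>k\<in>S. w s r k))
        = (\<Sum>S\<in>Pow Y. \<Sum>j\<in>Y - S. \<Sum>Z\<in>Pow (Y - S - {j}). ?t S j Z)"
      proof (intro sum.cong refl, unfold sum_distrib_right[where r="prod _ _"], intro sum.cong refl)
        fix S j Z assume *: "S \<in> Pow Y" "j \<in> Y - S" "Z \<in> Pow (Y - S - {j})"
        have 1: "X - {r} \<union> S \<union> (Y - {j} - Z - S) = X - {r} \<union> (Y - {j} - Z)"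
          "Y - S - {j} - Z = Y - {j} - Z - S" using * by auto
        show "(\<Sum>i\<in>X - {r} \<union> S \<union> (Y - S - {j} - Z). w' i j) *
            (?f (X - {r} \<union> S) (Y - S - {j} - Z) * ?f {j} Z) * (\<Prod>k\<in>S. w s r k) = ?t S j Z"
          unfolding 1(2) unfolding 1(1) by (simp add: mult_ac)
      qed
      also have "\<dots> = (\<Sum>S\<in>Pow Y. \<Sum>j | j \<in> Y \<and> j \<notin> S. \<Sum>Z\<in>Pow (Y - S - {j}). ?t S j Z)"
        by (intro sum.cong) auto
      also have "\<dots> = (\<Sum>j\<in>Y. \<Sum>S | S \<in> Pow Y \<and> j \<notin> S. \<Sum>Z\<in>Pow (Y - S - {j}). ?t S j Z)"
        using step by (intro sum.swap_restrict) auto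
      also have "\<dots> = (\<Sum>j\<in>Y. \<Sum>S\<in>Pow (Y - {j}). \<Sum>Z\<in>Pow (Y - {j} - S). ?t S j Z)"
      proof (intro sum.cong)
        fix j S show "Pow (Y - S - {j}) = Pow (Y - {j} - S)" by auto
      qed auto
      also have "\<dots> = (\<Sum>j\<in>Y. \<Sum>Z\<in>Pow (Y - {j}). \<Sum>S\<in>Pow (Y - {j} - Z). ?t S j Z)"
        using step by (intro sum.cong refl sum_Pow_disjoint_swap) auto
      also have "\<dots> = (\<Sum>j\<in>Y. \<Sum>Z\<in>Pow (Y - {j}). (\<Sum>i\<in>X - {r} \<union> (Y - {j} - Z). w' i j) *
           (?f X (Y - {j} - Z) * ?f {j} Z))"
      proof (intro sum.cong refl)
        fix j Z assume "j \<in> Y" "Z \<in> Pow (Y - {j})"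
        have "?f X (Y - {j} - Z) = (\<Sum>S\<in>Pow (Y - {j} - Z). (\<Prod>k\<in>S. w s r k) *
             ?f (X - {r} \<union> S) (Y - {j} - Z - S))"
          using step r by (intro forest_step) auto
        then show "(\<Sum>S\<in>Pow (Y - {j} - Z). ?t S j Z) = (\<Sum>i\<in>X - {r} \<union> (Y - {j} - Z). w' i j) *
           (?f X (Y - {j} - Z) * ?f {j} Z)"
          by (simp only: sum_distrib_right[symmetric] sum_distrib_left[symmetric])
      qed
      finally show ?thesis .
    qed
    \<comment> \<open>The terms A are those with i = r, so A and B together exhaust the upper
      endpoints i.\<close>
    have C: "(\<Sum>i\<in>X \<union> V. w' i j) = w' r j + (\<Sum>i\<in>X - {r} \<union> V. w' i j)" if "V \<subseteq> Y" for V j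
    proof -
      have "X \<union> V = insert r (X - {r} \<union> V)" "r \<notin> X - {r} \<union> V" "finite (X - {r} \<union> V)"
        using that step r by (auto dest: finite_subset)
      then show ?thesis by (metis sum.insert)
    qed
    show ?thesis
      unfolding sum.distrib A B
      unfolding sum.distrib[symmetric]
      by (intro sum.cong refl, subst C) (auto simp: algebra_simps)
  qed
  finally show ?case .
qed

section \<open>Connected graphs and the Kirkwood--Salsburg recursion\<close>

definition vpairs :: "nat set \<Rightarrow> nat set set" where
  "vpairs V = {{i, j} | i j. i \<in> V \<and> j \<in> V \<and> i \<noteq> j}"

definition connected_on :: "nat set \<Rightarrow> nat set set \<Rightarrow> bool" where
  "connected_on V E \<longleftrightarrow> E \<subseteq> vpairs V \<and>
     (\<forall>i\<in>V. \<forall>j\<in>V. (i, j) \<in> {(p, q). {p, q} \<in> E}\<^sup>*)"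

text \<open>On {1..n} this is n! times the Ursell function. The vertex set is arbitrary because the
  recursions pass to subsets, and weights on unordered pairs build in the symmetry of the
  interaction.\<close>

definition conn_sum :: "(nat set \<Rightarrow> 'b) \<Rightarrow> nat set \<Rightarrow> 'b::comm_ring_1" where
  "conn_sum z V = (\<Sum>E | connected_on V E. \<Prod>e\<in>E. z e)"

text \<open>The Boltzmann factor of V; expanded, it is the sum over all graphs on V, connected or
  not.\<close>

definition pair_prod :: "(nat set \<Rightarrow> 'b) \<Rightarrow> nat set \<Rightarrow> 'b::comm_ring_1" where
  "pair_prod z V = (\<Prod>e\<in>vpairs V. 1 + z e)"

lemma conn_graphs_eq: "conn_graphs n = {E. connected_on {1..n} E}"
  by (simp add: conn_graphs_def connected_graph_def connected_on_def edges_on_def vpairs_def)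

lemma finite_vpairs: "finite V \<Longrightarrow> finite (vpairs V)"
  by (rule finite_subset[of _ "Pow V"]) (auto simp: vpairs_def)

lemma vpairs_empty [simp]: "vpairs {} = {}" by (auto simp: vpairs_def)

lemma vpairs_singleton [simp]: "vpairs {r} = {}" by (auto simp: vpairs_def)

lemma vpairs_mono: "A \<subseteq> B \<Longrightarrow> vpairs A \<subseteq> vpairs B" by (auto simp: vpairs_def)

lemma vpairs_insert: "i \<notin> A \<Longrightarrow> vpairs (insert i A) = vpairs A \<union> (\<lambda>j. {i, j}) ` A"
  by (auto simp: vpairs_def)

lemma vpairs_disjoint: "A \<inter> B = {} \<Longrightarrow> vpairs A \<inter> vpairs B = {}"
  by (auto simp: vpairs_def doubleton_eq_iff)

lemma prod_vpairs_insert: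
  assumes "finite A" "i \<notin> A"
  shows "(\<Prod>e\<in>vpairs (insert i A). f e) = (\<Prod>j\<in>A. f {i, j}) * (\<Prod>e\<in>vpairs A. f e)"
proof -
  have "vpairs A \<inter> (\<lambda>j. {i, j}) ` A = {}" using assms by (auto simp: vpairs_def doubleton_eq_iff)
  moreover have "inj_on (\<lambda>j. {i, j}) A" by (auto simp: inj_on_def doubleton_eq_iff)
  ultimately show ?thesis
    using assms by (simp add: vpairs_insert prod.union_disjoint finite_vpairs prod.reindex mult.commute)
qed

lemma pair_prod_insert:
  assumes "finite A" "i \<notin> A"
  shows "pair_prod z (insert i A) = (\<Prod>j\<in>A. 1 + z {i, j}) * pair_prod z A"
  unfolding pair_prod_def using assms by (rule prod_vpairs_insert)

lemma pair_prod_empty [simp]: "pair_prod z {} = 1" by (simp add: pair_prod_def)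

lemma conn_sum_singleton [simp]: "conn_sum z {r} = 1"
proof -
  have "{E. connected_on {r} E} = {{}}" by (auto simp: connected_on_def)
  then show ?thesis by (simp add: conn_sum_def)
qed

text \<open>With \<open>component_split\<close> this yields the bijection between graphs on V with
  component C at r and pairs of a connected graph on C and an arbitrary graph on V - C.\<close>

lemma component_union:
  assumes C: "connected_on C E" "r \<in> C" and E': "E' \<subseteq> vpairs (V - C)"
  shows "{j. (r, j) \<in> {(p, q). {p, q} \<in> E \<union> E'}\<^sup>*} = C"
proof (intro set_eqI iffI; clarify?)
  fix j assume "(r, j) \<in> {(p, q). {p, q} \<in> E \<union> E'}\<^sup>*"
  then show "j \<in> C"
  proof (induction rule: rtrancl_induct)
    case (step y z)
    have "{y, z} \<notin> E'" using step E' by (auto simp: vpairs_def doubleton_eq_iff)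
    then have "{y, z} \<in> vpairs C" using step C by (auto simp: connected_on_def)
    then show ?case by (auto simp: vpairs_def doubleton_eq_iff)
  qed (rule C)
next
  fix j assume "j \<in> C"
  then have "(r, j) \<in> {(p, q). {p, q} \<in> E}\<^sup>*" using C by (auto simp: connected_on_def)
  then show "(r, j) \<in> {(p, q). {p, q} \<in> E \<union> E'}\<^sup>*"
    by (rule rtrancl_mono[THEN subsetD, rotated]) auto
qed

lemma component_split:
  assumes E: "E \<subseteq> vpairs V" and C: "C = {j. (r, j) \<in> {(p, q). {p, q} \<in> E}\<^sup>*}"
  shows "connected_on C (E \<inter> vpairs C)" "E - vpairs C \<subseteq> vpairs (V - C)"
proof -
  have edge: "q \<in> C" if "p \<in> C" "{p, q} \<in> E" for p q
    using that unfolding C by (auto intro: rtrancl_into_rtrancl)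
  have edge': "{p, q} \<in> vpairs C" if "p \<in> C" "{p, q} \<in> E" for p q
  proof -
    have "p \<noteq> q" using that E by (auto simp: vpairs_def doubleton_eq_iff)
    then show ?thesis using that edge unfolding vpairs_def by blast
  qed
  let ?R = "{(p, q). {p, q} \<in> E \<inter> vpairs C}"
  have reach: "(r, j) \<in> ?R\<^sup>*" if "j \<in> C" for j
  proof -
    have "(r, j) \<in> {(p, q). {p, q} \<in> E}\<^sup>*" using that by (simp add: C)
    then show ?thesis
    proof (induction rule: rtrancl_induct)
      case (step y z)
      then have "y \<in> C" by (simp add: C)
      then have "(y, z) \<in> ?R" using step edge' by auto
      then show ?case using step by (meson rtrancl_into_rtrancl)
    qed simp
  qed
  have "sym ?R" by (auto simp: sym_def insert_commute)
  then have "sym (?R\<^sup>*)" by (rule sym_rtrancl)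
  then have "(i, j) \<in> ?R\<^sup>*" if "i \<in> C" "j \<in> C" for i j
    using reach[OF that(1)] reach[OF that(2)] by (meson symD rtrancl_trans)
  then show "connected_on C (E \<inter> vpairs C)" by (auto simp: connected_on_def)
  show "E - vpairs C \<subseteq> vpairs (V - C)"
  proof
    fix e assume e: "e \<in> E - vpairs C"
    then obtain p q where pq: "e = {p, q}" "p \<in> V" "q \<in> V" "p \<noteq> q" using E by (auto simp: vpairs_def)
    have "p \<notin> C" using edge'[of p q] e pq by auto
    moreover have "q \<notin> C" using edge'[of q p] e pq by (auto simp: insert_commute)
    ultimately show "e \<in> vpairs (V - C)" using pq by (auto simp: vpairs_def)
  qed
qed

text \<open>Expand the product into all graphs on V and group them by the component of r. On its
  complement Z the graph is unrestricted, so the sum over that part is again a Boltzmann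
  factor.\<close>

lemma pair_prod_component:
  assumes "finite V" "r \<in> V"
  shows "pair_prod z V = (\<Sum>Z\<in>Pow (V - {r}). conn_sum z (V - Z) * pair_prod z Z)"
proof -
  let ?comp = "\<lambda>E. {j. (r, j) \<in> {(p, q). {p, q} \<in> E}\<^sup>*}"
  have comp: "V - ?comp E \<in> Pow (V - {r})" for E by auto
  have compV: "?comp E \<subseteq> V" if "E \<subseteq> vpairs V" for E
  proof
    fix j assume "j \<in> ?comp E"
    then have "(r, j) \<in> {(p, q). {p, q} \<in> E}\<^sup>*" by simp
    then show "j \<in> V"
    proof (induction rule: rtrancl_induct)
      case (step y z)
      then have "{y, z} \<in> vpairs V" using that by auto
      then show ?case by (auto simp: vpairs_def doubleton_eq_iff)
    qed (rule assms)
  qed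
  have "pair_prod z V = (\<Sum>E\<in>Pow (vpairs V). \<Prod>e\<in>E. z e)"
    unfolding pair_prod_def using assms by (intro prod_one_plus_Pow finite_vpairs)
  also have "\<dots> = (\<Sum>Z\<in>Pow (V - {r}). \<Sum>E | E \<in> Pow (vpairs V) \<and> V - ?comp E = Z. \<Prod>e\<in>E. z e)"
    using assms comp by (intro sum.group[symmetric]) (auto simp: finite_vpairs)
  also have "\<dots> = (\<Sum>Z\<in>Pow (V - {r}). conn_sum z (V - Z) * pair_prod z Z)"
  proof (intro sum.cong refl)
    fix Z assume Z: "Z \<in> Pow (V - {r})"
    define C where "C = V - Z"
    have rC: "r \<in> C" "Z = V - C" "C \<subseteq> V" "finite C" "finite Z" "C \<inter> Z = {}"
      using Z assms by (auto simp: C_def dest: finite_subset)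
    have "conn_sum z C * pair_prod z Z =
        (\<Sum>E1 | connected_on C E1. \<Sum>E2\<in>Pow (vpairs Z). (\<Prod>e\<in>E1. z e) * (\<Prod>e\<in>E2. z e))"
      unfolding conn_sum_def pair_prod_def using rC
      by (simp add: prod_one_plus_Pow finite_vpairs sum_product)
    also have "\<dots> = (\<Sum>(E1, E2)\<in>{E. connected_on C E} \<times> Pow (vpairs Z). (\<Prod>e\<in>E1. z e) * (\<Prod>e\<in>E2. z e))"
      by (simp add: sum.cartesian_product)
    also have "\<dots> = (\<Sum>E | E \<in> Pow (vpairs V) \<and> V - ?comp E = Z. \<Prod>e\<in>E. z e)"
    proof (rule sum.reindex_bij_witness[where j="\<lambda>(E1, E2). E1 \<union> E2" and i="\<lambda>E. (E \<inter> vpairs C, E - vpairs C)"], goal_cases)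
      case (1 a)
      obtain E1 E2 where a: "a = (E1, E2)" by force
      have "E1 \<subseteq> vpairs C" "E2 \<subseteq> vpairs Z" using 1 a by (auto simp: connected_on_def)
      then show ?case using vpairs_disjoint[OF rC(6)] a by auto
    next
      case (2 a)
      obtain E1 E2 where a: "a = (E1, E2)" by force
      have E: "connected_on C E1" "E1 \<subseteq> vpairs C" "E2 \<subseteq> vpairs (V - C)"
        using 2 a rC by (auto simp: connected_on_def)
      have "?comp (E1 \<union> E2) = C" using component_union[OF E(1) rC(1) E(3)] .
      moreover have "E1 \<union> E2 \<subseteq> vpairs V"
        using E vpairs_mono[of C V] vpairs_mono[of "V - C" V] rC by blast
      ultimately show ?case using a rC(2) by simp
    next
      case (3 E) then show ?case by auto
    next
      case (4 E)
      then have "?comp E = C" using compV[of E] unfolding C_def by blast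
      then show ?case using component_split[of E V C r] 4 rC(2) by auto
    next
      case (5 a)
      obtain E1 E2 where a: "a = (E1, E2)" by force
      have E: "E1 \<subseteq> vpairs C" "E2 \<subseteq> vpairs Z" using 5 a by (auto simp: connected_on_def)
      moreover have "finite E1" "finite E2"
        using E rC(4,5) finite_vpairs finite_subset by blast+
      ultimately have "finite E1" "finite E2" "E1 \<inter> E2 = {}"
        using vpairs_disjoint[OF rC(6)] by auto
      then show ?case by (simp add: a prod.union_disjoint)
    qed
    finally show "(\<Sum>E | E \<in> Pow (vpairs V) \<and> V - ?comp E = Z. \<Prod>e\<in>E. z e)
        = conn_sum z (V - Z) * pair_prod z Z" by (simp add: C_def)
  qed
  finally show ?thesis .
qed

text \<open>The prefactor of \<open>gforest\<close> contains the interactions of i =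
  \<open>ch X\<close> with the other roots, and the sum over its children S expands its interactions
  with Y. By the induction hypothesis nothing else depends on S, so one vertex is split off the
  Boltzmann factor, whatever \<open>ch\<close> selects.\<close>

lemma gforest_convolution:
  fixes z :: "nat set \<Rightarrow> 'b::comm_ring_1"
  defines "g \<equiv> \<lambda>ch. gforest ch (\<lambda>i A. \<Prod>j\<in>A. 1 + z {i, j}) (\<lambda>i j. z {i, j})"
  assumes ch: "\<And>X. finite X \<Longrightarrow> X \<noteq> {} \<Longrightarrow> ch X \<in> X"
    and "finite X" "finite Y" "X \<inter> Y = {}"
  shows "(\<Sum>Z\<in>Pow Y. g ch X (Y - Z) * pair_prod z Z) = pair_prod z (X \<union> Y)"
  using assms(3-5)
proof (induction X Y rule: finite_disjoint_pair_induct)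
  case (empty Y)
  have "g ch {} V = (if V = {} then 1 else 0)" for V
    unfolding g_def by (subst gforest.simps) simp
  then have "(\<Sum>Z\<in>Pow Y. g ch {} (Y - Z) * pair_prod z Z) = (\<Sum>Z\<in>Pow Y. if Z = Y then pair_prod z Y else 0)"
    by (intro sum.cong refl) auto
  then show ?case using empty by simp
next
  case (step X Y)
  define i where "i = ch X"
  have i: "i \<in> X" using ch step by (simp add: i_def)
  let ?P = "\<lambda>A. (\<Prod>j\<in>A. 1 + z {i, j})"
  have g: "g ch X V = ?P (X - {i}) * (\<Sum>S\<in>Pow V. (\<Prod>s\<in>S. z {i, s}) * g ch (X - {i} \<union> S) (V - S))" if "V \<subseteq> Y" for V
    using step i that unfolding g_def i_def by (subst gforest.simps) (auto dest: finite_subset)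
  have "(\<Sum>Z\<in>Pow Y. g ch X (Y - Z) * pair_prod z Z) =
    (\<Sum>Z\<in>Pow Y. ?P (X - {i}) * (\<Sum>S\<in>Pow (Y - Z). (\<Prod>s\<in>S. z {i, s}) * g ch (X - {i} \<union> S) (Y - Z - S)) * pair_prod z Z)"
    by (intro sum.cong refl, subst g) auto
  also have "\<dots> = ?P (X - {i}) * (\<Sum>Z\<in>Pow Y. \<Sum>S\<in>Pow (Y - Z). (\<Prod>s\<in>S. z {i, s}) * g ch (X - {i} \<union> S) (Y - Z - S) * pair_prod z Z)"
    by (simp add: sum_distrib_left sum_distrib_right mult.assoc)
  also have "(\<Sum>Z\<in>Pow Y. \<Sum>S\<in>Pow (Y - Z). (\<Prod>s\<in>S. z {i, s}) * g ch (X - {i} \<union> S) (Y - Z - S) * pair_prod z Z)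
    = (\<Sum>S\<in>Pow Y. \<Sum>Z\<in>Pow (Y - S). (\<Prod>s\<in>S. z {i, s}) * g ch (X - {i} \<union> S) (Y - Z - S) * pair_prod z Z)"
    using step by (intro sum_Pow_disjoint_swap)
  also have "\<dots> = (\<Sum>S\<in>Pow Y. (\<Prod>s\<in>S. z {i, s}) * pair_prod z (X - {i} \<union> Y))"
  proof (intro sum.cong refl)
    fix S assume S: "S \<in> Pow Y"
    have "(\<Sum>Z\<in>Pow (Y - S). g ch (X - {i} \<union> S) (Y - S - Z) * pair_prod z Z) = pair_prod z (X - {i} \<union> S \<union> (Y - S))"
      using S i by (intro step.IH) auto
    moreover have "X - {i} \<union> S \<union> (Y - S) = X - {i} \<union> Y" using S by auto
    moreover have "Y - Z - S = Y - S - Z" for Z by auto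
    ultimately show "(\<Sum>Z\<in>Pow (Y - S). (\<Prod>s\<in>S. z {i, s}) * g ch (X - {i} \<union> S) (Y - Z - S) * pair_prod z Z)
      = (\<Prod>s\<in>S. z {i, s}) * pair_prod z (X - {i} \<union> Y)"
      by (simp add: mult.assoc sum_distrib_left[symmetric])
  qed
  also have "\<dots> = ?P Y * pair_prod z (X - {i} \<union> Y)"
    using step by (simp add: prod_one_plus_Pow sum_distrib_right)
  also have "?P (X - {i}) * (?P Y * pair_prod z (X - {i} \<union> Y)) = ?P (X - {i} \<union> Y) * pair_prod z (X - {i} \<union> Y)"
    using step by (subst prod.union_disjoint) (auto simp: mult.assoc)
  also have "\<dots> = pair_prod z (insert i (X - {i} \<union> Y))"
    using step i by (subst pair_prod_insert) auto
  also have "insert i (X - {i} \<union> Y) = X \<union> Y" using i by auto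
  finally show ?case .
qed

text \<open>Convolved with \<open>pair_prod\<close>, both sides give the Boltzmann factor of
  \<open>insert r Y\<close>. The term Z = {} has coefficient 1, so the convolution can be inverted
  by induction over Y. Since \<open>ch\<close> stays free, it can be adapted to the stability bound
  afterwards.\<close>

lemma conn_sum_eq_gforest:
  fixes z :: "nat set \<Rightarrow> 'b::comm_ring_1"
  assumes ch: "\<And>X. finite X \<Longrightarrow> X \<noteq> {} \<Longrightarrow> ch X \<in> X"
    and "finite Y" "r \<notin> Y"
  shows "conn_sum z (insert r Y) = gforest ch (\<lambda>i A. \<Prod>j\<in>A. 1 + z {i, j}) (\<lambda>i j. z {i, j}) {r} Y"
  using assms(2-3)
proof (induction Y rule: finite_psubset_induct)
  case (psubset Y)
  let ?g = "gforest ch (\<lambda>i A. \<Prod>j\<in>A. 1 + z {i, j}) (\<lambda>i j. z {i, j}) {r}"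
  have "(\<Sum>Z\<in>Pow Y. conn_sum z (insert r Y - Z) * pair_prod z Z) = pair_prod z (insert r Y)"
    using psubset by (subst pair_prod_component[of "insert r Y" r]) auto
  also have "\<dots> = (\<Sum>Z\<in>Pow Y. ?g (Y - Z) * pair_prod z Z)"
    using gforest_convolution[where X="{r}" and Y=Y and ch=ch and z=z] ch psubset by auto
  finally have "conn_sum z (insert r Y) + (\<Sum>Z\<in>Pow Y - {{}}. conn_sum z (insert r Y - Z) * pair_prod z Z)
    = ?g Y + (\<Sum>Z\<in>Pow Y - {{}}. ?g (Y - Z) * pair_prod z Z)"
    using psubset by (simp add: sum_Pow_remove_empty)
  moreover have "(\<Sum>Z\<in>Pow Y - {{}}. conn_sum z (insert r Y - Z) * pair_prod z Z)
    = (\<Sum>Z\<in>Pow Y - {{}}. ?g (Y - Z) * pair_prod z Z)"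
  proof (intro sum.cong refl arg_cong2[where f="(*)"])
    fix Z assume Z: "Z \<in> Pow Y - {{}}"
    then have "Y - Z \<subset> Y" "insert r Y - Z = insert r (Y - Z)" using psubset by auto
    then show "conn_sum z (insert r Y - Z) = ?g (Y - Z)" using psubset by auto
  qed
  ultimately show ?case by simp
qed

text \<open>The product over \<open>i \<in> X\<close> of the interactions of \<open>i\<close> with the rest of \<open>X\<close> is the square of
  the product over all pairs, so not every \<open>i\<close> can exceed its share \<open>exp (2 * \<beta> i)\<close>.\<close>

lemma stability_exists_vertex:
  fixes z :: "nat set \<Rightarrow> complex"
  assumes "finite X" "X \<noteq> {}"
    and stab: "(\<Prod>e\<in>vpairs X. cmod (1 + z e)) \<le> (\<Prod>i\<in>X. exp (\<beta> i))"
  shows "\<exists>i\<in>X. (\<Prod>j\<in>X - {i}. cmod (1 + z {i, j})) \<le> exp (2 * \<beta> i)"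
proof (rule ccontr)
  assume "\<not> ?thesis"
  then have lt: "\<And>i. i \<in> X \<Longrightarrow> exp (2 * \<beta> i) < (\<Prod>j\<in>X - {i}. cmod (1 + z {i, j}))" by force
  have square: "(\<Prod>i\<in>X. \<Prod>j\<in>X - {i}. f {i, j}) = (\<Prod>e\<in>vpairs X. f e)\<^sup>2" for f :: "nat set \<Rightarrow> real"
    using \<open>finite X\<close>
  proof (induction X rule: finite_induct)
    case (insert x X)
    have 1: "insert x X - {i} = insert x (X - {i})" if "i \<in> X" for i using that insert by auto
    have 2: "insert x X - {x} = X" using insert by auto
    have "(\<Prod>i\<in>insert x X. \<Prod>j\<in>insert x X - {i}. f {i, j}) =
       (\<Prod>j\<in>X. f {x, j}) * (\<Prod>i\<in>X. f {i, x} * (\<Prod>j\<in>X - {i}. f {i, j}))"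
      using insert by (simp add: 1 2 cong: prod.cong)
    also have "\<dots> = (\<Prod>j\<in>X. f {x, j}) * ((\<Prod>j\<in>X. f {x, j}) * (\<Prod>e\<in>vpairs X. f e)\<^sup>2)"
      using insert by (simp add: prod.distrib insert_commute)
    also have "\<dots> = (\<Prod>e\<in>vpairs (insert x X). f e)\<^sup>2"
      using insert by (simp add: prod_vpairs_insert power2_eq_square)
    finally show ?case .
  qed simp
  have "(\<Prod>i\<in>X. exp (2 * \<beta> i)) < (\<Prod>i\<in>X. \<Prod>j\<in>X - {i}. cmod (1 + z {i, j}))"
  proof -
    obtain i where i: "i \<in> X" using assms by auto
    have "0 < (\<Prod>j\<in>X - {i}. cmod (1 + z {i, j}))" if "i \<in> X" for i
      using lt[OF that] exp_gt_zero[of "2 * \<beta> i"] by linarith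
    then show ?thesis
      using assms lt i by (intro prod_mono_strict[OF i]) (auto intro: less_imp_le)
  qed
  also have "\<dots> = (\<Prod>e\<in>vpairs X. cmod (1 + z e))\<^sup>2" by (rule square)
  also have "\<dots> \<le> (\<Prod>i\<in>X. exp (\<beta> i))\<^sup>2"
    using stab by (intro power_mono prod_nonneg) auto
  also have "\<dots> = (\<Prod>i\<in>X. exp (2 * \<beta> i))"
    by (simp add: prod_power_distrib[symmetric] exp_double)
  finally show False by simp
qed

text \<open>Every root set met by the recursion lies in V, so stability offers a vertex whose
  prefactor is at most \<open>exp (2 * \<beta> i)\<close>. The choice depends on z, but it
  disappears from the bound because \<open>forest_step\<close> can remove the same vertex from the
  forest sum.\<close>

lemma conn_sum_le_forest_double:
  fixes z :: "nat set \<Rightarrow> complex"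
  assumes "finite V" "r \<in> V"
    and stab: "\<And>X. X \<subseteq> V \<Longrightarrow> (\<Prod>e\<in>vpairs X. cmod (1 + z e)) \<le> (\<Prod>i\<in>X. exp (\<beta> i))"
  shows "cmod (conn_sum z V) \<le> (\<Prod>i\<in>V. exp (2 * \<beta> i)) * forest (\<lambda>i j. cmod (z {i, j})) {r} (V - {r})"
proof -
  let ?good = "\<lambda>X i. i \<in> X \<and> (\<Prod>j\<in>X - {i}. cmod (1 + z {i, j})) \<le> exp (2 * \<beta> i)"
  \<comment> \<open>Outside V no good vertex need exist; the second branch keeps \<open>ch X\<close>
    inside X there, as the identity for \<open>conn_sum\<close> demands.\<close>
  define ch where "ch X = (if \<exists>i. ?good X i then SOME i. ?good X i else SOME i. i \<in> X)" for X
  have ch: "ch X \<in> X" if "finite X" "X \<noteq> {}" for X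
    using that by (auto simp: ch_def some_in_eq intro: someI2_ex)
  have good: "?good X (ch X)" if "X \<subseteq> V" "X \<noteq> {}" for X
  proof -
    have "\<exists>i. ?good X i"
      using stability_exists_vertex[OF _ that(2) stab[OF that(1)]] that assms by (auto dest: finite_subset)
    then show ?thesis unfolding ch_def by (simp only: if_True) (rule someI_ex)
  qed
  let ?g = "gforest ch (\<lambda>i A. \<Prod>j\<in>A. 1 + z {i, j}) (\<lambda>i j. z {i, j})"
  let ?f = "forest (\<lambda>i j. cmod (z {i, j}))"
  have main: "cmod (?g X Y) \<le> (\<Prod>i\<in>X \<union> Y. exp (2 * \<beta> i)) * ?f X Y"
    if "finite X" "finite Y" "X \<inter> Y = {}" "X \<union> Y \<subseteq> V" for X Y
    using that
  proof (induction X Y rule: finite_disjoint_pair_induct)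
    case (empty Y)
    then show ?case by (subst gforest.simps) (auto simp: forest_empty)
  next
    case (step X Y)
    define i where "i = ch X"
    have i: "i \<in> X" "(\<Prod>j\<in>X - {i}. cmod (1 + z {i, j})) \<le> exp (2 * \<beta> i)"
      using good step by (auto simp: i_def)
    have g: "?g X Y = (\<Prod>j\<in>X - {i}. 1 + z {i, j}) * (\<Sum>S\<in>Pow Y. (\<Prod>s\<in>S. z {i, s}) * ?g (X - {i} \<union> S) (Y - S))"
      using step i(1) unfolding i_def by (subst gforest.simps) auto
    have "cmod (\<Sum>S\<in>Pow Y. (\<Prod>s\<in>S. z {i, s}) * ?g (X - {i} \<union> S) (Y - S))
      \<le> (\<Sum>S\<in>Pow Y. (\<Prod>s\<in>S. cmod (z {i, s})) * ((\<Prod>k\<in>X - {i} \<union> Y. exp (2 * \<beta> k)) * ?f (X - {i} \<union> S) (Y - S)))"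
    proof (intro sum_norm_le)
      fix S assume S: "S \<in> Pow Y"
      have "cmod (?g (X - {i} \<union> S) (Y - S)) \<le> (\<Prod>k\<in>X - {i} \<union> S \<union> (Y - S). exp (2 * \<beta> k)) * ?f (X - {i} \<union> S) (Y - S)"
        using S i step by (intro step.IH) auto
      moreover have "X - {i} \<union> S \<union> (Y - S) = X - {i} \<union> Y" using S by auto
      ultimately show "cmod ((\<Prod>s\<in>S. z {i, s}) * ?g (X - {i} \<union> S) (Y - S)) \<le>
         (\<Prod>s\<in>S. cmod (z {i, s})) * ((\<Prod>k\<in>X - {i} \<union> Y. exp (2 * \<beta> k)) * ?f (X - {i} \<union> S) (Y - S))"
        by (simp add: norm_mult prod_norm prod_nonneg mult_left_mono)
    qed
    also have "\<dots> = (\<Prod>k\<in>X - {i} \<union> Y. exp (2 * \<beta> k)) * (\<Sum>S\<in>Pow Y. (\<Prod>s\<in>S. cmod (z {i, s})) * ?f (X - {i} \<union> S) (Y - S))"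
      by (simp add: sum_distrib_left mult_ac)
    also have "(\<Sum>S\<in>Pow Y. (\<Prod>s\<in>S. cmod (z {i, s})) * ?f (X - {i} \<union> S) (Y - S)) = ?f X Y"
      using step i by (intro forest_step[symmetric]) auto
    finally have "cmod (?g X Y) \<le> exp (2 * \<beta> i) * ((\<Prod>k\<in>X - {i} \<union> Y. exp (2 * \<beta> k)) * ?f X Y)"
      unfolding g norm_mult using i(2) by (intro mult_mono) (auto simp: prod_norm)
    also have "\<dots> = (\<Prod>k\<in>insert i (X - {i} \<union> Y). exp (2 * \<beta> k)) * ?f X Y"
      using step i by (subst prod.insert) auto
    also have "insert i (X - {i} \<union> Y) = X \<union> Y" using i by auto
    finally show ?case .
  qed
  have "conn_sum z V = ?g {r} (V - {r})"
    using conn_sum_eq_gforest[of ch "V - {r}" r z] ch assms by (simp add: insert_absorb)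
  moreover have "cmod (?g {r} (V - {r})) \<le> (\<Prod>i\<in>{r} \<union> (V - {r}). exp (2 * \<beta> i)) * ?f {r} (V - {r})"
    using assms by (intro main) auto
  moreover have "{r} \<union> (V - {r}) = V" using assms by auto
  ultimately show ?thesis by simp
qed

section \<open>The Brydges--Kennedy flow with hard cores\<close>

definition energy :: "(nat set \<Rightarrow> complex) \<Rightarrow> nat set \<Rightarrow> complex" where
  "energy u V = (\<Sum>e\<in>vpairs V. u e)"

definition cross_energy :: "(nat set \<Rightarrow> complex) \<Rightarrow> nat set \<Rightarrow> nat set \<Rightarrow> complex" where
  "cross_energy u A B = (\<Sum>j\<in>B. \<Sum>i\<in>A. u {i, j})"

lemma energy_insert:
  assumes "finite A" "i \<notin> A"
  shows "energy u (insert i A) = (\<Sum>j\<in>A. u {i, j}) + energy u A"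
proof -
  have "vpairs A \<inter> (\<lambda>j. {i, j}) ` A = {}" using assms by (auto simp: vpairs_def doubleton_eq_iff)
  moreover have "inj_on (\<lambda>j. {i, j}) A" by (auto simp: inj_on_def doubleton_eq_iff)
  ultimately show ?thesis
    using assms by (simp add: energy_def vpairs_insert sum.union_disjoint finite_vpairs sum.reindex add.commute)
qed

lemma energy_Un:
  assumes "finite A" "finite B" "A \<inter> B = {}"
  shows "energy u (A \<union> B) = energy u A + energy u B + cross_energy u A B"
  using assms(2,3)
proof (induction B rule: finite_induct)
  case empty
  then show ?case by (simp add: energy_def cross_energy_def)
next
  case (insert b B)
  have "energy u (A \<union> insert b B) = energy u (insert b (A \<union> B))" by simp
  also have "\<dots> = (\<Sum>j\<in>A \<union> B. u {b, j}) + energy u (A \<union> B)"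
    using insert assms by (intro energy_insert) auto
  also have "(\<Sum>j\<in>A \<union> B. u {b, j}) = (\<Sum>j\<in>A. u {b, j}) + (\<Sum>j\<in>B. u {b, j})"
    using insert assms by (intro sum.union_disjoint) auto
  finally show ?case using insert assms
    by (simp add: energy_insert cross_energy_def insert_commute)
qed

abbreviation mayer :: "(nat set \<Rightarrow> complex) \<Rightarrow> real \<Rightarrow> nat set \<Rightarrow> complex" where
  "mayer u t \<equiv> (\<lambda>e. exp (- (of_real t * u e)) - 1)"

lemma pair_prod_mayer:
  assumes "finite V"
  shows "pair_prod (mayer u t) V = exp (- (of_real t * energy u V))"
  using assms by (simp add: pair_prod_def energy_def exp_sum[symmetric] finite_vpairs sum_distrib_left sum_negf)

lemma sum_Pow_complement:
  "(\<Sum>Z\<in>Pow B. h (B - Z)) = (\<Sum>Z\<in>Pow B. h Z)"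
  by (rule sum.reindex_bij_witness[where i="\<lambda>Z. B - Z" and j="\<lambda>Z. B - Z"]) (auto simp: double_diff)

text \<open>Mark the vertex j first. The sum over all W containing j is then the decomposition of
  the Boltzmann factor of A by the component of j, the same value for every j.\<close>

lemma conn_sum_convolution_weighted:
  fixes z :: "nat set \<Rightarrow> 'b::comm_ring_1"
  assumes "finite A"
  shows "(\<Sum>W\<in>Pow A. (\<Sum>j\<in>W. c j) * (conn_sum z W * pair_prod z (A - W))) = (\<Sum>j\<in>A. c j) * pair_prod z A"
proof -
  have "(\<Sum>W\<in>Pow A. (\<Sum>j\<in>W. c j) * (conn_sum z W * pair_prod z (A - W)))
     = (\<Sum>W\<in>Pow A. \<Sum>j\<in>W. c j * (conn_sum z W * pair_prod z (A - W)))"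
    by (simp add: sum_distrib_right)
  also have "\<dots> = (\<Sum>j\<in>A. \<Sum>Z\<in>Pow (A - {j}). c j * (conn_sum z (insert j Z) * pair_prod z (A - insert j Z)))"
    using assms by (rule sum_Pow_mem)
  also have "\<dots> = (\<Sum>j\<in>A. c j * pair_prod z A)"
  proof (intro sum.cong refl)
    fix j assume j: "j \<in> A"
    have "pair_prod z A = (\<Sum>Z\<in>Pow (A - {j}). conn_sum z (A - Z) * pair_prod z Z)"
      using assms j by (rule pair_prod_component)
    also have "\<dots> = (\<Sum>Z\<in>Pow (A - {j}). conn_sum z (A - (A - {j} - Z)) * pair_prod z (A - {j} - Z))"
      by (rule sum_Pow_complement[symmetric])
    also have "\<dots> = (\<Sum>Z\<in>Pow (A - {j}). conn_sum z (insert j Z) * pair_prod z (A - insert j Z))"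
    proof (intro sum.cong refl)
      fix Z assume "Z \<in> Pow (A - {j})"
      then have "A - (A - {j} - Z) = insert j Z" "A - {j} - Z = A - insert j Z" using j by auto
      then show "conn_sum z (A - (A - {j} - Z)) * pair_prod z (A - {j} - Z) = conn_sum z (insert j Z) * pair_prod z (A - insert j Z)"
        by simp
    qed
    finally show "(\<Sum>Z\<in>Pow (A - {j}). c j * (conn_sum z (insert j Z) * pair_prod z (A - insert j Z))) = c j * pair_prod z A"
      by (simp add: sum_distrib_left)
  qed
  finally show ?thesis by (simp add: sum_distrib_right)
qed

text \<open>The Brydges--Kennedy equation. It follows by induction over V from the component
  decomposition, because the derivative of a Boltzmann factor is explicit. The root r makes every
  splitting of V into two clusters occur once, A being the cluster without r.\<close>

lemma has_vector_derivative_conn_sum: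
  assumes "finite V" "r \<in> V"
  shows "((\<lambda>t. conn_sum (mayer u t) V) has_vector_derivative
     (- energy u V * conn_sum (mayer u t) V - (\<Sum>A\<in>Pow (V - {r}). cross_energy u (V - A) A *
        (conn_sum (mayer u t) (V - A) * conn_sum (mayer u t) A)))) (at t)"
  using assms
proof (induction V rule: finite_psubset_induct)
  case (psubset V)
  let ?K = "\<lambda>t. conn_sum (mayer u t)" and ?G = "\<lambda>t. pair_prod (mayer u t)"
  let ?D = "\<lambda>V. - energy u V * ?K t V - (\<Sum>A\<in>Pow (V - {r}). cross_energy u (V - A) A * (?K t (V - A) * ?K t A))"
  let ?Y = "V - {r}"
  have finY: "finite ?Y" using psubset by auto
  \<comment> \<open>The connected sum of the empty set is 1, not 0, so it is the cross energy that
    has to remove the term A = {}.\<close>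
  have cross0: "cross_energy u X {} = 0" for X by (simp add: cross_energy_def)
  \<comment> \<open>Solved for the connected sum of V, this leaves Boltzmann factors and connected
    sums of proper subsets, whose derivatives are known.\<close>
  have GK: "?G s V = ?K s V + (\<Sum>Z\<in>Pow ?Y - {{}}. ?K s (V - Z) * ?G s Z)" for s
    using pair_prod_component[OF psubset.hyps(1) psubset.prems, of "mayer u s"]
      sum_Pow_remove_empty[OF finY, of "\<lambda>Z. ?K s (V - Z) * ?G s Z"] by simp
  have Gd: "((\<lambda>s. ?G s Z) has_vector_derivative (- energy u Z * ?G t Z)) (at t)" if "finite Z" for Z
    unfolding pair_prod_mayer[OF that]
    by (auto intro!: derivative_eq_intros has_vector_derivative_real_field)
  have "((\<lambda>s. ?G s V - (\<Sum>Z\<in>Pow ?Y - {{}}. ?K s (V - Z) * ?G s Z)) has_vector_derivative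
     (- energy u V * ?G t V - (\<Sum>Z\<in>Pow ?Y - {{}}. ?K t (V - Z) * (- energy u Z * ?G t Z) + ?D (V - Z) * ?G t Z))) (at t)"
  proof (intro has_vector_derivative_diff has_vector_derivative_sum has_vector_derivative_mult Gd)
    fix Z assume "Z \<in> Pow ?Y - {{}}"
    then show "((\<lambda>s. ?K s (V - Z)) has_vector_derivative ?D (V - Z)) (at t)"
      using psubset.prems by (intro psubset.IH) auto
  qed (use psubset in \<open>auto dest: finite_subset\<close>)
  also have "(\<lambda>s. ?G s V - (\<Sum>Z\<in>Pow ?Y - {{}}. ?K s (V - Z) * ?G s Z)) = (\<lambda>s. ?K s V)"
    by (simp add: GK)
  also have "(- energy u V * ?G t V - (\<Sum>Z\<in>Pow ?Y - {{}}. ?K t (V - Z) * (- energy u Z * ?G t Z) + ?D (V - Z) * ?G t Z)) = ?D V"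
  proof -
    let ?X = "\<lambda>A. cross_energy u (V - A) A"
    let ?d = "\<lambda>Z W. cross_energy u (V - Z - W) W * (?K t (V - Z - W) * ?K t W * ?G t Z)"
    have 1: "?K t (V - Z) * (- energy u Z * ?G t Z) + ?D (V - Z) * ?G t Z
        = - (energy u V * (?K t (V - Z) * ?G t Z)) + ?X Z * (?K t (V - Z) * ?G t Z) - (\<Sum>W\<in>Pow (?Y - Z). ?d Z W)"
      if "Z \<in> Pow ?Y" for Z
    proof -
      have "energy u ((V - Z) \<union> Z) = energy u (V - Z) + energy u Z + ?X Z"
        using psubset that by (intro energy_Un) (auto dest: finite_subset)
      moreover have "(V - Z) \<union> Z = V" using that by auto
      ultimately have e: "energy u V = energy u (V - Z) + energy u Z + ?X Z" by simp
      have "V - Z - {r} = ?Y - Z" by auto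
      then show ?thesis unfolding e
        by (simp add: algebra_simps sum_distrib_left sum_distrib_right)
    qed
    \<comment> \<open>With A = Z \<union> W the interaction of W with V - A is a sum over marked
      vertices of W, so the inner sum collapses to the cross energy of all of A times its Boltzmann
      factor. These terms cancel those produced by splitting the energy of V.\<close>
    have 2: "(\<Sum>Z\<in>Pow ?Y. \<Sum>W\<in>Pow (?Y - Z). ?d Z W) = (\<Sum>A\<in>Pow ?Y. ?X A * (?K t (V - A) * ?G t A))"
    proof -
      have "(\<Sum>Z\<in>Pow ?Y. \<Sum>W\<in>Pow (?Y - Z). ?d Z W) = (\<Sum>A\<in>Pow ?Y. \<Sum>W\<in>Pow A. ?d (A - W) W)"
        using finY by (rule sum_Pow_disjoint_union)
      also have "\<dots> = (\<Sum>A\<in>Pow ?Y. ?K t (V - A) * (\<Sum>W\<in>Pow A. (\<Sum>j\<in>W. \<Sum>i\<in>V - A. u {i, j}) * (?K t W * ?G t (A - W))))"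
      proof (intro sum.cong refl, unfold sum_distrib_left[of "?K t _"], intro sum.cong refl)
        fix A W assume "A \<in> Pow ?Y" "W \<in> Pow A"
        then have "V - (A - W) - W = V - A" by auto
        then show "?d (A - W) W = ?K t (V - A) * ((\<Sum>j\<in>W. \<Sum>i\<in>V - A. u {i, j}) * (?K t W * ?G t (A - W)))"
          by (simp add: cross_energy_def mult_ac)
      qed
      also have "\<dots> = (\<Sum>A\<in>Pow ?Y. ?K t (V - A) * ((\<Sum>j\<in>A. \<Sum>i\<in>V - A. u {i, j}) * ?G t A))"
        using finY by (intro sum.cong refl arg_cong2[where f="(*)"] conn_sum_convolution_weighted) (auto dest: finite_subset)
      finally show ?thesis by (simp add: cross_energy_def mult_ac)
    qed
    have 3: "(\<Sum>W\<in>Pow (?Y - {}). ?d {} W) = (\<Sum>A\<in>Pow ?Y. ?X A * (?K t (V - A) * ?K t A))"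
      by simp
    have "(\<Sum>Z\<in>Pow ?Y - {{}}. ?K t (V - Z) * (- energy u Z * ?G t Z) + ?D (V - Z) * ?G t Z)
        = (\<Sum>Z\<in>Pow ?Y - {{}}. - (energy u V * (?K t (V - Z) * ?G t Z)) + ?X Z * (?K t (V - Z) * ?G t Z) - (\<Sum>W\<in>Pow (?Y - Z). ?d Z W))"
      by (intro sum.cong refl 1) auto
    also have "\<dots> = - (energy u V * (\<Sum>Z\<in>Pow ?Y - {{}}. ?K t (V - Z) * ?G t Z))
        + (\<Sum>Z\<in>Pow ?Y - {{}}. ?X Z * (?K t (V - Z) * ?G t Z)) - (\<Sum>Z\<in>Pow ?Y - {{}}. \<Sum>W\<in>Pow (?Y - Z). ?d Z W)"
      by (simp add: sum.distrib sum_subtractf sum_negf sum_distrib_left)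
    also have "(\<Sum>Z\<in>Pow ?Y - {{}}. ?X Z * (?K t (V - Z) * ?G t Z)) = (\<Sum>Z\<in>Pow ?Y. ?X Z * (?K t (V - Z) * ?G t Z))"
      using sum_Pow_remove_empty[OF finY, of "\<lambda>Z. ?X Z * (?K t (V - Z) * ?G t Z)"] by (simp add: cross0)
    also have "(\<Sum>Z\<in>Pow ?Y - {{}}. \<Sum>W\<in>Pow (?Y - Z). ?d Z W) = (\<Sum>A\<in>Pow ?Y. ?X A * (?K t (V - A) * ?G t A))
         - (\<Sum>A\<in>Pow ?Y. ?X A * (?K t (V - A) * ?K t A))"
      using sum_Pow_remove_empty[OF finY, of "\<lambda>Z. \<Sum>W\<in>Pow (?Y - Z). ?d Z W"] unfolding 2 3 by simp
    finally show ?thesis unfolding GK[of t] by (simp add: algebra_simps)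
  qed
  finally show ?case .
qed

section \<open>Hard pairs as a budget of damping factors\<close>

lemma card_vpairs_insert_ge:
  assumes "finite W" "i \<notin> W" "S \<subseteq> W"
  shows "card (vpairs W \<inter> H) + card {s \<in> S. {i, s} \<in> H} \<le> card (vpairs (insert i W) \<inter> H)"
proof -
  have fin: "finite S" using assms finite_subset by blast
  have "inj_on (\<lambda>s. {i, s}) {s \<in> S. {i, s} \<in> H}" by (auto simp: inj_on_def doubleton_eq_iff)
  then have "card {s \<in> S. {i, s} \<in> H} = card ((\<lambda>s. {i, s}) ` {s \<in> S. {i, s} \<in> H})" by (simp add: card_image)
  moreover have "card (vpairs W \<inter> H) + card ((\<lambda>s. {i, s}) ` {s \<in> S. {i, s} \<in> H})
     = card ((vpairs W \<inter> H) \<union> (\<lambda>s. {i, s}) ` {s \<in> S. {i, s} \<in> H})"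
    using assms fin by (intro card_Un_disjoint[symmetric]) (use finite_vpairs in \<open>auto simp: vpairs_def doubleton_eq_iff\<close>)
  moreover have "\<dots> \<le> card (vpairs (insert i W) \<inter> H)"
    using assms by (intro card_mono) (auto simp: finite_vpairs vpairs_insert)
  ultimately show ?thesis by simp
qed

text \<open>The connecting edge {i, j} crosses the cut and is counted in neither cluster. If it is
  hard, one damping factor remains for it after both clusters have received theirs.\<close>

lemma card_vpairs_split_ge:
  assumes "finite X" "A \<subseteq> X" "j \<in> A" "i \<in> X - A"
  shows "card (vpairs (X - A) \<inter> H) + card (vpairs A \<inter> H) + (if {i, j} \<in> H then 1 else 0) \<le> card (vpairs X \<inter> H)"
proof -
  let ?c = "if {i, j} \<in> H then {{i, j}} else {}"
  have fin: "finite A" using assms finite_subset by blast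
  have ij: "{i, j} \<in> vpairs X" "{i, j} \<notin> vpairs A" "{i, j} \<notin> vpairs (X - A)"
    using assms by (auto simp: vpairs_def doubleton_eq_iff)
  have dj: "vpairs (X - A) \<inter> vpairs A = {}" by (intro vpairs_disjoint) auto
  have "card (vpairs (X - A) \<inter> H) + card (vpairs A \<inter> H) + card ?c
     = card ((vpairs (X - A) \<inter> H) \<union> (vpairs A \<inter> H)) + card ?c"
    using assms fin dj by (subst card_Un_disjoint) (auto simp: finite_vpairs)
  also have "\<dots> = card ((vpairs (X - A) \<inter> H) \<union> (vpairs A \<inter> H) \<union> ?c)"
    using assms fin ij by (subst (2) card_Un_disjoint) (auto simp: finite_vpairs)
  also have "\<dots> \<le> card (vpairs X \<inter> H)"
    using assms ij vpairs_mono[of A X] vpairs_mono[of "X - A" X]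
    by (intro card_mono) (auto simp: finite_vpairs)
  finally show ?thesis by (auto split: if_splits)
qed

text \<open>A forest uses each hard pair at most once. Since q is at most 1, one factor q for every
  hard pair of vertices is no more than one factor for every hard edge actually used.\<close>

lemma forest_damped_ge:
  fixes w :: "nat \<Rightarrow> nat \<Rightarrow> real"
  assumes q: "0 \<le> q" "q \<le> 1" and w: "\<And>i j. 0 \<le> w i j"
    and "finite X" "finite Y" "X \<inter> Y = {}"
  shows "q ^ card (vpairs (X \<union> Y) \<inter> H) * forest w X Y
     \<le> forest (\<lambda>i j. if {i, j} \<in> H then q * w i j else w i j) X Y"
  using assms(4-6)
proof (induction X Y rule: finite_disjoint_pair_induct)
  case (empty Y)
  then show ?case by (auto simp: forest_empty)
next
  case (step X Y)
  then obtain i where i: "i \<in> X" by auto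
  let ?w = "\<lambda>i j. if {i, j} \<in> H then q * w i j else w i j"
  let ?c = "\<lambda>V. card (vpairs V \<inter> H)"
  have "q ^ ?c (X \<union> Y) * forest w X Y = (\<Sum>S\<in>Pow Y. q ^ ?c (X \<union> Y) * ((\<Prod>s\<in>S. w i s) * forest w (X - {i} \<union> S) (Y - S)))"
    using step i by (subst forest_step[of _ _ i]) (auto simp: sum_distrib_left)
  also have "\<dots> \<le> (\<Sum>S\<in>Pow Y. (\<Prod>s\<in>S. ?w i s) * forest ?w (X - {i} \<union> S) (Y - S))"
  proof (intro sum_mono)
    fix S assume S: "S \<in> Pow Y"
    let ?k = "card {s \<in> S. {i, s} \<in> H}"
    have finS: "finite S" using S step finite_subset[of S Y] by auto
    have eq: "X - {i} \<union> S \<union> (Y - S) = X - {i} \<union> Y" "insert i (X - {i} \<union> Y) = X \<union> Y" using S i by auto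
    have "?c (X - {i} \<union> Y) + ?k \<le> ?c (insert i (X - {i} \<union> Y))"
      using S step i by (intro card_vpairs_insert_ge) auto
    then have "q ^ ?c (X \<union> Y) \<le> q ^ (?k + ?c (X - {i} \<union> Y))"
      unfolding eq using q by (intro power_decreasing) auto
    then have "q ^ ?c (X \<union> Y) * ((\<Prod>s\<in>S. w i s) * forest w (X - {i} \<union> S) (Y - S))
      \<le> q ^ (?k + ?c (X - {i} \<union> Y)) * ((\<Prod>s\<in>S. w i s) * forest w (X - {i} \<union> S) (Y - S))"
      using w step i S finS by (intro mult_right_mono mult_nonneg_nonneg prod_nonneg forest_nonneg) auto
    also have "\<dots> = (q ^ ?k * (\<Prod>s\<in>S. w i s)) * (q ^ ?c (X - {i} \<union> Y) * forest w (X - {i} \<union> S) (Y - S))"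
      by (simp add: power_add mult_ac)
    also have "\<dots> \<le> (q ^ ?k * (\<Prod>s\<in>S. w i s)) * forest ?w (X - {i} \<union> S) (Y - S)"
      using step.IH[of i S] i S q w unfolding eq by (intro mult_left_mono mult_nonneg_nonneg prod_nonneg) auto
    also have "q ^ ?k * (\<Prod>s\<in>S. w i s) = (\<Prod>s\<in>S. (if {i, s} \<in> H then q else 1) * w i s)"
      using finS by (simp add: prod.distrib prod.If_cases Int_def)
    also have "\<dots> = (\<Prod>s\<in>S. ?w i s)" by (intro prod.cong) auto
    finally show "q ^ ?c (X \<union> Y) * ((\<Prod>s\<in>S. w i s) * forest w (X - {i} \<union> S) (Y - S))
      \<le> (\<Prod>s\<in>S. ?w i s) * forest ?w (X - {i} \<union> S) (Y - S)" .
  qed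
  also have "\<dots> = forest ?w X Y" using step i by (intro forest_step[symmetric]) auto
  finally show ?case .
qed

lemma conn_sum_zero:
  assumes "finite V" "i \<in> V" "j \<in> V" "i \<noteq> j"
  shows "conn_sum (\<lambda>_. 0) V = 0"
proof -
  have "(\<Prod>e\<in>E. 0) = (0::'a)" if "connected_on V E" for E :: "nat set set"
  proof -
    have "E \<noteq> {}" using that assms by (auto simp: connected_on_def)
    moreover have "finite E" using that assms finite_vpairs finite_subset by (auto simp: connected_on_def)
    ultimately show ?thesis by (simp add: power_0_left)
  qed
  then show ?thesis by (simp add: conn_sum_def)
qed

text \<open>Along the flow, a hard edge of strength \<open>N = \<kappa> * N'\<close> is compensated by the damping
  \<open>exp (- (t - s) * N')\<close> which each hard pair contributes to the Boltzmann factor of its cluster.\<close>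

lemma conn_sum_mayer_le_forest:
  fixes u :: "nat set \<Rightarrow> complex" and \<beta> :: "nat \<Rightarrow> real" and H :: "nat set set" and \<kappa> N' :: real
  defines "w \<equiv> \<lambda>s t i j. if {i, j} \<in> H then \<kappa> * exp (- ((t - s) * N')) else s * cmod (u {i, j})"
  assumes "finite V" and N': "0 < N'" "0 \<le> \<kappa>"
    and hard: "\<And>e. e \<in> H \<Longrightarrow> cmod (u e) = \<kappa> * N'"
    and stab: "\<And>X. X \<subseteq> V \<Longrightarrow> N' * card (vpairs X \<inter> H) - (\<Sum>i\<in>X. \<beta> i) \<le> Re (energy u X)"
    and \<beta>: "\<And>i. 0 \<le> \<beta> i"
    and "X \<subseteq> V" "r \<in> X" "0 \<le> t"
  shows "cmod (conn_sum (mayer u t) X) \<le> exp (t * (\<Sum>i\<in>X. \<beta> i)) * forest (w t t) {r} (X - {r})"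
proof -
  have "finite X" using assms finite_subset by blast
  then show ?thesis using assms(8-10)
  proof (induction X arbitrary: r t rule: finite_psubset_induct)
    case (psubset X)
    let ?Y = "X - {r}" and ?K = "\<lambda>s. conn_sum (mayer u s)" and ?b = "\<lambda>X. \<Sum>i\<in>X. \<beta> i"
    let ?c = "\<lambda>X. card (vpairs X \<inter> H)"
    have w_nonneg: "0 \<le> w s t i j" if "0 \<le> s" for s t i j using that N' by (simp add: w_def)
    consider "?Y = {}" | "?Y \<noteq> {}" "t = 0" | "?Y \<noteq> {}" "0 < t" using psubset by fastforce
    then show ?case
    proof cases
      case 1
      then have "X = {r}" using psubset by auto
      then show ?thesis using psubset \<beta> by (simp add: forest_no_children)
    next
      case 2
      then obtain j where "j \<in> X" "j \<noteq> r" by auto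
      then have "?K t X = 0" using psubset 2 conn_sum_zero[of X r j] by simp
      moreover have "0 \<le> forest (w t t) {r} ?Y" using psubset w_nonneg by (intro forest_nonneg) auto
      ultimately show ?thesis by simp
    next
      case 3
      \<comment> \<open>Variation of constants: the integrating factor cancels the term of the flow
        that is linear in the energy of X. At s = t it is 1, and at s = 0 the connected sum
        vanishes.\<close>
      define m where "m s = exp (- (of_real (t - s) * energy u X)) * ?K s X" for s
      \<comment> \<open>The majorant of \<open>m\<close>, for a fixed end time t. At time s a hard
        edge has weight \<open>\<kappa> * exp (- ((t - s) * N'))\<close>, which grows to
        \<open>\<kappa>\<close> at s = t however large \<open>N'\<close> is.\<close>
      define \<phi> where "\<phi> s = exp (t * ?b X) * forest (w s t) {r} ?Y" for s
      define w' where "w' s i j = (if {i, j} \<in> H then \<kappa> * N' * exp (- ((t - s) * N')) else cmod (u {i, j}))" for s i j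
      define m' where "m' s = - (exp (- (of_real (t - s) * energy u X)) *
        (\<Sum>A\<in>Pow ?Y. cross_energy u (X - A) A * (?K s (X - A) * ?K s A)))" for s
      define \<phi>' where "\<phi>' s = exp (t * ?b X) * (\<Sum>j\<in>?Y. \<Sum>Z\<in>Pow (?Y - {j}). (\<Sum>i\<in>{r} \<union> (?Y - {j} - Z). w' s i j) *
        (forest (w s t) {r} (?Y - {j} - Z) * forest (w s t) {j} Z))" for s
      have wd: "((\<lambda>s. w s t i j) has_real_derivative w' s i j) (at s)" for s i j
        unfolding w_def w'_def by (cases "{i, j} \<in> H") (auto intro!: derivative_eq_intros)
      have \<phi>d: "(\<phi> has_real_derivative \<phi>' s) (at s)" for s
        unfolding \<phi>_def \<phi>'_def
        by (intro DERIV_cmult has_real_derivative_forest wd) (use psubset in auto)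
      have md: "(m has_vector_derivative m' s) (at s)" for s
      proof -
        have e: "((\<lambda>s. exp (- (complex_of_real (t - s) * energy u X))) has_vector_derivative
            (energy u X * exp (- (of_real (t - s) * energy u X)))) (at s)"
          by (auto intro!: derivative_eq_intros has_vector_derivative_real_field)
        show ?thesis
          unfolding m_def
          by (rule has_vector_derivative_eq_rhs[OF has_vector_derivative_mult[OF e
                has_vector_derivative_conn_sum[OF psubset.hyps(1) psubset.prems(2)]]])
             (simp add: m'_def algebra_simps)
      qed
      have bound: "cmod (m' s) \<le> \<phi>' s" if s: "0 < s" "s < t" for s
      proof -
        define q where "q = exp (- ((t - s) * N'))"
        have q: "0 \<le> q" "q \<le> 1" using s N' by (auto simp: q_def)
        \<comment> \<open>Over the remaining time t - s, stability gives the usual factor and in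
          addition one q for each hard pair of X.\<close>
        have E: "cmod (exp (- (of_real (t - s) * energy u X))) \<le> exp ((t - s) * ?b X) * q ^ ?c X"
        proof -
          have "cmod (exp (- (of_real (t - s) * energy u X))) = exp (- ((t - s) * Re (energy u X)))"
            by simp
          also have "\<dots> \<le> exp (- ((t - s) * (N' * ?c X - ?b X)))"
            using s stab[OF psubset.prems(1)] by (simp add: mult_left_mono)
          also have "\<dots> = exp ((t - s) * ?b X) * q ^ ?c X"
            unfolding q_def exp_of_nat_mult[symmetric] mult_exp_exp by (simp add: algebra_simps)
          finally show ?thesis .
        qed
        have wq: "w s t = (\<lambda>i j. if {i, j} \<in> H then q * w s s i j else w s s i j)"
          by (auto simp: w_def q_def fun_eq_iff)
        \<comment> \<open>The induction hypothesis at time s bounds a cluster with undamped hard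
          weights \<open>\<kappa>\<close>; spending the factors q of its own hard pairs turns
          \<open>w s s\<close> into \<open>w s t\<close>.\<close>
        have K: "q ^ ?c A * cmod (?K s A) \<le> exp (s * ?b A) * forest (w s t) {j} (A - {j})"
          if "A \<subset> X" "j \<in> A" for A j
        proof -
          have "finite A" using that psubset finite_subset[of A X] by auto
          then have "q ^ ?c ({j} \<union> (A - {j})) * forest (w s s) {j} (A - {j}) \<le> forest (w s t) {j} (A - {j})"
            unfolding wq using q w_nonneg s by (intro forest_damped_ge) auto
          moreover have "{j} \<union> (A - {j}) = A" using that by auto
          ultimately have 1: "q ^ ?c A * forest (w s s) {j} (A - {j}) \<le> forest (w s t) {j} (A - {j})" by simp
          have "cmod (?K s A) \<le> exp (s * ?b A) * forest (w s s) {j} (A - {j})"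
            using that psubset.prems s by (intro psubset.IH) auto
          then have "q ^ ?c A * cmod (?K s A) \<le> q ^ ?c A * (exp (s * ?b A) * forest (w s s) {j} (A - {j}))"
            using q by (intro mult_left_mono) auto
          also have "\<dots> = exp (s * ?b A) * (q ^ ?c A * forest (w s s) {j} (A - {j}))" by simp
          also have "\<dots> \<le> exp (s * ?b A) * forest (w s t) {j} (A - {j})"
            using 1 by (intro mult_left_mono) auto
          finally show ?thesis .
        qed
        let ?T = "\<lambda>A j. (\<Sum>i\<in>X - A. cmod (u {i, j})) * (cmod (?K s (X - A)) * cmod (?K s A))"
        have "cmod (\<Sum>A\<in>Pow ?Y. cross_energy u (X - A) A * (?K s (X - A) * ?K s A)) \<le> (\<Sum>A\<in>Pow ?Y. \<Sum>j\<in>A. ?T A j)"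
        proof (intro sum_norm_le)
          fix A assume "A \<in> Pow ?Y"
          have "cmod (cross_energy u (X - A) A) \<le> (\<Sum>j\<in>A. \<Sum>i\<in>X - A. cmod (u {i, j}))"
            unfolding cross_energy_def by (intro sum_norm_le) auto
          then show "cmod (cross_energy u (X - A) A * (?K s (X - A) * ?K s A)) \<le> (\<Sum>j\<in>A. ?T A j)"
            unfolding sum_distrib_right[symmetric] norm_mult by (intro mult_right_mono) auto
        qed
        also have "\<dots> = (\<Sum>j\<in>?Y. \<Sum>Z\<in>Pow (?Y - {j}). ?T (insert j Z) j)"
          using psubset by (intro sum_Pow_mem) auto
        finally have "cmod (m' s) \<le> exp ((t - s) * ?b X) * q ^ ?c X * (\<Sum>j\<in>?Y. \<Sum>Z\<in>Pow (?Y - {j}). ?T (insert j Z) j)"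
          unfolding m'_def norm_minus_cancel norm_mult
          using E q by (intro mult_mono) auto
        also have "\<dots> = exp ((t - s) * ?b X) * (\<Sum>j\<in>?Y. \<Sum>Z\<in>Pow (?Y - {j}). q ^ ?c X * ?T (insert j Z) j)"
          by (simp add: sum_distrib_left mult.assoc)
        also have "\<dots> \<le> exp ((t - s) * ?b X) * (\<Sum>j\<in>?Y. \<Sum>Z\<in>Pow (?Y - {j}).
            exp (s * ?b X) * ((\<Sum>i\<in>{r} \<union> (?Y - {j} - Z). w' s i j) *
              (forest (w s t) {r} (?Y - {j} - Z) * forest (w s t) {j} Z)))"
        proof (intro mult_left_mono sum_mono)
          fix j Z assume j: "j \<in> ?Y" and Z: "Z \<in> Pow (?Y - {j})"
          define A where "A = insert j Z"
          have A: "A \<subset> X" "j \<in> A" "A - {j} = Z" "{r} \<union> (?Y - {j} - Z) = X - A" "X - A \<subset> X" "r \<in> X - A"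
            "X - A - {r} = ?Y - {j} - Z"
            using j Z psubset.prems by (auto simp: A_def)
          have finA: "finite A" using A psubset finite_subset[of A X] by auto
          have bX: "?b X = ?b (X - A) + ?b A"
            using A psubset by (simp add: sum.subset_diff[of A X \<beta>])
          have "q ^ ?c X * ?T A j = (\<Sum>i\<in>X - A. (q ^ ?c X * cmod (u {i, j})) * (cmod (?K s (X - A)) * cmod (?K s A)))"
            by (simp add: sum_distrib_left sum_distrib_right mult.assoc)
          also have "\<dots> \<le> (\<Sum>i\<in>X - A. (w' s i j * (q ^ ?c (X - A) * q ^ ?c A)) * (cmod (?K s (X - A)) * cmod (?K s A)))"
          proof (intro sum_mono mult_right_mono)
            fix i assume i: "i \<in> X - A"
            \<comment> \<open>The factor q left for a hard connecting edge turns its strength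
              \<open>\<kappa> * N'\<close> into the derivative of its weight in the
              majorant.\<close>
            have "?c (X - A) + ?c A + (if {i, j} \<in> H then 1 else 0) \<le> ?c X"
              using A i psubset by (intro card_vpairs_split_ge) auto
            then have "q ^ ?c X \<le> q ^ (?c (X - A) + ?c A + (if {i, j} \<in> H then 1 else 0))"
              using q by (intro power_decreasing)
            then have "q ^ ?c X * cmod (u {i, j}) \<le> q ^ (?c (X - A) + ?c A + (if {i, j} \<in> H then 1 else 0)) * cmod (u {i, j})"
              by (intro mult_right_mono) auto
            also have "\<dots> = w' s i j * (q ^ ?c (X - A) * q ^ ?c A)"
              using hard by (auto simp: w'_def q_def power_add)
            finally show "q ^ ?c X * cmod (u {i, j}) \<le> w' s i j * (q ^ ?c (X - A) * q ^ ?c A)" .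
          qed auto
          also have "\<dots> = (\<Sum>i\<in>X - A. w' s i j) * ((q ^ ?c (X - A) * cmod (?K s (X - A))) * (q ^ ?c A * cmod (?K s A)))"
            by (simp only: sum_distrib_right[symmetric] mult_ac)
          also have "\<dots> \<le> (\<Sum>i\<in>X - A. w' s i j) * ((exp (s * ?b (X - A)) * forest (w s t) {r} (X - A - {r})) *
              (exp (s * ?b A) * forest (w s t) {j} (A - {j})))"
          proof (rule mult_left_mono[OF mult_mono[OF K[OF A(5,6)] K[OF A(1,2)]]])
            have "0 \<le> forest (w s t) {r} (X - A - {r})"
              using psubset.hyps(1) w_nonneg s by (intro forest_nonneg) auto
            then show "0 \<le> exp (s * ?b (X - A)) * forest (w s t) {r} (X - A - {r})" by simp
            show "0 \<le> q ^ ?c A * cmod (?K s A)" using q by simp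
            show "0 \<le> (\<Sum>i\<in>X - A. w' s i j)" using N' by (intro sum_nonneg) (simp add: w'_def)
          qed
          also have "\<dots> = exp (s * ?b X) * ((\<Sum>i\<in>X - A. w' s i j) *
              (forest (w s t) {r} (X - A - {r}) * forest (w s t) {j} (A - {j})))"
            unfolding bX distrib_left exp_add by (simp add: mult_ac)
          finally show "q ^ ?c X * ?T (insert j Z) j \<le> exp (s * ?b X) * ((\<Sum>i\<in>{r} \<union> (?Y - {j} - Z). w' s i j) *
              (forest (w s t) {r} (?Y - {j} - Z) * forest (w s t) {j} Z))"
            unfolding A(3,4,7) A_def[symmetric] .
        qed auto
        also have "\<dots> = \<phi>' s"
        proof -
          have "exp (t * ?b X) = exp ((t - s) * ?b X) * exp (s * ?b X)"
            by (simp add: mult_exp_exp algebra_simps)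
          then show ?thesis unfolding \<phi>'_def by (simp only: sum_distrib_left mult.assoc)
        qed
        finally show ?thesis .
      qed
      \<comment> \<open>The derivative bound is integrated from 0 to t by the mean value
        inequality.\<close>
      have "cmod (m t - m 0) \<le> \<phi> t - \<phi> 0"
      proof (rule differentiable_bound_general[OF 3(2)])
        show "continuous_on {0..t} m"
          by (rule continuous_on_vector_derivative) (rule has_vector_derivative_at_within[OF md])
        show "continuous_on {0..t} \<phi>"
          by (rule DERIV_continuous_on) (rule has_field_derivative_at_within[OF \<phi>d])
        show "(\<phi> has_vector_derivative \<phi>' s) (at s)" for s
          using \<phi>d by (simp add: has_real_derivative_iff_has_vector_derivative)
      qed (use md bound in auto)
      moreover have "m 0 = 0"
      proof -
        obtain j where "j \<in> X" "j \<noteq> r" using 3 by auto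
        then show ?thesis using psubset conn_sum_zero[of X r j] by (simp add: m_def)
      qed
      moreover have "0 \<le> \<phi> 0"
        unfolding \<phi>_def using psubset w_nonneg by (intro mult_nonneg_nonneg forest_nonneg) auto
      moreover have "m t = ?K t X" by (simp add: m_def)
      ultimately show ?thesis by (simp add: \<phi>_def)
    qed
  qed
qed

text \<open>Hard edges get strength C + n, of which only n is used as damping rate, so
  \<open>\<kappa>\<close> = 1 + C/n. The limit of \<open>\<kappa>\<close> is the weight 1 of a hard
  edge, while the Mayer factor of the edge tends to -1.\<close>

lemma conn_sum_le_forest_hard_core:
  fixes v :: "nat set \<Rightarrow> complex option" and \<beta> :: "nat \<Rightarrow> real"
  defines "z \<equiv> \<lambda>e. case v e of None \<Rightarrow> -1 | Some a \<Rightarrow> exp (- a) - 1"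
  assumes "finite V" "r \<in> V"
    and stab: "\<And>X. X \<subseteq> V \<Longrightarrow> (\<Prod>e\<in>vpairs X. cmod (1 + z e)) \<le> (\<Prod>i\<in>X. exp (\<beta> i))"
    and \<beta>: "\<And>i. 0 \<le> \<beta> i"
  shows "cmod (conn_sum z V) \<le> (\<Prod>i\<in>V. exp (\<beta> i)) *
    forest (\<lambda>i j. cmod (case v {i, j} of None \<Rightarrow> 1 | Some a \<Rightarrow> a)) {r} (V - {r})"
proof -
  define H where "H = {e. v e = None}"
  define soft where "soft e = (case v e of None \<Rightarrow> 0 | Some a \<Rightarrow> a)" for e
  \<comment> \<open>If X contains a hard pair, the product in the stability hypothesis vanishes and
    the soft energy of X is not controlled. C bounds the negative part of any such soft energy and
    is paid from the strength of one hard edge.\<close>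
  define C where "C = (\<Sum>e\<in>vpairs V. \<bar>Re (soft e)\<bar>)"
  define u where "u n e = (case v e of None \<Rightarrow> complex_of_real (C + real n) | Some a \<Rightarrow> a)" for n e
  define w where "w n i j = (if {i, j} \<in> H then 1 + C / real n else cmod (u n {i, j}))" for n :: nat and i j
  have C: "0 \<le> C" unfolding C_def by (intro sum_nonneg) auto
  have bnd: "cmod (conn_sum (mayer (u n) 1) V) \<le> exp (\<Sum>i\<in>V. \<beta> i) * forest (w n) {r} (V - {r})" if n: "0 < n" for n :: nat
  proof -
    have "cmod (conn_sum (mayer (u n) 1) V) \<le> exp (1 * (\<Sum>i\<in>V. \<beta> i)) * forest
       (\<lambda>i j. if {i, j} \<in> H then (1 + C / real n) * exp (- ((1 - 1) * real n)) else 1 * cmod (u n {i, j})) {r} (V - {r})"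
    proof (rule conn_sum_mayer_le_forest[where V=V])
      show "cmod (u n e) = (1 + C / real n) * real n" if "e \<in> H" for e
      proof -
        have "cmod (u n e) = \<bar>C + real n\<bar>" using that unfolding u_def H_def by (simp del: of_real_add)
        then show ?thesis using n C by (simp add: field_simps)
      qed
      fix X assume X: "X \<subseteq> V"
      have finX: "finite (vpairs X)" using X assms finite_subset finite_vpairs by blast
      have b_nonneg: "0 \<le> (\<Sum>i\<in>X. \<beta> i)" using \<beta> by (intro sum_nonneg) auto
      have "(\<Sum>e\<in>vpairs X. Re (u n e)) = (\<Sum>e\<in>vpairs X. (if e \<in> H then C + real n else 0) + Re (soft e))"
        by (intro sum.cong refl) (auto simp: u_def soft_def H_def split: option.splits)
      also have "\<dots> = (C + real n) * card (vpairs X \<inter> H) + (\<Sum>e\<in>vpairs X. Re (soft e))"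
        using finX by (simp add: sum.distrib sum.If_cases mult.commute)
      finally have eq: "Re (energy (u n) X) = (C + real n) * card (vpairs X \<inter> H) + (\<Sum>e\<in>vpairs X. Re (soft e))"
        by (simp add: energy_def)
      show "real n * card (vpairs X \<inter> H) - (\<Sum>i\<in>X. \<beta> i) \<le> Re (energy (u n) X)"
      \<comment> \<open>Without hard pairs the hypothesis is stability of the soft energy itself;
        otherwise the surplus C of a single hard pair suffices.\<close>
      proof (cases "vpairs X \<inter> H = {}")
        case True
        have "exp (- (\<Sum>e\<in>vpairs X. Re (soft e))) = (\<Prod>e\<in>vpairs X. exp (- Re (soft e)))"
          using finX by (simp add: exp_sum sum_negf[symmetric])
        also have "\<dots> = (\<Prod>e\<in>vpairs X. cmod (1 + z e))"
          using True by (intro prod.cong refl) (auto simp: z_def soft_def H_def split: option.splits)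
        also have "\<dots> \<le> exp (\<Sum>i\<in>X. \<beta> i)"
          using stab[OF X] X assms(2) by (simp add: exp_sum finite_subset)
        finally show ?thesis using True by (simp add: eq)
      next
        case False
        then have "1 \<le> card (vpairs X \<inter> H)" using finX by (simp add: Suc_le_eq card_gt_0_iff)
        then have "C * 1 \<le> C * card (vpairs X \<inter> H)" using C by (intro mult_left_mono) auto
        moreover have "- (\<Sum>e\<in>vpairs X. Re (soft e)) \<le> C"
        proof -
          have "- (\<Sum>e\<in>vpairs X. Re (soft e)) \<le> (\<Sum>e\<in>vpairs X. \<bar>Re (soft e)\<bar>)"
            unfolding sum_negf[symmetric] by (intro sum_mono) auto
          also have "\<dots> \<le> C" unfolding C_def
            using X assms by (intro sum_mono2 finite_vpairs vpairs_mono) auto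
          finally show ?thesis .
        qed
        ultimately show ?thesis using b_nonneg unfolding eq by (simp add: algebra_simps)
      qed
    qed (use assms n C in auto)
    then show ?thesis by (simp add: w_def[abs_def] cong: if_cong)
  qed
  have lim1: "(\<lambda>n. conn_sum (mayer (u n) 1) V) \<longlonglongrightarrow> conn_sum z V"
    unfolding conn_sum_def
  proof (intro tendsto_sum tendsto_prod)
    fix e
    show "(\<lambda>n. mayer (u n) 1 e) \<longlonglongrightarrow> z e"
    proof (cases "v e")
      case None
      have "(\<lambda>n. exp (- (C + real n))) \<longlonglongrightarrow> 0"
        by (intro filterlim_compose[OF exp_at_bot] filterlim_compose[OF filterlim_uminus_at_bot_at_top]
            filterlim_tendsto_add_at_top[OF tendsto_const] filterlim_real_sequentially)
      then have "(\<lambda>n. complex_of_real (exp (- (C + real n))) - 1) \<longlonglongrightarrow> of_real 0 - 1"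
        by (intro tendsto_diff tendsto_of_real tendsto_const)
      then show ?thesis by (simp add: u_def z_def None exp_of_real[symmetric])
    qed (simp add: u_def z_def)
  qed
  have lim2: "(\<lambda>n. exp (\<Sum>i\<in>V. \<beta> i) * forest (w n) {r} (V - {r})) \<longlonglongrightarrow> exp (\<Sum>i\<in>V. \<beta> i) *
    forest (\<lambda>i j. cmod (case v {i, j} of None \<Rightarrow> 1 | Some a \<Rightarrow> a)) {r} (V - {r})"
  proof (intro tendsto_mult tendsto_const tendsto_forest)
    fix i j
    show "(\<lambda>n. w n i j) \<longlonglongrightarrow> cmod (case v {i, j} of None \<Rightarrow> 1 | Some a \<Rightarrow> a)"
    proof (cases "v {i, j}")
      case None
      have "(\<lambda>n. 1 + C / real n) \<longlonglongrightarrow> 1 + 0" by (intro tendsto_add tendsto_const lim_const_over_n)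
      then show ?thesis using None by (simp add: w_def H_def)
    qed (simp add: w_def H_def u_def)
  qed (use assms in auto)
  have "cmod (conn_sum z V) \<le> exp (\<Sum>i\<in>V. \<beta> i) *
    forest (\<lambda>i j. cmod (case v {i, j} of None \<Rightarrow> 1 | Some a \<Rightarrow> a)) {r} (V - {r})"
    by (rule tendsto_le[OF sequentially_bot lim2 tendsto_norm[OF lim1]],
        rule eventually_mono[OF eventually_gt_at_top[of 0]]) (rule bnd)
  then show ?thesis using assms by (simp add: exp_sum)
qed

section \<open>Integration over finitely many points\<close>

text \<open>Only the \<open>\<sigma>\<close>-algebra of \<open>points M\<close> is ever used: all integrals are over finitely many
  coordinates.\<close>

abbreviation points :: "'a measure \<Rightarrow> (nat \<Rightarrow> 'a) measure" where
  "points M \<equiv> PiM UNIV (\<lambda>_::nat. M)"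

text \<open>Integrated and frozen points sit in one total function, so integrals over disjoint index
  sets can be nested and the integrand may refer to any vertex.\<close>

definition pint :: "'a measure \<Rightarrow> nat set \<Rightarrow> ((nat \<Rightarrow> 'a) \<Rightarrow> ennreal) \<Rightarrow> (nat \<Rightarrow> 'a) \<Rightarrow> ennreal" where
  "pint M I F xs = (\<integral>\<^sup>+\<omega>. F (override_on xs \<omega> I) \<partial>PiM I (\<lambda>_. M))"

lemma space_points: "xs \<in> space (points M) \<longleftrightarrow> (\<forall>i. xs i \<in> space M)"
  by (simp add: space_PiM PiE_iff)

lemma measurable_override_on [measurable]:
  "(\<lambda>(xs, \<omega>). override_on xs \<omega> I) \<in> points M \<Otimes>\<^sub>M PiM I (\<lambda>_. M) \<rightarrow>\<^sub>M points M"
  unfolding case_prod_beta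
proof (rule measurable_PiM_single')
  show "(\<lambda>p. override_on (fst p) (snd p) I i) \<in> points M \<Otimes>\<^sub>M PiM I (\<lambda>_. M) \<rightarrow>\<^sub>M M" for i
    by (cases "i \<in> I") (auto simp: override_on_def)
qed (auto simp: space_pair_measure space_PiM PiE_iff override_on_def)

lemma measurable_override_on_right:
  assumes "xs \<in> space (points M)"
  shows "(\<lambda>\<omega>. override_on xs \<omega> I) \<in> PiM I (\<lambda>_. M) \<rightarrow>\<^sub>M points M"
  using measurable_compose[OF measurable_Pair1'[OF assms] measurable_override_on] by simp

lemma measurable_fun_upd_points:
  assumes "xs \<in> space (points M)"
  shows "(\<lambda>z. xs(i := z)) \<in> M \<rightarrow>\<^sub>M points M"
  by (rule measurable_PiM_single'[where f="\<lambda>k z. (xs(i := z)) k"])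
     (use assms in \<open>auto simp: space_points PiE_iff\<close>)

lemma override_on_space_points:
  "xs \<in> space (points M) \<Longrightarrow> \<omega> \<in> space (PiM I (\<lambda>_. M)) \<Longrightarrow> override_on xs \<omega> I \<in> space (points M)"
  by (auto simp: space_PiM PiE_iff override_on_def)

lemma fun_upd_space_points:
  "xs \<in> space (points M) \<Longrightarrow> z \<in> space M \<Longrightarrow> xs(i := z) \<in> space (points M)"
  by (auto simp: space_points)

lemma pint_mono:
  assumes "\<And>ys. ys \<in> space (points M) \<Longrightarrow> (\<And>i. i \<notin> I \<Longrightarrow> ys i = xs i) \<Longrightarrow> F ys \<le> G ys"
    and "xs \<in> space (points M)"
  shows "pint M I F xs \<le> pint M I G xs"
  unfolding pint_def
  by (intro nn_integral_mono assms(1) override_on_space_points assms(2)) (auto simp: override_on_def)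

lemma pint_cong:
  assumes "\<And>ys. ys \<in> space (points M) \<Longrightarrow> (\<And>i. i \<notin> I \<Longrightarrow> ys i = xs i) \<Longrightarrow> F ys = G ys"
    and "xs \<in> space (points M)"
  shows "pint M I F xs = pint M I G xs"
  by (intro antisym pint_mono assms(2)) (auto simp: assms(1))

lemma pint_cmult:
  assumes "F \<in> borel_measurable (points M)" "xs \<in> space (points M)"
  shows "pint M I (\<lambda>xs. c * F xs) xs = c * pint M I F xs"
  unfolding pint_def
  using measurable_compose[OF measurable_override_on_right[OF assms(2)] assms(1)]
  by (rule nn_integral_cmult)

lemma pint_sum:
  assumes "\<And>k. k \<in> K \<Longrightarrow> F k \<in> borel_measurable (points M)" "xs \<in> space (points M)"
  shows "pint M I (\<lambda>xs. \<Sum>k\<in>K. F k xs) xs = (\<Sum>k\<in>K. pint M I (F k) xs)"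
  unfolding pint_def
  using measurable_compose[OF measurable_override_on_right[OF assms(2)] assms(1)]
  by (intro nn_integral_sum) auto

lemma pint_add:
  assumes "F \<in> borel_measurable (points M)" "G \<in> borel_measurable (points M)" "xs \<in> space (points M)"
  shows "pint M I (\<lambda>xs. F xs + G xs) xs = pint M I F xs + pint M I G xs"
  unfolding pint_def
  by (intro nn_integral_add measurable_compose[OF measurable_override_on_right[OF assms(3)]] assms(1,2))

context finite_measure
begin

lemma product_sigma_finite_const: "product_sigma_finite (\<lambda>_::nat. M)"
  by (simp add: product_sigma_finite_def sigma_finite_measure_axioms)

interpretation product_sigma_finite "\<lambda>_::nat. M" by (rule product_sigma_finite_const)

lemma pint_measurable [measurable]:
  assumes "finite I" and F: "F \<in> borel_measurable (points M)"
  shows "pint M I F \<in> borel_measurable (points M)"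
proof -
  interpret I: sigma_finite_measure "PiM I (\<lambda>_. M)" using assms by (intro sigma_finite)
  have "(\<lambda>(xs, \<omega>). F (override_on xs \<omega> I)) \<in> borel_measurable (points M \<Otimes>\<^sub>M PiM I (\<lambda>_. M))"
    using measurable_compose[OF measurable_override_on F] by (simp add: case_prod_beta)
  then show ?thesis unfolding pint_def[abs_def] by (rule I.borel_measurable_nn_integral)
qed

lemma pint_empty: "pint M {} F xs = F xs"
  by (simp add: pint_def space_PiM_empty)

lemma pint_Un:
  assumes "finite I" "finite J" "I \<inter> J = {}"
    and F: "F \<in> borel_measurable (points M)" and xs: "xs \<in> space (points M)"
  shows "pint M (I \<union> J) F xs = pint M I (pint M J F) xs"
proof -
  have "pint M (I \<union> J) F xs = (\<integral>\<^sup>+ x. (\<integral>\<^sup>+ y. F (override_on xs (merge I J (x, y)) (I \<union> J)) \<partial>PiM J (\<lambda>_. M)) \<partial>PiM I (\<lambda>_. M))"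
    unfolding pint_def using assms measurable_compose[OF measurable_override_on_right[OF xs] F]
    by (intro product_nn_integral_fold) auto
  moreover have "override_on xs (merge I J (x, y)) (I \<union> J) = override_on (override_on xs x I) y J" for x y
    using assms(3) by (auto simp: override_on_def merge_def fun_eq_iff)
  ultimately show ?thesis by (simp add: pint_def)
qed

lemma pint_singleton:
  assumes F: "F \<in> borel_measurable (points M)" and xs: "xs \<in> space (points M)"
  shows "pint M {i} F xs = (\<integral>\<^sup>+ z. F (xs(i := z)) \<partial>M)"
proof -
  have "override_on xs \<omega> {i} = xs(i := \<omega> i)" for \<omega> by (auto simp: override_on_def)
  moreover have "(\<integral>\<^sup>+ \<omega>. F (xs(i := \<omega> i)) \<partial>PiM {i} (\<lambda>_. M)) = (\<integral>\<^sup>+ z. F (xs(i := z)) \<partial>M)"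
    by (rule product_nn_integral_singleton) (rule measurable_compose[OF measurable_fun_upd_points[OF xs] F])
  ultimately show ?thesis by (simp add: pint_def)
qed

lemma pint_insert:
  assumes "finite I" "i \<notin> I" and F: "F \<in> borel_measurable (points M)" and xs: "xs \<in> space (points M)"
  shows "pint M (insert i I) F xs = (\<integral>\<^sup>+ z. pint M I F (xs(i := z)) \<partial>M)"
  using pint_Un[of "{i}" I F xs] assms pint_singleton[OF pint_measurable[OF assms(1) F] xs, of i] by simp

lemma nn_iter_eq_pint:
  assumes F: "F \<in> borel_measurable (points M)" and "xs \<in> space (points M)"
  shows "nn_iter M m k F xs = pint M {k..<k + m} F xs"
  using assms(2)
proof (induction m arbitrary: k xs)
  case (Suc m)
  have "{k..<k + Suc m} = insert k {Suc k..<Suc k + m}" by auto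
  then have "pint M {k..<k + Suc m} F xs = (\<integral>\<^sup>+ z. pint M {Suc k..<Suc k + m} F (xs(k := z)) \<partial>M)"
    using pint_insert[of "{Suc k..<Suc k + m}" k F xs] F Suc.prems by simp
  also have "\<dots> = (\<integral>\<^sup>+ z. nn_iter M m (Suc k) F (xs(k := z)) \<partial>M)"
    by (intro nn_integral_cong Suc.IH[symmetric] fun_upd_space_points Suc.prems)
  finally show ?case by simp
qed (simp add: pint_empty)

lemma pint_prod:
  assumes "finite I" "\<And>i. i \<in> I \<Longrightarrow> g i \<in> borel_measurable M"
  shows "pint M I (\<lambda>xs. \<Prod>i\<in>I. g i (xs i)) xs = (\<Prod>i\<in>I. \<integral>\<^sup>+ z. g i z \<partial>M)"
proof -
  have "pint M I (\<lambda>xs. \<Prod>i\<in>I. g i (xs i)) xs = (\<integral>\<^sup>+\<omega>. (\<Prod>i\<in>I. g i (\<omega> i)) \<partial>PiM I (\<lambda>_. M))"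
    unfolding pint_def by (intro nn_integral_cong prod.cong) (auto simp: override_on_def)
  then show ?thesis using assms by (simp add: product_nn_integral_prod)
qed

section \<open>Relabelling and discarding coordinates\<close>

lemma distr_PiM_image:
  fixes \<sigma> :: "nat \<Rightarrow> nat"
  assumes "finite J" "inj_on \<sigma> J"
  shows "distr (PiM (\<sigma> ` J) (\<lambda>_. M)) (PiM J (\<lambda>_. M)) (\<lambda>\<omega>. \<lambda>j\<in>J. \<omega> (\<sigma> j)) = PiM J (\<lambda>_. M)"
proof (rule PiM_eqI)
  have meas: "(\<lambda>\<omega>. \<lambda>j\<in>J. \<omega> (\<sigma> j)) \<in> PiM (\<sigma> ` J) (\<lambda>_. M) \<rightarrow>\<^sub>M PiM J (\<lambda>_. M)"
    by (intro measurable_restrict measurable_component_singleton) auto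
  fix A assume A: "\<And>i. i \<in> J \<Longrightarrow> A i \<in> sets M"
  let ?B = "\<lambda>k. A (the_inv_into J \<sigma> k)"
  have B: "?B (\<sigma> j) = A j" if "j \<in> J" for j using that assms by (simp add: the_inv_into_f_f)
  have "emeasure (distr (PiM (\<sigma> ` J) (\<lambda>_. M)) (PiM J (\<lambda>_. M)) (\<lambda>\<omega>. \<lambda>j\<in>J. \<omega> (\<sigma> j))) (Pi\<^sub>E J A)
    = emeasure (PiM (\<sigma> ` J) (\<lambda>_. M)) ((\<lambda>\<omega>. \<lambda>j\<in>J. \<omega> (\<sigma> j)) -` Pi\<^sub>E J A \<inter> space (PiM (\<sigma> ` J) (\<lambda>_. M)))"
    using A assms meas by (intro emeasure_distr sets_PiM_I_finite) auto
  also have "(\<lambda>\<omega>. \<lambda>j\<in>J. \<omega> (\<sigma> j)) -` Pi\<^sub>E J A \<inter> space (PiM (\<sigma> ` J) (\<lambda>_. M)) = Pi\<^sub>E (\<sigma> ` J) ?B"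
    by (auto simp: space_PiM PiE_iff B) (use A[THEN sets.sets_into_space] in blast)+
  also have "emeasure (PiM (\<sigma> ` J) (\<lambda>_. M)) (Pi\<^sub>E (\<sigma> ` J) ?B) = (\<Prod>k\<in>\<sigma> ` J. emeasure M (?B k))"
    using A assms B by (intro emeasure_PiM) auto
  also have "\<dots> = (\<Prod>j\<in>J. emeasure M (A j))" using assms B by (simp add: prod.reindex)
  finally show "emeasure (distr (PiM (\<sigma> ` J) (\<lambda>_. M)) (PiM J (\<lambda>_. M)) (\<lambda>\<omega>. \<lambda>j\<in>J. \<omega> (\<sigma> j))) (Pi\<^sub>E J A)
    = (\<Prod>j\<in>J. emeasure M (A j))" .
qed (use assms in auto)

lemma nn_integral_PiM_image:
  fixes \<sigma> :: "nat \<Rightarrow> nat"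
  assumes "finite J" "inj_on \<sigma> J" "G \<in> borel_measurable (PiM J (\<lambda>_. M))"
  shows "(\<integral>\<^sup>+\<omega>. G (\<lambda>j\<in>J. \<omega> (\<sigma> j)) \<partial>PiM (\<sigma> ` J) (\<lambda>_. M)) = (\<integral>\<^sup>+\<omega>. G \<omega> \<partial>PiM J (\<lambda>_. M))"
proof -
  have meas: "(\<lambda>\<omega>. \<lambda>j\<in>J. \<omega> (\<sigma> j)) \<in> PiM (\<sigma> ` J) (\<lambda>_. M) \<rightarrow>\<^sub>M PiM J (\<lambda>_. M)"
    by (intro measurable_restrict measurable_component_singleton) auto
  show ?thesis
    using nn_integral_distr[OF meas, of G] assms by (simp add: distr_PiM_image)
qed

lemma pint_image:
  fixes \<sigma> :: "nat \<Rightarrow> nat"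
  assumes "finite J" "inj_on \<sigma> J" and G: "G \<in> borel_measurable (points M)" and xs: "xs \<in> space (points M)"
    and eq: "\<And>ys. ys \<in> space (points M) \<Longrightarrow> (\<And>i. i \<notin> \<sigma> ` J \<Longrightarrow> ys i = xs i) \<Longrightarrow>
        F ys = G (override_on xs (ys \<circ> \<sigma>) J)"
  shows "pint M (\<sigma> ` J) F xs = pint M J G xs"
proof -
  have "pint M (\<sigma> ` J) F xs = (\<integral>\<^sup>+\<omega>. G (override_on xs (\<lambda>j\<in>J. \<omega> (\<sigma> j)) J) \<partial>PiM (\<sigma> ` J) (\<lambda>_. M))"
    unfolding pint_def
  proof (rule nn_integral_cong)
    fix \<omega> assume \<omega>: "\<omega> \<in> space (PiM (\<sigma> ` J) (\<lambda>_. M))"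
    have "F (override_on xs \<omega> (\<sigma> ` J)) = G (override_on xs (override_on xs \<omega> (\<sigma> ` J) \<circ> \<sigma>) J)"
      using \<omega> xs by (intro eq override_on_space_points) auto
    also have "override_on xs (override_on xs \<omega> (\<sigma> ` J) \<circ> \<sigma>) J = override_on xs (\<lambda>j\<in>J. \<omega> (\<sigma> j)) J"
      by (auto simp: override_on_def)
    finally show "F (override_on xs \<omega> (\<sigma> ` J)) = G (override_on xs (\<lambda>j\<in>J. \<omega> (\<sigma> j)) J)" .
  qed
  also have "\<dots> = pint M J G xs"
    unfolding pint_def using assms(1,2) measurable_compose[OF measurable_override_on_right[OF xs] G]
    by (intro nn_integral_PiM_image)
  finally show ?thesis .
qed

text \<open>The coordinates outside the image of J contribute only a total mass, so the preimage of
  a null set is null. This carries an m-point assumption over to any m of n points.\<close>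

lemma AE_PiM_project:
  fixes \<sigma> :: "nat \<Rightarrow> nat"
  assumes "finite I" "finite J" "inj_on \<sigma> J" "\<sigma> ` J \<subseteq> I" and ae: "AE \<omega> in PiM J (\<lambda>_. M). P \<omega>"
  shows "AE \<omega> in PiM I (\<lambda>_. M). P (\<lambda>j\<in>J. \<omega> (\<sigma> j))"
proof -
  from ae obtain N where N: "{\<omega> \<in> space (PiM J (\<lambda>_. M)). \<not> P \<omega>} \<subseteq> N" "emeasure (PiM J (\<lambda>_. M)) N = 0"
    "N \<in> sets (PiM J (\<lambda>_. M))" by (rule AE_E)
  let ?r = "\<lambda>\<omega>. \<lambda>j\<in>J. \<omega> (\<sigma> j)"
  have meas: "?r \<in> PiM K (\<lambda>_. M) \<rightarrow>\<^sub>M PiM J (\<lambda>_. M)" if "\<sigma> ` J \<subseteq> K" for K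
    using that by (intro measurable_restrict measurable_component_singleton) auto
  have measN: "(\<lambda>\<omega>. indicator N (?r \<omega>) :: ennreal) \<in> borel_measurable (PiM K (\<lambda>_. M))" if "\<sigma> ` J \<subseteq> K" for K
    using measurable_compose[OF meas[OF that] borel_measurable_indicator[OF N(3)]] .
  let ?R = "I - \<sigma> ` J"
  have I: "\<sigma> ` J \<union> ?R = I" using assms by auto
  have "(\<integral>\<^sup>+\<omega>. indicator N (?r \<omega>) \<partial>PiM I (\<lambda>_. M))
     = (\<integral>\<^sup>+ x. (\<integral>\<^sup>+ y. indicator N (?r (merge (\<sigma> ` J) ?R (x, y))) \<partial>PiM ?R (\<lambda>_. M)) \<partial>PiM (\<sigma> ` J) (\<lambda>_. M))"
    using product_nn_integral_fold[of "\<sigma> ` J" ?R "\<lambda>\<omega>. indicator N (?r \<omega>)"] measN[of I] assms(1,2,4)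
    unfolding I by (auto simp: I)
  also have "\<dots> = (\<integral>\<^sup>+ x. emeasure (PiM ?R (\<lambda>_. M)) (space (PiM ?R (\<lambda>_. M))) * indicator N (?r x) \<partial>PiM (\<sigma> ` J) (\<lambda>_. M))"
  proof (rule nn_integral_cong)
    fix x :: "nat \<Rightarrow> 'a"
    have "?r (merge (\<sigma> ` J) ?R (x, y)) = ?r x" for y by (auto simp: merge_def restrict_def)
    then show "(\<integral>\<^sup>+ y. indicator N (?r (merge (\<sigma> ` J) ?R (x, y))) \<partial>PiM ?R (\<lambda>_. M))
      = emeasure (PiM ?R (\<lambda>_. M)) (space (PiM ?R (\<lambda>_. M))) * indicator N (?r x)"
      by (simp add: mult.commute)
  qed
  also have "\<dots> = emeasure (PiM ?R (\<lambda>_. M)) (space (PiM ?R (\<lambda>_. M))) * (\<integral>\<^sup>+ x. indicator N (?r x) \<partial>PiM (\<sigma> ` J) (\<lambda>_. M))"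
    by (intro nn_integral_cmult measN) auto
  also have "(\<integral>\<^sup>+ x. indicator N (?r x) \<partial>PiM (\<sigma> ` J) (\<lambda>_. M)) = (\<integral>\<^sup>+ x. indicator N x \<partial>PiM J (\<lambda>_. M))"
    using assms N by (intro nn_integral_PiM_image) auto
  also have "\<dots> = 0" using N by simp
  finally have "AE \<omega> in PiM I (\<lambda>_. M). (indicator N (?r \<omega>) :: ennreal) = 0"
    using nn_integral_0_iff_AE[OF measN[OF assms(4)]] by (simp only: mult_zero_right)
  from this AE_space show ?thesis
  proof eventually_elim
    case (elim \<omega>)
    then have "?r \<omega> \<notin> N" "?r \<omega> \<in> space (PiM J (\<lambda>_. M))"
      using measurable_space[OF meas[OF assms(4)]] by (auto split: split_indicator_asm)
    then show "P (?r \<omega>)" using N(1) by auto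
  qed
qed

end

section \<open>Integrated forest sums\<close>

lemma sum_Pow_card:
  fixes h :: "nat \<Rightarrow> 'b::comm_semiring_1"
  assumes "finite V"
  shows "(\<Sum>S\<in>Pow V. h (card S)) = (\<Sum>k\<le>card V. of_nat (card V choose k) * h k)"
proof -
  have "(\<Sum>S\<in>Pow V. h (card S)) = (\<Sum>k\<le>card V. \<Sum>S | S \<in> Pow V \<and> card S = k. h (card S))"
    using assms by (intro sum.group[symmetric]) (auto intro: card_mono)
  also have "\<dots> = (\<Sum>k\<le>card V. of_nat (card V choose k) * h k)"
    using n_subsets[OF assms] by (intro sum.cong refl) simp
  finally show ?thesis .
qed

lemma LIMSEQ_binomial_over_power:
  "(\<lambda>n. real (n choose k) / real n ^ k) \<longlonglongrightarrow> 1 / fact k"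
proof -
  have "(\<lambda>n. (\<Prod>i<k. 1 - real i / real n) / fact k) \<longlonglongrightarrow> (\<Prod>i<k. 1 - 0) / fact k"
    by (intro tendsto_divide tendsto_prod tendsto_diff tendsto_const lim_const_over_n) auto
  moreover have "eventually (\<lambda>n. (\<Prod>i<k. 1 - real i / real n) / fact k = real (n choose k) / real n ^ k) sequentially"
  proof (rule eventually_mono[OF eventually_ge_at_top[of "Suc k"]])
    fix n assume n: "Suc k \<le> n"
    have "real (n choose k) * fact k = (\<Prod>i<k. real n - real i)"
      by (simp add: binomial_gbinomial gbinomial_prod_rev atLeast0LessThan)
    also have "\<dots> = (\<Prod>i<k. real n * (1 - real i / real n))"
      using n by (intro prod.cong refl) (simp add: field_simps)
    also have "\<dots> = real n ^ k * (\<Prod>i<k. 1 - real i / real n)"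
      by (simp add: prod.distrib)
    finally show "(\<Prod>i<k. 1 - real i / real n) / fact k = real (n choose k) / real n ^ k"
      using n by (simp add: field_simps)
  qed
  ultimately show ?thesis using tendsto_cong by force
qed

lemma sum_Pow_power_le_exp:
  fixes \<tau> \<alpha> :: real
  assumes "finite V" "0 \<le> \<tau>" "0 \<le> \<alpha>" "\<tau> * card V \<le> 1" "x \<le> ennreal \<alpha>"
  shows "(\<Sum>S\<in>Pow V. ennreal \<tau> ^ card S * x ^ card S) \<le> ennreal (exp \<alpha>)"
proof -
  have "(\<Sum>S\<in>Pow V. ennreal \<tau> ^ card S * x ^ card S) = (\<Sum>S\<in>Pow V. \<Prod>s\<in>S. ennreal \<tau> * x)"
    by (simp add: power_mult_distrib)
  also have "\<dots> = (1 + ennreal \<tau> * x) ^ card V"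
    using assms(1) prod_one_plus_Pow[OF assms(1), of "\<lambda>_. ennreal \<tau> * x"] by simp
  also have "\<dots> \<le> (1 + ennreal \<tau> * ennreal \<alpha>) ^ card V"
    using assms by (intro power_mono add_left_mono mult_left_mono) auto
  also have "1 + ennreal \<tau> * ennreal \<alpha> = ennreal (1 + \<tau> * \<alpha>)"
    using assms by (simp add: ennreal_mult'')
  also have "\<dots> ^ card V = ennreal ((1 + \<tau> * \<alpha>) ^ card V)"
    using assms by (intro ennreal_power) simp
  also have "(1 + \<tau> * \<alpha>) ^ card V \<le> exp (\<tau> * \<alpha>) ^ card V"
    using assms by (intro power_mono) auto
  also have "\<dots> = exp (\<tau> * card V * \<alpha>)" by (simp add: exp_of_nat_mult[symmetric] mult_ac)
  also have "\<dots> \<le> exp \<alpha>" using assms mult_right_mono[of "\<tau> * card V" 1 \<alpha>] by simp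
  finally show ?thesis by (simp add: ennreal_leI)
qed

text \<open>V is a pool of labels for integrated vertices, from which root removal draws: the
  children S leave it and the recursion goes on with V - S. The factor \<open>e\<close> is the share
  of an integrated vertex in the tree-graph prefactor.\<close>

definition qsum :: "'a measure \<Rightarrow> ('a \<Rightarrow> ennreal) \<Rightarrow> ennreal \<Rightarrow> nat set \<Rightarrow>
    (nat set \<Rightarrow> (nat \<Rightarrow> 'a) \<Rightarrow> ennreal) \<Rightarrow> (nat \<Rightarrow> 'a) \<Rightarrow> ennreal" where
  "qsum M e t V \<Psi> xs = (\<Sum>Y\<in>Pow V. t ^ card Y * pint M Y (\<lambda>xs. (\<Prod>y\<in>Y. e (xs y)) * \<Psi> Y xs) xs)"

lemma qsum_cong:
  assumes "\<And>Y xs. Y \<subseteq> V \<Longrightarrow> \<Psi> Y xs = \<Psi>' Y xs"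
  shows "qsum M e t V \<Psi> xs = qsum M e t V \<Psi>' xs"
  unfolding qsum_def using assms by (intro sum.cong refl) simp

lemma measurable_points_pair:
  assumes "case_prod w \<in> borel_measurable (M \<Otimes>\<^sub>M M)"
  shows "(\<lambda>xs. w (xs i) (xs j)) \<in> borel_measurable (points M)"
proof -
  have "(\<lambda>xs. (xs i, xs j)) \<in> points M \<rightarrow>\<^sub>M M \<Otimes>\<^sub>M M" by simp
  from measurable_compose[OF this assms] show ?thesis by simp
qed

lemma measurable_points_component:
  assumes "e \<in> borel_measurable M"
  shows "(\<lambda>xs. e (xs i)) \<in> borel_measurable (points M)"
  using assms by (intro measurable_compose[OF measurable_component_singleton[of i]]) auto

lemma measurable_forest:
  fixes w :: "'a \<Rightarrow> 'a \<Rightarrow> ennreal"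
  assumes "finite X" "finite Y" "X \<inter> Y = {}" and w: "case_prod w \<in> borel_measurable (M \<Otimes>\<^sub>M M)"
  shows "(\<lambda>xs. forest (\<lambda>i j. w (xs i) (xs j)) X Y) \<in> borel_measurable (points M)"
  using assms(1-3)
proof (induction X Y rule: finite_disjoint_pair_induct)
  case (empty Y) then show ?case by (simp add: forest_empty)
next
  case (step X Y)
  then obtain i where i: "i \<in> X" by auto
  have "(\<lambda>xs. \<Sum>S\<in>Pow Y. (\<Prod>s\<in>S. w (xs i) (xs s)) * forest (\<lambda>i j. w (xs i) (xs j)) (X - {i} \<union> S) (Y - S))
      \<in> borel_measurable (points M)"
    using step.IH[OF i] measurable_points_pair[OF w]
    by (intro borel_measurable_sum borel_measurable_times_ennreal borel_measurable_prod_ennreal) auto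
  then show ?case using step i by (subst forest_step[of _ _ i]) auto
qed

context finite_measure
begin

lemma qsum_add_cmult:
  assumes V: "finite V" and e: "e \<in> borel_measurable M"
    and \<Psi>: "\<And>Y. Y \<subseteq> V \<Longrightarrow> \<Psi> Y \<in> borel_measurable (points M)"
    and \<Psi>': "\<And>Y. Y \<subseteq> V \<Longrightarrow> \<Psi>' Y \<in> borel_measurable (points M)"
    and c: "\<And>ys. (\<And>i. i \<notin> V \<Longrightarrow> ys i = xs i) \<Longrightarrow> c ys = c xs"
    and xs: "xs \<in> space (points M)"
  shows "qsum M e t V (\<lambda>Y xs. \<Psi> Y xs + c xs * \<Psi>' Y xs) xs = qsum M e t V \<Psi> xs + c xs * qsum M e t V \<Psi>' xs"
proof -
  have "pint M Y (\<lambda>xs. (\<Prod>y\<in>Y. e (xs y)) * (\<Psi> Y xs + c xs * \<Psi>' Y xs)) xs =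
    pint M Y (\<lambda>xs. (\<Prod>y\<in>Y. e (xs y)) * \<Psi> Y xs) xs + c xs * pint M Y (\<lambda>xs. (\<Prod>y\<in>Y. e (xs y)) * \<Psi>' Y xs) xs"
    if Y: "Y \<subseteq> V" for Y
  proof -
    have m: "(\<lambda>xs. (\<Prod>y\<in>Y. e (xs y)) * \<Psi> Y xs) \<in> borel_measurable (points M)"
      "(\<lambda>xs. (\<Prod>y\<in>Y. e (xs y)) * \<Psi>' Y xs) \<in> borel_measurable (points M)"
      using \<Psi>[OF Y] \<Psi>'[OF Y] measurable_points_component[OF e] by measurable
    have "pint M Y (\<lambda>xs. (\<Prod>y\<in>Y. e (xs y)) * (\<Psi> Y xs + c xs * \<Psi>' Y xs)) xs =
      pint M Y (\<lambda>ys. (\<Prod>y\<in>Y. e (ys y)) * \<Psi> Y ys + c xs * ((\<Prod>y\<in>Y. e (ys y)) * \<Psi>' Y ys)) xs"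
    proof (rule pint_cong[OF _ xs])
      fix ys assume "\<And>i. i \<notin> Y \<Longrightarrow> ys i = xs i"
      then have "c ys = c xs" using Y by (intro c) auto
      then show "(\<Prod>y\<in>Y. e (ys y)) * (\<Psi> Y ys + c ys * \<Psi>' Y ys) =
        (\<Prod>y\<in>Y. e (ys y)) * \<Psi> Y ys + c xs * ((\<Prod>y\<in>Y. e (ys y)) * \<Psi>' Y ys)"
        by (simp add: distrib_left mult_ac)
    qed
    also have "\<dots> = pint M Y (\<lambda>xs. (\<Prod>y\<in>Y. e (xs y)) * \<Psi> Y xs) xs +
        pint M Y (\<lambda>ys. c xs * ((\<Prod>y\<in>Y. e (ys y)) * \<Psi>' Y ys)) xs"
      using m xs by (intro pint_add) auto
    finally show ?thesis using pint_cmult[OF m(2) xs] by simp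
  qed
  then show ?thesis
    unfolding qsum_def by (simp add: distrib_left sum.distrib sum_distrib_left mult_ac)
qed

text \<open>For Y = S \<union> Z the weight in t, the vertex factors and, by Fubini, the integral
  all factorize. As i is not in V, its point is constant under every integral involved.\<close>

lemma qsum_step:
  assumes V: "finite V" "i \<notin> V" and e: "e \<in> borel_measurable M"
    and w: "case_prod w \<in> borel_measurable (M \<Otimes>\<^sub>M M)"
    and \<Psi>: "\<And>S Y. S \<subseteq> V \<Longrightarrow> Y \<subseteq> V - S \<Longrightarrow> \<Psi> S Y \<in> borel_measurable (points M)"
    and xs: "xs \<in> space (points M)"
  shows "qsum M e t V (\<lambda>Y xs. \<Sum>S\<in>Pow Y. (\<Prod>s\<in>S. w (xs i) (xs s)) * \<Psi> S (Y - S) xs) xs =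
    (\<Sum>S\<in>Pow V. t ^ card S * pint M S (\<lambda>ys. (\<Prod>s\<in>S. w (xs i) (ys s) * e (ys s)) * qsum M e t (V - S) (\<Psi> S) ys) xs)"
proof -
  let ?F = "\<lambda>S Z xs. (\<Prod>y\<in>Z \<union> S. e (xs y)) * ((\<Prod>s\<in>S. w (xs i) (xs s)) * \<Psi> S Z xs)"
  let ?h = "\<lambda>Z S. t ^ card (Z \<union> S) * pint M (Z \<union> S) (?F S Z) xs"
  let ?P = "\<lambda>S ys. (\<Prod>s\<in>S. w (xs i) (ys s) * e (ys s))"
  have we: "(\<lambda>ys. w (xs i) (ys s) * e (ys s)) \<in> borel_measurable (points M)" for s
  proof -
    have "w (xs i) \<in> borel_measurable M"
      using measurable_compose[OF measurable_Pair1' w, of "xs i"] xs by (simp add: space_points)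
    then show ?thesis using e by (intro measurable_points_component borel_measurable_times_ennreal)
  qed
  have F: "?F S Z \<in> borel_measurable (points M)" if "S \<subseteq> V" "Z \<subseteq> V - S" for S Z
    using \<Psi>[OF that] measurable_points_pair[OF w] measurable_points_component[OF e]
    by (intro borel_measurable_times_ennreal borel_measurable_prod_ennreal) auto
  have F': "(\<lambda>ys. (\<Prod>y\<in>Z. e (ys y)) * \<Psi> S Z ys) \<in> borel_measurable (points M)" if "S \<subseteq> V" "Z \<subseteq> V - S" for S Z
    using \<Psi>[OF that] measurable_points_component[OF e]
    by (intro borel_measurable_times_ennreal borel_measurable_prod_ennreal) auto
  have "qsum M e t V (\<lambda>Y xs. \<Sum>S\<in>Pow Y. (\<Prod>s\<in>S. w (xs i) (xs s)) * \<Psi> S (Y - S) xs) xs =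
     (\<Sum>Y\<in>Pow V. \<Sum>S\<in>Pow Y. ?h (Y - S) S)"
    unfolding qsum_def
  proof (intro sum.cong refl)
    fix Y assume Y: "Y \<in> Pow V"
    have "pint M Y (\<lambda>xs. (\<Prod>y\<in>Y. e (xs y)) * (\<Sum>S\<in>Pow Y. (\<Prod>s\<in>S. w (xs i) (xs s)) * \<Psi> S (Y - S) xs)) xs
      = pint M Y (\<lambda>xs. \<Sum>S\<in>Pow Y. ?F S (Y - S) xs) xs"
      by (intro pint_cong xs) (auto simp: sum_distrib_left Un_absorb2 intro!: sum.cong)
    also have "\<dots> = (\<Sum>S\<in>Pow Y. pint M Y (?F S (Y - S)) xs)"
      using Y by (intro pint_sum F xs) auto
    finally show "t ^ card Y * pint M Y (\<lambda>xs. (\<Prod>y\<in>Y. e (xs y)) *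
        (\<Sum>S\<in>Pow Y. (\<Prod>s\<in>S. w (xs i) (xs s)) * \<Psi> S (Y - S) xs)) xs = (\<Sum>S\<in>Pow Y. ?h (Y - S) S)"
      by (auto simp: sum_distrib_left Un_absorb2 intro!: sum.cong)
  qed
  also have "\<dots> = (\<Sum>Z\<in>Pow V. \<Sum>S\<in>Pow (V - Z). ?h Z S)"
    using V by (intro sum_Pow_disjoint_union[symmetric])
  also have "\<dots> = (\<Sum>S\<in>Pow V. \<Sum>Z\<in>Pow (V - S). ?h Z S)"
    using V by (intro sum_Pow_disjoint_swap)
  also have "\<dots> = (\<Sum>S\<in>Pow V. t ^ card S * pint M S (\<lambda>ys. ?P S ys * qsum M e t (V - S) (\<Psi> S) ys) xs)"
  proof (intro sum.cong refl)
    fix S assume S: "S \<in> Pow V"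
    then have finS: "finite S" using V finite_subset by auto
    let ?Q = "\<lambda>Z. pint M Z (\<lambda>ys. (\<Prod>y\<in>Z. e (ys y)) * \<Psi> S Z ys)"
    have h: "?h Z S = t ^ card S * (t ^ card Z * pint M S (\<lambda>ys. ?P S ys * ?Q Z ys) xs)" if Z: "Z \<in> Pow (V - S)" for Z
    proof -
      have finZ: "finite Z" using Z V finite_subset[of Z V] by auto
      have dj: "S \<inter> Z = {}" using Z by auto
      have "pint M (S \<union> Z) (?F S Z) xs = pint M S (pint M Z (?F S Z)) xs"
        using finS finZ dj xs S Z by (intro pint_Un F) auto
      also have "\<dots> = pint M S (\<lambda>ys. ?P S ys * ?Q Z ys) xs"
      proof (rule pint_cong[OF _ xs])
        fix ys assume ys: "ys \<in> space (points M)" "\<And>k. k \<notin> S \<Longrightarrow> ys k = xs k"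
        have "pint M Z (?F S Z) ys = pint M Z (\<lambda>zs. ?P S ys * ((\<Prod>y\<in>Z. e (zs y)) * \<Psi> S Z zs)) ys"
        proof (rule pint_cong[OF _ ys(1)])
          fix zs assume zs: "\<And>k. k \<notin> Z \<Longrightarrow> zs k = ys k"
          have 1: "zs i = xs i" using zs[of i] ys(2)[of i] V Z S by (metis DiffD1 Pow_iff subsetD)
          have 2: "zs s = ys s" if "s \<in> S" for s using zs[of s] that dj by auto
          have "(\<Prod>y\<in>Z \<union> S. e (zs y)) = (\<Prod>y\<in>Z. e (zs y)) * (\<Prod>s\<in>S. e (ys s))"
            using finS finZ dj by (subst prod.union_disjoint) (auto simp: 2 intro!: prod.cong)
          moreover have "(\<Prod>s\<in>S. w (zs i) (zs s)) = (\<Prod>s\<in>S. w (xs i) (ys s))"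
            by (intro prod.cong) (auto simp: 1 2)
          ultimately show "?F S Z zs = ?P S ys * ((\<Prod>y\<in>Z. e (zs y)) * \<Psi> S Z zs)"
            by (simp add: prod.distrib mult_ac)
        qed
        also have "\<dots> = ?P S ys * ?Q Z ys"
          using S Z ys by (intro pint_cmult F') auto
        finally show "pint M Z (?F S Z) ys = ?P S ys * ?Q Z ys" .
      qed
      finally have "pint M (Z \<union> S) (?F S Z) xs = pint M S (\<lambda>ys. ?P S ys * ?Q Z ys) xs" by (simp add: Un_commute)
      moreover have "card (Z \<union> S) = card S + card Z" using finS finZ dj by (subst card_Un_disjoint) auto
      ultimately show ?thesis by (simp add: power_add mult.assoc)
    qed
    have m: "(\<lambda>ys. ?P S ys * ?Q Z ys) \<in> borel_measurable (points M)" if "Z \<in> Pow (V - S)" for Z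
    proof (rule borel_measurable_times_ennreal)
      show "?P S \<in> borel_measurable (points M)" by (intro borel_measurable_prod_ennreal we)
      show "?Q Z \<in> borel_measurable (points M)"
        using that S V finite_subset[of Z V] by (intro pint_measurable F') auto
    qed
    have "pint M S (\<lambda>ys. ?P S ys * qsum M e t (V - S) (\<Psi> S) ys) xs =
       pint M S (\<lambda>ys. \<Sum>Z\<in>Pow (V - S). t ^ card Z * (?P S ys * ?Q Z ys)) xs"
      by (intro pint_cong xs) (simp add: qsum_def sum_distrib_left mult_ac)
    also have "\<dots> = (\<Sum>Z\<in>Pow (V - S). pint M S (\<lambda>ys. t ^ card Z * (?P S ys * ?Q Z ys)) xs)"
      by (intro pint_sum borel_measurable_times_ennreal[OF borel_measurable_const] m xs)
    also have "\<dots> = (\<Sum>Z\<in>Pow (V - S). t ^ card Z * pint M S (\<lambda>ys. ?P S ys * ?Q Z ys) xs)"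
      using m xs by (intro sum.cong refl pint_cmult) auto
    finally show "(\<Sum>Z\<in>Pow (V - S). ?h Z S) = t ^ card S * pint M S (\<lambda>ys. ?P S ys * qsum M e t (V - S) (\<Psi> S) ys) xs"
      using h by (simp add: sum_distrib_left)
  qed
  finally show ?thesis .
qed

end

context finite_measure
begin

text \<open>For \<open>t = 1 / |V|\<close> the sum over all \<open>Y \<subseteq> V\<close> of a given size \<open>k\<close> of the weights \<open>t ^ |Y|\<close>
  tends to \<open>1 / k!\<close> as \<open>V\<close> grows. The weights make the bounds
  close under the root-removal recursion, since the children then contribute a binomial sum
  \<open>(1 + t * a) ^ |V| \<le> exp a\<close>.\<close>

lemma qsum_forest_le:
  fixes w :: "'a \<Rightarrow> 'a \<Rightarrow> ennreal" and e :: "'a \<Rightarrow> ennreal" and a :: "'a \<Rightarrow> real" and \<tau> :: real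
  assumes e: "e \<in> borel_measurable M" and w: "case_prod w \<in> borel_measurable (M \<Otimes>\<^sub>M M)"
    and a: "a \<in> borel_measurable M" "\<And>x. x \<in> space M \<Longrightarrow> 0 \<le> a x"
    and KP: "\<And>x. x \<in> space M \<Longrightarrow> (\<integral>\<^sup>+ y. w x y * e y * ennreal (exp (a y)) \<partial>M) \<le> ennreal (a x)"
    and "finite X" "finite V" "X \<inter> V = {}" "0 \<le> \<tau>" "\<tau> * card V \<le> 1" "xs \<in> space (points M)"
  shows "qsum M e (ennreal \<tau>) V (\<lambda>Y xs. forest (\<lambda>i j. w (xs i) (xs j)) X Y) xs \<le> (\<Prod>i\<in>X. ennreal (exp (a (xs i))))"
  using assms(6-11)
proof (induction X V arbitrary: xs rule: finite_disjoint_pair_induct)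
  case (empty V)
  have "qsum M e (ennreal \<tau>) V (\<lambda>Y xs. forest (\<lambda>i j. w (xs i) (xs j)) {} Y) xs =
    (\<Sum>Y\<in>Pow V. if Y = {} then 1 else 0)"
    unfolding qsum_def
  proof (intro sum.cong refl)
    fix Y
    show "ennreal \<tau> ^ card Y * pint M Y (\<lambda>xs. (\<Prod>y\<in>Y. e (xs y)) * forest (\<lambda>i j. w (xs i) (xs j)) {} Y) xs
      = (if Y = {} then 1 else 0)"
      by (cases "Y = {}") (simp_all add: forest_empty pint_def space_PiM_empty)
  qed
  then show ?case using empty by simp
next
  case (step X V)
  then obtain i where i: "i \<in> X" by auto
  let ?f = "\<lambda>xs X Y. forest (\<lambda>i j. w (xs i) (xs j)) X Y" and ?A = "\<lambda>x. ennreal (exp (a x))"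
  let ?g = "\<lambda>z. w (xs i) z * e z * ?A z"
  let ?t = "ennreal \<tau>"
  have i_space: "xs i \<in> space M" using step by (simp add: space_points)
  have gm: "?g \<in> borel_measurable M"
  proof -
    have "w (xs i) \<in> borel_measurable M" using measurable_compose[OF measurable_Pair1'[OF i_space] w] by simp
    then show ?thesis using e a by measurable
  qed
  let ?P = "\<Prod>k\<in>X - {i}. ?A (xs k)"
  have "qsum M e ?t V (\<lambda>Y xs. ?f xs X Y) xs =
    qsum M e ?t V (\<lambda>Y xs. \<Sum>S\<in>Pow Y. (\<Prod>s\<in>S. w (xs i) (xs s)) * ?f xs (X - {i} \<union> S) (Y - S)) xs"
    using step i by (intro qsum_cong forest_step) (auto dest: finite_subset)
  also have "\<dots> = (\<Sum>S\<in>Pow V. ?t ^ card S * pint M S (\<lambda>ys. (\<Prod>s\<in>S. w (xs i) (ys s) * e (ys s)) *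
      qsum M e ?t (V - S) (\<lambda>Y xs. ?f xs (X - {i} \<union> S) Y) ys) xs)"
    using step i by (intro qsum_step e w measurable_forest) (auto dest: finite_subset)
  also have "\<dots> \<le> (\<Sum>S\<in>Pow V. ?t ^ card S * (?P * (\<integral>\<^sup>+ z. ?g z \<partial>M) ^ card S))"
  proof (intro sum_mono mult_left_mono)
    fix S assume S: "S \<in> Pow V"
    then have finS: "finite S" using step finite_subset[of S V] by auto
    have "pint M S (\<lambda>ys. (\<Prod>s\<in>S. w (xs i) (ys s) * e (ys s)) *
       qsum M e ?t (V - S) (\<lambda>Y xs. ?f xs (X - {i} \<union> S) Y) ys) xs \<le> pint M S (\<lambda>ys. ?P * (\<Prod>s\<in>S. ?g (ys s))) xs"
    proof (rule pint_mono[OF _ step.prems(3)])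
      fix ys assume ys: "ys \<in> space (points M)" "\<And>k. k \<notin> S \<Longrightarrow> ys k = xs k"
      \<comment> \<open>The pool shrinks while the weight stays fixed, so the condition on
        \<open>\<tau>\<close> is inherited.\<close>
      have "\<tau> * card (V - S) \<le> \<tau> * card V" using step by (intro mult_left_mono) (auto intro: card_mono)
      then have "qsum M e ?t (V - S) (\<lambda>Y xs. ?f xs (X - {i} \<union> S) Y) ys \<le> (\<Prod>k\<in>X - {i} \<union> S. ?A (ys k))"
        using S i step.prems ys(1) by (intro step.IH) auto
      also have "\<dots> = (\<Prod>k\<in>X - {i}. ?A (ys k)) * (\<Prod>k\<in>S. ?A (ys k))"
        using S step finS by (intro prod.union_disjoint) auto
      also have "(\<Prod>k\<in>X - {i}. ?A (ys k)) = ?P"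
        using S step by (intro prod.cong refl arg_cong[where f="\<lambda>x. ?A x"] ys(2)) auto
      finally have "(\<Prod>s\<in>S. w (xs i) (ys s) * e (ys s)) * qsum M e ?t (V - S) (\<lambda>Y xs. ?f xs (X - {i} \<union> S) Y) ys
        \<le> (\<Prod>s\<in>S. w (xs i) (ys s) * e (ys s)) * (?P * (\<Prod>k\<in>S. ?A (ys k)))"
        by (intro mult_left_mono) auto
      also have "\<dots> = ?P * (\<Prod>s\<in>S. ?g (ys s))" by (simp add: prod.distrib mult_ac)
      finally show "(\<Prod>s\<in>S. w (xs i) (ys s) * e (ys s)) * qsum M e ?t (V - S) (\<lambda>Y xs. ?f xs (X - {i} \<union> S) Y) ys
        \<le> ?P * (\<Prod>s\<in>S. ?g (ys s))" .
    qed
    also have "\<dots> = ?P * pint M S (\<lambda>ys. \<Prod>s\<in>S. ?g (ys s)) xs"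
      using step.prems gm by (intro pint_cmult borel_measurable_prod_ennreal measurable_points_component[OF gm]) auto
    also have "pint M S (\<lambda>ys. \<Prod>s\<in>S. ?g (ys s)) xs = (\<integral>\<^sup>+ z. ?g z \<partial>M) ^ card S"
      using finS gm by (subst pint_prod) auto
    finally show "pint M S (\<lambda>ys. (\<Prod>s\<in>S. w (xs i) (ys s) * e (ys s)) *
       qsum M e ?t (V - S) (\<lambda>Y xs. ?f xs (X - {i} \<union> S) Y) ys) xs \<le> ?P * (\<integral>\<^sup>+ z. ?g z \<partial>M) ^ card S" .
  qed auto
  also have "\<dots> = ?P * (\<Sum>S\<in>Pow V. ?t ^ card S * (\<integral>\<^sup>+ z. ?g z \<partial>M) ^ card S)"
    by (simp add: sum_distrib_left mult_ac)
  also have "\<dots> \<le> ?P * ?A (xs i)"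
    using step a(2)[OF i_space] KP[OF i_space] by (intro mult_left_mono sum_Pow_power_le_exp) auto
  also have "\<dots> = (\<Prod>k\<in>X. ?A (xs k))" using step i by (simp add: prod.remove[of X i] mult.commute)
  finally show ?case .
qed

text \<open>The vertex q, kept at y, lies in the tree of exactly one root i. That root contributes C
  for the path to q, while every root, and q itself, contributes the factor \<open>exp a\<close> for
  the trees attached to it. C is a supersolution of the equation for paths: the next vertex is
  either q or an integrated child that continues the path.\<close>

lemma qsum_forest_marked_le:
  fixes w :: "'a \<Rightarrow> 'a \<Rightarrow> ennreal" and e C :: "'a \<Rightarrow> ennreal" and a :: "'a \<Rightarrow> real" and \<tau> :: real
  assumes e: "e \<in> borel_measurable M" and w: "case_prod w \<in> borel_measurable (M \<Otimes>\<^sub>M M)"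
    and a: "a \<in> borel_measurable M" "\<And>x. x \<in> space M \<Longrightarrow> 0 \<le> a x"
    and KP: "\<And>x. x \<in> space M \<Longrightarrow> (\<integral>\<^sup>+ y. w x y * e y * ennreal (exp (a y)) \<partial>M) \<le> ennreal (a x)"
    and C: "C \<in> borel_measurable M"
      "\<And>x. x \<in> space M \<Longrightarrow> w x y + (\<integral>\<^sup>+ z. w x z * e z * ennreal (exp (a z)) * C z \<partial>M) \<le> C x"
    and "finite X" "finite V" "X \<inter> V = {}" "q \<notin> X" "q \<notin> V" "0 \<le> \<tau>" "\<tau> * card V \<le> 1"
      "xs \<in> space (points M)" "xs q = y"
  shows "qsum M e (ennreal \<tau>) V (\<lambda>Y xs. forest (\<lambda>i j. w (xs i) (xs j)) X (insert q Y)) xs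
    \<le> (\<Prod>i\<in>X. ennreal (exp (a (xs i)))) * ennreal (exp (a y)) * (\<Sum>i\<in>X. C (xs i))"
  using assms(8-16)
proof (induction X V arbitrary: xs rule: finite_disjoint_pair_induct)
  case (empty V)
  then show ?case by (simp add: qsum_def forest_empty pint_def)
next
  case (step X V)
  then obtain i where i: "i \<in> X" by auto
  let ?f = "\<lambda>xs X Y. forest (\<lambda>i j. w (xs i) (xs j)) X Y" and ?A = "\<lambda>x. ennreal (exp (a x))"
  let ?g = "\<lambda>z. w (xs i) z * e z * ?A z"
  let ?t = "ennreal \<tau>" and ?q = "\<lambda>S. qsum M e (ennreal \<tau>) (V - S)"
  have i_space: "xs i \<in> space M" using step by (simp add: space_points)
  have iq: "i \<noteq> q" using step i by auto
  have gm: "?g \<in> borel_measurable M"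
  proof -
    have "w (xs i) \<in> borel_measurable M" using measurable_compose[OF measurable_Pair1'[OF i_space] w] by simp
    then show ?thesis using e a by measurable
  qed
  let ?G = "\<integral>\<^sup>+ z. ?g z \<partial>M" and ?D = "\<integral>\<^sup>+ z. ?g z * C z \<partial>M"
  have G: "?G \<le> ennreal (a (xs i))" using KP[OF i_space] .
  \<comment> \<open>P collects the factors \<open>exp a\<close> of q and the roots other than i. L
    collects the positions of the path to q that involve no integrated child of i: it starts at
    another root, or q is a child of i.\<close>
  define P where "P = (\<Prod>k\<in>X - {i}. ?A (xs k)) * ?A y"
  define L where "L = (\<Sum>k\<in>X - {i}. C (xs k)) + w (xs i) y"
  have fin: "\<And>S. S \<subseteq> V \<Longrightarrow> finite S" and fin2: "\<And>S Y. Y \<subseteq> V - S \<Longrightarrow> finite Y"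
    using finite_subset[OF _ \<open>finite V\<close>] by blast+
  \<comment> \<open>Either q stays below the new roots, or it is a child of i; in the second case it
    becomes a root and the unmarked bound \<open>qsum_forest_le\<close> applies.\<close>
  let ?\<Psi> = "\<lambda>S Y xs. ?f xs (X - {i} \<union> S) (insert q Y) + w (xs i) (xs q) * ?f xs (insert q (X - {i} \<union> S)) Y"
  have "qsum M e ?t V (\<lambda>Y xs. ?f xs X (insert q Y)) xs =
    qsum M e ?t V (\<lambda>Y xs. \<Sum>S\<in>Pow Y. (\<Prod>s\<in>S. w (xs i) (xs s)) * ?\<Psi> S (Y - S) xs) xs"
  proof (rule qsum_cong)
    fix Y xs assume Y: "Y \<subseteq> V"
    have finY: "finite Y" using Y step finite_subset[of Y V] by auto
    have qY: "q \<notin> Y" using Y step by auto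
    have "?f xs X (insert q Y) = (\<Sum>S\<in>Pow (insert q Y). (\<Prod>s\<in>S. w (xs i) (xs s)) * ?f xs (X - {i} \<union> S) (insert q Y - S))"
      using Y finY step i by (intro forest_step) auto
    also have "\<dots> = (\<Sum>S\<in>Pow Y. (\<Prod>s\<in>S. w (xs i) (xs s)) * ?f xs (X - {i} \<union> S) (insert q Y - S) +
       (\<Prod>s\<in>insert q S. w (xs i) (xs s)) * ?f xs (X - {i} \<union> insert q S) (insert q Y - insert q S))"
      using finY qY by (rule sum_Pow_insert)
    also have "\<dots> = (\<Sum>S\<in>Pow Y. (\<Prod>s\<in>S. w (xs i) (xs s)) * ?\<Psi> S (Y - S) xs)"
    proof (intro sum.cong refl)
      fix S assume S: "S \<in> Pow Y"
      then have "finite S" "q \<notin> S" using finY qY finite_subset[of S Y] by auto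
      moreover have "insert q Y - S = insert q (Y - S)" "insert q Y - insert q S = Y - S"
        "X - {i} \<union> insert q S = insert q (X - {i} \<union> S)" using S qY by auto
      ultimately show "(\<Prod>s\<in>S. w (xs i) (xs s)) * ?f xs (X - {i} \<union> S) (insert q Y - S) +
       (\<Prod>s\<in>insert q S. w (xs i) (xs s)) * ?f xs (X - {i} \<union> insert q S) (insert q Y - insert q S)
        = (\<Prod>s\<in>S. w (xs i) (xs s)) * ?\<Psi> S (Y - S) xs"
        by (simp only: prod.insert not_False_eq_True distrib_left mult_ac)
    qed
    finally show "?f xs X (insert q Y) = (\<Sum>S\<in>Pow Y. (\<Prod>s\<in>S. w (xs i) (xs s)) * ?\<Psi> S (Y - S) xs)" .
  qed
  also have "\<dots> = (\<Sum>S\<in>Pow V. ?t ^ card S * pint M S (\<lambda>ys. (\<Prod>s\<in>S. w (xs i) (ys s) * e (ys s)) * ?q S (?\<Psi> S) ys) xs)"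
    using step.hyps step.prems i fin fin2
    by (intro qsum_step e w borel_measurable_add borel_measurable_times_ennreal measurable_points_pair measurable_forest) auto
  \<comment> \<open>If the path runs through a child s of i, that child contributes
    \<open>?D\<close> and its siblings \<open>?G\<close> each; otherwise all children contribute
    \<open>?G\<close> and the path is accounted for by L.\<close>
  also have "\<dots> \<le> (\<Sum>S\<in>Pow V. ?t ^ card S * (P * (L * ?G ^ card S + (\<Sum>s\<in>S. ?D * ?G ^ card (S - {s})))))"
  proof (intro sum_mono mult_left_mono)
    fix S assume S: "S \<in> Pow V"
    then have finS: "finite S" and qS: "q \<notin> S" and iS: "i \<notin> S" using step i finite_subset[of S V] by auto
    have gS: "(\<lambda>ys. \<Prod>s\<in>S. ?g (ys s)) \<in> borel_measurable (points M)"
      by (intro borel_measurable_prod_ennreal measurable_points_component[OF gm])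
    have gC: "(\<lambda>ys. (\<Prod>s\<in>S. ?g (ys s)) * C (ys k)) \<in> borel_measurable (points M)" for k
      by (intro borel_measurable_times_ennreal gS measurable_points_component C)
    have gL: "(\<lambda>ys. L * (\<Prod>s\<in>S. ?g (ys s))) \<in> borel_measurable (points M)"
      by (intro borel_measurable_times_ennreal[OF borel_measurable_const] gS)
    have gsum: "(\<lambda>ys. \<Sum>k\<in>S. (\<Prod>s\<in>S. ?g (ys s)) * C (ys k)) \<in> borel_measurable (points M)"
      by (intro borel_measurable_sum gC)
    have "pint M S (\<lambda>ys. (\<Prod>s\<in>S. w (xs i) (ys s) * e (ys s)) * ?q S (?\<Psi> S) ys) xs
      \<le> pint M S (\<lambda>ys. P * (L * (\<Prod>s\<in>S. ?g (ys s)) + (\<Sum>k\<in>S. (\<Prod>s\<in>S. ?g (ys s)) * C (ys k)))) xs"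
    proof (rule pint_mono)
      fix ys assume ys: "ys \<in> space (points M)" "\<And>k. k \<notin> S \<Longrightarrow> ys k = xs k"
      have yq: "ys q = y" and yi: "ys i = xs i" using ys(2) qS iS step.prems by auto
      have tau: "\<tau> * card (V - S) \<le> 1"
        using mult_left_mono[of "real (card (V - S))" "card V" \<tau>] card_mono[of V "V - S"] step by auto
      have f1: "?q S (\<lambda>Y xs. ?f xs (X - {i} \<union> S) (insert q Y)) ys \<le>
        (\<Prod>k\<in>X - {i} \<union> S. ?A (ys k)) * ?A y * (\<Sum>k\<in>X - {i} \<union> S. C (ys k))"
        using S i step.prems step.hyps ys(1) yq tau qS by (intro step.IH) auto
      have f2: "?q S (\<lambda>Y xs. ?f xs (insert q (X - {i} \<union> S)) Y) ys \<le> (\<Prod>k\<in>insert q (X - {i} \<union> S). ?A (ys k))"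
        using S i step.prems step.hyps ys(1) tau qS finS
        by (intro qsum_forest_le[OF e w a KP]) auto
      have f3: "(\<Prod>k\<in>insert q (X - {i} \<union> S). ?A (ys k)) = (\<Prod>k\<in>X - {i} \<union> S. ?A (ys k)) * ?A y"
        using step.prems step.hyps qS finS yq by (subst prod.insert) (auto simp: mult.commute)
      have "?q S (?\<Psi> S) ys = ?q S (\<lambda>Y xs. ?f xs (X - {i} \<union> S) (insert q Y)) ys +
          w (ys i) (ys q) * ?q S (\<lambda>Y xs. ?f xs (insert q (X - {i} \<union> S)) Y) ys"
      proof (rule qsum_add_cmult)
        show "w (zs i) (zs q) = w (ys i) (ys q)" if "\<And>k. k \<notin> V - S \<Longrightarrow> zs k = ys k" for zs
        proof -
          have "i \<notin> V - S" "q \<notin> V - S" using step.hyps step.prems i by auto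
          then show ?thesis using that by simp
        qed
      qed (use step.hyps step.prems i S ys e w finS qS fin2 in
          \<open>auto intro!: measurable_forest\<close>)
      also have "\<dots> \<le> (\<Prod>k\<in>X - {i} \<union> S. ?A (ys k)) * ?A y * (\<Sum>k\<in>X - {i} \<union> S. C (ys k)) +
         w (ys i) (ys q) * ((\<Prod>k\<in>X - {i} \<union> S. ?A (ys k)) * ?A y)"
        using f1 f2 unfolding f3 by (intro add_mono mult_left_mono) auto
      also have "\<dots> = ((\<Prod>k\<in>X - {i} \<union> S. ?A (ys k)) * ?A y) * ((\<Sum>k\<in>X - {i} \<union> S. C (ys k)) + w (xs i) y)"
        by (simp add: yq yi distrib_left mult_ac)
      also have "(\<Prod>k\<in>X - {i} \<union> S. ?A (ys k)) = (\<Prod>k\<in>X - {i}. ?A (ys k)) * (\<Prod>k\<in>S. ?A (ys k))"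
        using S step finS by (intro prod.union_disjoint) auto
      also have "(\<Prod>k\<in>X - {i}. ?A (ys k)) = (\<Prod>k\<in>X - {i}. ?A (xs k))"
        using S step by (intro prod.cong refl arg_cong[where f="\<lambda>x. ?A x"] ys(2)) auto
      also have "(\<Sum>k\<in>X - {i} \<union> S. C (ys k)) = (\<Sum>k\<in>X - {i}. C (ys k)) + (\<Sum>k\<in>S. C (ys k))"
        using S step finS by (intro sum.union_disjoint) auto
      also have "(\<Sum>k\<in>X - {i}. C (ys k)) = (\<Sum>k\<in>X - {i}. C (xs k))"
        using S step by (intro sum.cong refl arg_cong[where f="\<lambda>x. C x"] ys(2)) auto
      also have "((\<Prod>k\<in>X - {i}. ?A (xs k)) * (\<Prod>k\<in>S. ?A (ys k)) * ?A y) *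
          ((\<Sum>k\<in>X - {i}. C (xs k)) + (\<Sum>k\<in>S. C (ys k)) + w (xs i) y)
          = P * (\<Prod>k\<in>S. ?A (ys k)) * (L + (\<Sum>k\<in>S. C (ys k)))"
        unfolding P_def L_def by (simp only: mult_ac add_ac)
      finally have "(\<Prod>s\<in>S. w (xs i) (ys s) * e (ys s)) * ?q S (?\<Psi> S) ys
         \<le> (\<Prod>s\<in>S. w (xs i) (ys s) * e (ys s)) * (P * (\<Prod>k\<in>S. ?A (ys k)) * (L + (\<Sum>k\<in>S. C (ys k))))"
        by (intro mult_left_mono) auto
      also have "\<dots> = P * ((\<Prod>s\<in>S. ?g (ys s)) * (L + (\<Sum>k\<in>S. C (ys k))))"
        by (simp only: prod.distrib mult_ac)
      also have "(\<Prod>s\<in>S. ?g (ys s)) * (L + (\<Sum>k\<in>S. C (ys k))) =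
          L * (\<Prod>s\<in>S. ?g (ys s)) + (\<Sum>k\<in>S. (\<Prod>s\<in>S. ?g (ys s)) * C (ys k))"
        by (simp only: distrib_left sum_distrib_left mult.commute[of L])
      finally show "(\<Prod>s\<in>S. w (xs i) (ys s) * e (ys s)) * ?q S (?\<Psi> S) ys
         \<le> P * (L * (\<Prod>s\<in>S. ?g (ys s)) + (\<Sum>k\<in>S. (\<Prod>s\<in>S. ?g (ys s)) * C (ys k)))" .
    qed (use step.prems in auto)
    also have "\<dots> = P * pint M S (\<lambda>ys. L * (\<Prod>s\<in>S. ?g (ys s)) + (\<Sum>k\<in>S. (\<Prod>s\<in>S. ?g (ys s)) * C (ys k))) xs"
      using step.prems by (intro pint_cmult borel_measurable_add gL gsum) auto
    also have "pint M S (\<lambda>ys. L * (\<Prod>s\<in>S. ?g (ys s)) + (\<Sum>k\<in>S. (\<Prod>s\<in>S. ?g (ys s)) * C (ys k))) xs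
       = pint M S (\<lambda>ys. L * (\<Prod>s\<in>S. ?g (ys s))) xs + pint M S (\<lambda>ys. \<Sum>k\<in>S. (\<Prod>s\<in>S. ?g (ys s)) * C (ys k)) xs"
      using step.prems by (intro pint_add gL gsum) auto
    also have "pint M S (\<lambda>ys. L * (\<Prod>s\<in>S. ?g (ys s))) xs = L * pint M S (\<lambda>ys. \<Prod>s\<in>S. ?g (ys s)) xs"
      using step.prems gS by (intro pint_cmult) auto
    also have "pint M S (\<lambda>ys. \<Prod>s\<in>S. ?g (ys s)) xs = ?G ^ card S"
      using finS gm by (subst pint_prod) auto
    also have "pint M S (\<lambda>ys. \<Sum>k\<in>S. (\<Prod>s\<in>S. ?g (ys s)) * C (ys k)) xs = (\<Sum>k\<in>S. pint M S (\<lambda>ys. (\<Prod>s\<in>S. ?g (ys s)) * C (ys k)) xs)"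
      using step.prems gC by (intro pint_sum) auto
    also have "\<dots> = (\<Sum>k\<in>S. ?D * ?G ^ card (S - {k}))"
    proof (intro sum.cong refl)
      fix k assume k: "k \<in> S"
      let ?gg = "\<lambda>s z. if s = k then ?g z * C z else ?g z"
      have "(\<Prod>s\<in>S. ?g (ys s)) * C (ys k) = (\<Prod>s\<in>S. ?gg s (ys s))" for ys
      proof -
        have "(\<Prod>s\<in>S. ?gg s (ys s)) = ?gg k (ys k) * (\<Prod>s\<in>S - {k}. ?gg s (ys s))"
          using finS k by (intro prod.remove)
        also have "(\<Prod>s\<in>S - {k}. ?gg s (ys s)) = (\<Prod>s\<in>S - {k}. ?g (ys s))" by (intro prod.cong) auto
        also have "?gg k (ys k) * \<dots> = (?g (ys k) * (\<Prod>s\<in>S - {k}. ?g (ys s))) * C (ys k)" by (simp add: mult_ac)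
        also have "?g (ys k) * (\<Prod>s\<in>S - {k}. ?g (ys s)) = (\<Prod>s\<in>S. ?g (ys s))"
          using finS k by (intro prod.remove[symmetric])
        finally show ?thesis by simp
      qed
      then have "pint M S (\<lambda>ys. (\<Prod>s\<in>S. ?g (ys s)) * C (ys k)) xs = pint M S (\<lambda>ys. \<Prod>s\<in>S. ?gg s (ys s)) xs"
        by simp
      also have "\<dots> = (\<Prod>s\<in>S. \<integral>\<^sup>+ z. ?gg s z \<partial>M)"
        using finS gm C(1) by (intro pint_prod) auto
      also have "\<dots> = (\<integral>\<^sup>+ z. ?gg k z \<partial>M) * (\<Prod>s\<in>S - {k}. \<integral>\<^sup>+ z. ?gg s z \<partial>M)"
        using finS k by (intro prod.remove)
      also have "(\<Prod>s\<in>S - {k}. \<integral>\<^sup>+ z. ?gg s z \<partial>M) = (\<Prod>s\<in>S - {k}. ?G)" by (intro prod.cong) auto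
      finally show "pint M S (\<lambda>ys. (\<Prod>s\<in>S. ?g (ys s)) * C (ys k)) xs = ?D * ?G ^ card (S - {k})" by simp
    qed
    finally show "pint M S (\<lambda>ys. (\<Prod>s\<in>S. w (xs i) (ys s) * e (ys s)) * ?q S (?\<Psi> S) ys) xs
      \<le> P * (L * ?G ^ card S + (\<Sum>s\<in>S. ?D * ?G ^ card (S - {s})))" .
  qed auto
  also have "\<dots> = P * (L * (\<Sum>S\<in>Pow V. ?t ^ card S * ?G ^ card S) +
      (\<Sum>S\<in>Pow V. \<Sum>s\<in>S. ?t ^ card S * (?D * ?G ^ card (S - {s}))))"
    by (simp add: sum_distrib_left distrib_left sum.distrib mult_ac)
  \<comment> \<open>Choosing the child on the path first leaves a free sum over its siblings. The
    choice itself costs one factor t for each label of V, in total at most 1.\<close>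
  also have "(\<Sum>S\<in>Pow V. \<Sum>s\<in>S. ?t ^ card S * (?D * ?G ^ card (S - {s}))) =
     (\<Sum>s\<in>V. \<Sum>Z\<in>Pow (V - {s}). ?t ^ card (insert s Z) * (?D * ?G ^ card (insert s Z - {s})))"
    using step by (intro sum_Pow_mem)
  also have "\<dots> = (\<Sum>s\<in>V. ?t * ?D * (\<Sum>Z\<in>Pow (V - {s}). ?t ^ card Z * ?G ^ card Z))"
  proof (intro sum.cong refl)
    fix s assume "s \<in> V"
    have "?t ^ card (insert s Z) * (?D * ?G ^ card (insert s Z - {s})) = ?t * ?D * (?t ^ card Z * ?G ^ card Z)"
      if "Z \<in> Pow (V - {s})" for Z
    proof -
      have "s \<notin> Z" "finite Z" using that step finite_subset[of Z V] by auto
      then show ?thesis by (simp add: mult_ac)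
    qed
    then show "(\<Sum>Z\<in>Pow (V - {s}). ?t ^ card (insert s Z) * (?D * ?G ^ card (insert s Z - {s}))) =
      ?t * ?D * (\<Sum>Z\<in>Pow (V - {s}). ?t ^ card Z * ?G ^ card Z)" by (simp add: sum_distrib_left)
  qed
  also have "P * (L * (\<Sum>S\<in>Pow V. ?t ^ card S * ?G ^ card S) + \<dots>) \<le>
     P * (L * ?A (xs i) + (\<Sum>s\<in>V. ?t * ?D * ?A (xs i)))"
  proof (intro mult_left_mono add_mono sum_mono sum_Pow_power_le_exp)
    fix s
    show "\<tau> * card (V - {s}) \<le> 1"
      using mult_left_mono[of "real (card (V - {s}))" "card V" \<tau>] card_mono[of V "V - {s}"] step by auto
  qed (use step a(2)[OF i_space] G in auto)
  also have "(\<Sum>s\<in>V. ?t * ?D * ?A (xs i)) = (of_nat (card V) * ?t) * (?D * ?A (xs i))"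
    by (simp add: mult_ac)
  also have "of_nat (card V) * ?t = ennreal (\<tau> * card V)"
    using step by (simp add: ennreal_mult'' mult.commute ennreal_of_nat_eq_real_of_nat)
  also have "P * (L * ?A (xs i) + ennreal (\<tau> * card V) * (?D * ?A (xs i))) \<le> P * (L * ?A (xs i) + 1 * (?D * ?A (xs i)))"
    using step by (intro mult_left_mono add_left_mono mult_right_mono) (auto simp: ennreal_le_1)
  also have "\<dots> = (?A (xs i) * P) * (L + ?D)" by (simp add: algebra_simps)
  \<comment> \<open>Together \<open>w (xs i) y\<close> and \<open>?D\<close> are at most
    \<open>C (xs i)\<close> by the supersolution property.\<close>
  also have "\<dots> \<le> (?A (xs i) * P) * ((\<Sum>k\<in>X - {i}. C (xs k)) + C (xs i))"
    using C(2)[OF i_space] unfolding L_def by (intro mult_left_mono) (auto simp: add.assoc intro!: add_left_mono)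
  also have "\<dots> = (\<Prod>k\<in>X. ?A (xs k)) * ?A y * (\<Sum>k\<in>X. C (xs k))"
    using step i by (simp add: P_def prod.remove[of X i] sum.remove[of X i] mult.assoc add.commute)
  finally show ?case .
qed

end

section \<open>Iterated integrals and chains\<close>

lemma nn_iter_mono:
  assumes "\<And>ys. (\<And>i. i \<notin> {k..<k + m} \<Longrightarrow> ys i = xs i) \<Longrightarrow> (\<And>i. i \<in> {k..<k + m} \<Longrightarrow> ys i \<in> space M) \<Longrightarrow>
    F ys \<le> G ys"
  shows "nn_iter M m k F xs \<le> nn_iter M m k G xs"
  using assms
proof (induction m arbitrary: k xs)
  case (Suc m)
  have "nn_iter M m (Suc k) F (xs(k := z)) \<le> nn_iter M m (Suc k) G (xs(k := z))" if z: "z \<in> space M" for z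
  proof (rule Suc.IH)
    fix ys assume ys: "\<And>i. i \<notin> {Suc k..<Suc k + m} \<Longrightarrow> ys i = (xs(k := z)) i" "\<And>i. i \<in> {Suc k..<Suc k + m} \<Longrightarrow> ys i \<in> space M"
    show "F ys \<le> G ys"
    proof (rule Suc.prems)
      show "ys i = xs i" if "i \<notin> {k..<k + Suc m}" for i using that ys(1)[of i] by auto
      show "ys i \<in> space M" if "i \<in> {k..<k + Suc m}" for i
        using that ys(1)[of k] ys(2)[of i] z by (cases "i = k") auto
    qed
  qed
  then show ?case by (auto intro!: nn_integral_mono)
qed auto

lemma nn_iter_cong:
  assumes "\<And>ys. (\<And>i. i \<notin> {k..<k + m} \<Longrightarrow> ys i = xs i) \<Longrightarrow> (\<And>i. i \<in> {k..<k + m} \<Longrightarrow> ys i \<in> space M) \<Longrightarrow>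
    F ys = G ys"
  shows "nn_iter M m k F xs = nn_iter M m k G xs"
proof (rule antisym; rule nn_iter_mono)
  fix ys assume "\<And>i. i \<notin> {k..<k + m} \<Longrightarrow> ys i = xs i" "\<And>i. i \<in> {k..<k + m} \<Longrightarrow> ys i \<in> space M"
  then have "F ys = G ys" by (rule assms)
  then show "F ys \<le> G ys" "G ys \<le> F ys" by simp_all
qed

text \<open>A non-integrable function has Bochner integral 0, so the estimate holds at every level
  without integrability; the density h has modulus 1 and drops out.\<close>

lemma norm_cint_iter_le:
  assumes "\<forall>x\<in>space M. cmod (h x) = 1"
  shows "ennreal (cmod (cint_iter M h m k F xs)) \<le> nn_iter M m k (\<lambda>xs. ennreal (cmod (F xs))) xs"
proof (induction m arbitrary: k xs)
  case (Suc m)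
  let ?f = "\<lambda>z. h z * cint_iter M h m (Suc k) F (xs(k := z))"
  have "ennreal (cmod (LINT z|M. ?f z)) \<le> (\<integral>\<^sup>+ z. ennreal (cmod (?f z)) \<partial>M)"
  proof (cases "integrable M ?f")
    case True
    then show ?thesis by (rule integral_norm_bound_ennreal)
  qed (simp add: not_integrable_integral_eq)
  also have "\<dots> \<le> (\<integral>\<^sup>+ z. nn_iter M m (Suc k) (\<lambda>xs. ennreal (cmod (F xs))) (xs(k := z)) \<partial>M)"
    using assms Suc.IH by (intro nn_integral_mono) (simp add: norm_mult)
  finally show ?case by simp
qed simp

text \<open>The factor \<open>exp (w x)\<close> at the starting point is left out. In this form the
  sum over m satisfies the path equation required of C in
  \<open>qsum_forest_marked_le\<close>.\<close>

primrec chain_from :: "'a measure \<Rightarrow> ('a \<Rightarrow> 'a \<Rightarrow> real) \<Rightarrow> ('a \<Rightarrow> real) \<Rightarrow> 'a \<Rightarrow> nat \<Rightarrow> 'a \<Rightarrow> ennreal" where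
  "chain_from M K w y 0 x = ennreal (K x y)"
| "chain_from M K w y (Suc m) x = (\<integral>\<^sup>+ z. ennreal (K x z) * ennreal (exp (w z)) * chain_from M K w y m z \<partial>M)"

context finite_measure
begin

lemma chain_from_measurable:
  assumes K: "case_prod K \<in> borel_measurable (M \<Otimes>\<^sub>M M)" and w: "w \<in> borel_measurable M" and y: "y \<in> space M"
  shows "chain_from M K w y m \<in> borel_measurable M"
proof (induction m)
  case 0
  have "(\<lambda>x. K x y) \<in> borel_measurable M"
    using measurable_compose[OF measurable_Pair2'[OF y] K] by simp
  then show ?case by simp
next
  case (Suc m)
  have "(\<lambda>(x, z). ennreal (K x z) * ennreal (exp (w z)) * chain_from M K w y m z) \<in> borel_measurable (M \<Otimes>\<^sub>M M)"
    using K w Suc by measurable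
  then show ?case using borel_measurable_nn_integral by simp
qed

text \<open>The first link has both endpoints fixed once its outer variable is chosen, so it can be
  moved into the prefactor c. Generalizing over c and the starting index k makes the induction on
  the number of links possible.\<close>

lemma nn_iter_chain:
  fixes K :: "'a \<Rightarrow> 'a \<Rightarrow> real"
  assumes K: "case_prod K \<in> borel_measurable (M \<Otimes>\<^sub>M M)" "\<And>s t. 0 \<le> K s t"
    and w: "w \<in> borel_measurable M" and y: "y \<in> space M"
    and "xs k \<in> space M" "xs (Suc (k + m)) = y"
  shows "nn_iter M m (Suc k) (\<lambda>xs. c * (\<Prod>i\<in>{k..k + m}. ennreal (K (xs i) (xs (Suc i)) * exp (w (xs i))))) xs
    = c * (ennreal (exp (w (xs k))) * chain_from M K w y m (xs k))"
  using assms(5,6)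
proof (induction m arbitrary: k xs c)
  case 0
  then show ?case using K by (simp add: ennreal_mult mult.commute)
next
  case (Suc m)
  let ?p = "\<lambda>xs i. ennreal (K (xs i) (xs (Suc i)) * exp (w (xs i)))"
  have Kx: "K (xs k) \<in> borel_measurable M"
    using measurable_compose[OF measurable_Pair1'[OF Suc.prems(1)] K(1)] by simp
  have "nn_iter M m (Suc (Suc k)) (\<lambda>xs. c * (\<Prod>i\<in>{k..k + Suc m}. ?p xs i)) (xs(Suc k := z))
    = c * ennreal (K (xs k) z * exp (w (xs k))) * (ennreal (exp (w z)) * chain_from M K w y m z)"
    if z: "z \<in> space M" for z
  proof -
    have "nn_iter M m (Suc (Suc k)) (\<lambda>xs. c * (\<Prod>i\<in>{k..k + Suc m}. ?p xs i)) (xs(Suc k := z))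
      = nn_iter M m (Suc (Suc k)) (\<lambda>ys. c * ennreal (K (xs k) z * exp (w (xs k))) * (\<Prod>i\<in>{Suc k..Suc k + m}. ?p ys i)) (xs(Suc k := z))"
    proof (rule nn_iter_cong)
      fix ys assume ys: "\<And>i. i \<notin> {Suc (Suc k)..<Suc (Suc k) + m} \<Longrightarrow> ys i = (xs(Suc k := z)) i"
      have "{k..k + Suc m} = insert k {Suc k..Suc k + m}" by auto
      moreover have "ys k = xs k" "ys (Suc k) = z" using ys[of k] ys[of "Suc k"] by auto
      ultimately show "c * (\<Prod>i\<in>{k..k + Suc m}. ?p ys i) = c * ennreal (K (xs k) z * exp (w (xs k))) * (\<Prod>i\<in>{Suc k..Suc k + m}. ?p ys i)"
        by (simp add: mult.assoc)
    qed
    also have "\<dots> = c * ennreal (K (xs k) z * exp (w (xs k))) *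
        (ennreal (exp (w ((xs(Suc k := z)) (Suc k)))) * chain_from M K w y m ((xs(Suc k := z)) (Suc k)))"
      using Suc.prems z by (intro Suc.IH) auto
    finally show ?thesis by simp
  qed
  then have "nn_iter M (Suc m) (Suc k) (\<lambda>xs. c * (\<Prod>i\<in>{k..k + Suc m}. ?p xs i)) xs
    = (\<integral>\<^sup>+ z. c * ennreal (K (xs k) z * exp (w (xs k))) * (ennreal (exp (w z)) * chain_from M K w y m z) \<partial>M)"
    unfolding nn_iter.simps by (intro nn_integral_cong) blast
  also have "\<dots> = (\<integral>\<^sup>+ z. (c * ennreal (exp (w (xs k)))) * (ennreal (K (xs k) z) * ennreal (exp (w z)) * chain_from M K w y m z) \<partial>M)"
    using K by (intro nn_integral_cong) (simp add: ennreal_mult mult_ac)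
  also have "\<dots> = (c * ennreal (exp (w (xs k)))) * chain_from M K w y (Suc m) (xs k)"
    unfolding chain_from.simps using chain_from_measurable[OF K(1) w y] Kx w
    by (intro nn_integral_cmult borel_measurable_times_ennreal) auto
  finally show ?case by (simp add: mult.assoc)
qed

lemma chain_term_eq:
  fixes K :: "'a \<Rightarrow> 'a \<Rightarrow> real"
  assumes "case_prod K \<in> borel_measurable (M \<Otimes>\<^sub>M M)" "\<And>s t. 0 \<le> K s t"
    and "w \<in> borel_measurable M" "x \<in> space M" "y \<in> space M"
  shows "chain_term M K w x y m = ennreal (exp (w x)) * chain_from M K w y m x"
  using nn_iter_chain[OF assms(1-3,5), of "(\<lambda>_. x)(Suc m := y)" 0 m 1] assms(4)
  by (simp add: chain_term_def)

text \<open>Any Y can be matched with the block starting at 3 while the vertices 1 and 2 stay in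
  place, and neither forest sums nor product measures notice the labels.\<close>

lemma pint_forest_card:
  fixes w :: "'a \<Rightarrow> 'a \<Rightarrow> ennreal" and e :: "'a \<Rightarrow> ennreal"
  defines "F \<equiv> \<lambda>xs Y. (\<Prod>y\<in>Y. e (xs y)) * forest (\<lambda>i j. w (xs i) (xs j)) {1} (insert 2 Y)"
  assumes e: "e \<in> borel_measurable M" and w: "case_prod w \<in> borel_measurable (M \<Otimes>\<^sub>M M)"
    and Y: "finite Y" "1 \<notin> Y" "2 \<notin> Y" and xs: "xs \<in> space (points M)"
  shows "pint M Y (\<lambda>xs. F xs Y) xs = pint M {3..<3 + card Y} (\<lambda>xs. F xs {3..<3 + card Y}) xs"
proof -
  define J where "J = {3..<3 + card Y}"
  have J: "finite J" "1 \<notin> J" "2 \<notin> J" "card J = card Y" by (auto simp: J_def)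
  obtain \<sigma> where \<sigma>: "bij_betw \<sigma> J Y" using finite_same_card_bij[of J Y] Y J by auto
  then have inj: "inj_on \<sigma> J" and im: "\<sigma> ` J = Y" by (auto simp: bij_betw_def)
  have "pint M (\<sigma> ` J) (\<lambda>xs. F xs Y) xs = pint M J (\<lambda>xs. F xs J) xs"
  proof (rule pint_image[OF _ inj _ xs])
    show "(\<lambda>xs. F xs J) \<in> borel_measurable (points M)"
      unfolding F_def using e w
      by (intro borel_measurable_times_ennreal borel_measurable_prod_ennreal measurable_points_component measurable_forest) (use J in auto)
    fix ys assume ys: "\<And>i. i \<notin> \<sigma> ` J \<Longrightarrow> ys i = xs i"
    define zs where "zs = override_on xs (ys \<circ> \<sigma>) J"
    define \<pi> where "\<pi> i = (if i \<in> J then \<sigma> i else i)" for i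
    have \<pi>J: "\<pi> ` J = Y" using im by (auto simp: \<pi>_def)
    have \<pi>12: "\<pi> 1 = 1" "\<pi> 2 = 2" using J by (simp_all add: \<pi>_def)
    then have \<pi>: "\<pi> ` {1} = {1}" "\<pi> ` insert 2 J = insert 2 Y" using \<pi>J by simp_all
    have "inj_on \<pi> J" using inj by (subst inj_on_cong[of _ \<pi> \<sigma>]) (auto simp: \<pi>_def)
    moreover have "J - {2} = J" "insert 2 J - {1} = insert 2 J" using J by auto
    ultimately have "inj_on \<pi> (insert 1 (insert 2 J))"
      using Y by (simp only: inj_on_insert \<pi> \<pi>J \<pi>12) simp
    then have "inj_on \<pi> ({1} \<union> insert 2 J)" by (simp only: insert_is_Un[symmetric])
    then have "forest (\<lambda>i j. w (ys i) (ys j)) (\<pi> ` {1}) (\<pi> ` insert 2 J) =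
      forest (\<lambda>i j. w (ys (\<pi> i)) (ys (\<pi> j))) {1} (insert 2 J)"
      using J by (intro forest_image) auto
    also have "\<dots> = forest (\<lambda>i j. w (zs i) (zs j)) {1} (insert 2 J)"
    proof (rule forest_cong)
      have "ys (\<pi> i) = zs i" if "i \<in> {1} \<union> insert 2 J" for i
        using that ys[of i] Y unfolding im by (auto simp: zs_def \<pi>_def override_on_def)
      then show "w (ys (\<pi> i)) (ys (\<pi> j)) = w (zs i) (zs j)" if "i \<in> {1} \<union> insert 2 J" "j \<in> insert 2 J" for i j
        using that by auto
    qed (use J in auto)
    finally have "forest (\<lambda>i j. w (ys i) (ys j)) {1} (insert 2 Y) = forest (\<lambda>i j. w (zs i) (zs j)) {1} (insert 2 J)"
      unfolding \<pi> .
    moreover have "(\<Prod>y\<in>Y. e (ys y)) = (\<Prod>j\<in>J. e (zs j))"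
      unfolding im[symmetric] using inj by (subst prod.reindex) (auto simp: zs_def override_on_def)
    ultimately show "F ys Y = F (override_on xs (ys \<circ> \<sigma>) J) J"
      unfolding F_def zs_def[symmetric] by simp
  qed (rule J)
  then show ?thesis unfolding im unfolding J_def .
qed

text \<open>For a pool of n labels with weight 1/n, the subsets of size k carry total weight (n
  choose k) / n^k, and the marked forest bound holds uniformly in n. With a fixed number K of terms,
  n tends to infinity and the weights become 1/k!; only then K is released.\<close>

lemma tree_series_le:
  fixes w :: "'a \<Rightarrow> 'a \<Rightarrow> ennreal" and e C :: "'a \<Rightarrow> ennreal" and a :: "'a \<Rightarrow> real"
  assumes e: "e \<in> borel_measurable M" and w: "case_prod w \<in> borel_measurable (M \<Otimes>\<^sub>M M)"
    and a: "a \<in> borel_measurable M" "\<And>x. x \<in> space M \<Longrightarrow> 0 \<le> a x"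
    and KP: "\<And>x. x \<in> space M \<Longrightarrow> (\<integral>\<^sup>+ y. w x y * e y * ennreal (exp (a y)) \<partial>M) \<le> ennreal (a x)"
    and C: "C \<in> borel_measurable M"
      "\<And>x. x \<in> space M \<Longrightarrow> w x (xs 2) + (\<integral>\<^sup>+ z. w x z * e z * ennreal (exp (a z)) * C z \<partial>M) \<le> C x"
    and xs: "xs \<in> space (points M)"
  shows "(\<Sum>k. ennreal (1 / fact k) * pint M {3..<3 + k}
      (\<lambda>xs. (\<Prod>y\<in>{3..<3 + k}. e (xs y)) * forest (\<lambda>i j. w (xs i) (xs j)) {1} (insert 2 {3..<3 + k})) xs)
    \<le> ennreal (exp (a (xs 1))) * ennreal (exp (a (xs 2))) * C (xs 1)"
proof -
  define J where "J k = pint M {3..<3 + k}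
      (\<lambda>xs. (\<Prod>y\<in>{3..<3 + k}. e (xs y)) * forest (\<lambda>i j. w (xs i) (xs j)) {1} (insert 2 {3..<3 + k})) xs" for k
  let ?R = "ennreal (exp (a (xs 1))) * ennreal (exp (a (xs 2))) * C (xs 1)"
  have bound: "(\<Sum>k<K. ennreal (real (n choose k) / real n ^ k) * J k) \<le> ?R" if n: "K \<le> n" "0 < n" for K n
  proof -
    let ?V = "{3..<3 + n}" and ?t = "ennreal (1 / real n)"
    have "(\<Sum>k<K. ennreal (real (n choose k) / real n ^ k) * J k) \<le> (\<Sum>k\<le>n. ennreal (real (n choose k) / real n ^ k) * J k)"
      using n by (intro sum_mono2) auto
    also have "\<dots> = (\<Sum>k\<le>card ?V. of_nat (card ?V choose k) * (?t ^ k * J k))"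
    proof (intro sum.cong)
      fix k
      have "ennreal (real (n choose k) / real n ^ k) = ennreal (real (n choose k)) * ennreal ((1 / real n) ^ k)"
        by (subst ennreal_mult[symmetric]) (auto simp: power_one_over)
      then show "ennreal (real (n choose k) / real n ^ k) * J k = of_nat (card ?V choose k) * (?t ^ k * J k)"
        by (simp add: ennreal_power ennreal_of_nat_eq_real_of_nat mult.assoc)
    qed simp
    also have "\<dots> = (\<Sum>Y\<in>Pow ?V. ?t ^ card Y * J (card Y))"
      by (rule sum_Pow_card[symmetric]) simp
    also have "\<dots> = qsum M e ?t ?V (\<lambda>Y xs. forest (\<lambda>i j. w (xs i) (xs j)) {1} (insert 2 Y)) xs"
      unfolding qsum_def
    proof (intro sum.cong refl arg_cong2[where f="(*)"])
      fix Y assume "Y \<in> Pow ?V"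
      then have "finite Y" "1 \<notin> Y" "2 \<notin> Y" by (auto dest: finite_subset)
      from pint_forest_card[OF e w this xs]
      show "J (card Y) = pint M Y (\<lambda>xs. (\<Prod>y\<in>Y. e (xs y)) * forest (\<lambda>i j. w (xs i) (xs j)) {1} (insert 2 Y)) xs"
        by (simp add: J_def)
    qed
    also have "\<dots> \<le> (\<Prod>i\<in>{1}. ennreal (exp (a (xs i)))) * ennreal (exp (a (xs 2))) * (\<Sum>i\<in>{1}. C (xs i))"
      using n xs by (intro qsum_forest_marked_le[OF e w a KP C]) auto
    finally show ?thesis by simp
  qed
  have "(\<Sum>k<K. ennreal (1 / fact k) * J k) \<le> ?R" for K
  proof (rule tendsto_le[OF sequentially_bot tendsto_const])
    show "(\<lambda>n. \<Sum>k<K. ennreal (real (n choose k) / real n ^ k) * J k) \<longlonglongrightarrow> (\<Sum>k<K. ennreal (1 / fact k) * J k)"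
      by (intro tendsto_sum tendsto_mult_ennreal tendsto_ennrealI LIMSEQ_binomial_over_power tendsto_const) auto
    show "eventually (\<lambda>n. (\<Sum>k<K. ennreal (real (n choose k) / real n ^ k) * J k) \<le> ?R) sequentially"
      by (rule eventually_mono[OF eventually_ge_at_top[of "Suc K"]]) (intro bound, auto)
  qed
  then show ?thesis unfolding J_def[symmetric] by (intro suminf_le_const summableI) auto
qed

text \<open>The n-point bounds hold for almost all configurations, whereas the terms of the series
  keep x and y fixed. By Fubini, for almost every pair the section of the exceptional set in the
  remaining points is null.\<close>

lemma AE_pint_null:
  assumes N: "N \<in> null_sets (PiM {1..j + 2} (\<lambda>_. M))"
  shows "AE p in M \<Otimes>\<^sub>M M. pint M {3..<3 + j} (\<lambda>xs. indicator N (restrict xs {1..j + 2})) ((\<lambda>_. fst p)(2 := snd p)) = 0"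
proof (cases "space M = {}")
  case True
  then show ?thesis by (intro AE_I2) (auto simp: space_pair_measure)
next
  case False
  then obtain x0 where x0: "x0 \<in> space M" by auto
  let ?n = "j + 2" and ?F = "\<lambda>xs. indicator N (restrict xs {1..j + 2}) :: ennreal"
  have F: "?F \<in> borel_measurable (points M)"
  proof -
    have "(\<lambda>xs. restrict xs {1..?n}) \<in> points M \<rightarrow>\<^sub>M PiM {1..?n} (\<lambda>_. M)" by (intro measurable_restrict_subset) auto
    from measurable_compose[OF this borel_measurable_indicator[OF null_setsD2[OF N]]] show ?thesis .
  qed
  have upd: "(\<lambda>p. (\<lambda>_. fst p)(2 := snd p)) \<in> M \<Otimes>\<^sub>M M \<rightarrow>\<^sub>M points M"
    by (rule measurable_PiM_single'[where f="\<lambda>k p. ((\<lambda>_. fst p)(2 := snd p)) k"])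
       (auto simp: space_pair_measure)
  let ?g = "\<lambda>p. pint M {3..<3 + j} ?F ((\<lambda>_. fst p)(2 := snd p))"
  have g: "?g \<in> borel_measurable (M \<Otimes>\<^sub>M M)"
    using measurable_compose[OF upd pint_measurable[OF _ F, of "{3..<3 + j}"]] by simp
  have i2: "insert 2 {3..<3 + j} = {2..<3 + j}" and i1: "insert 1 {2..<3 + j} = {1..?n}" by auto
  have "integral\<^sup>N (M \<Otimes>\<^sub>M M) ?g = (\<integral>\<^sup>+ x. \<integral>\<^sup>+ y. ?g (x, y) \<partial>M \<partial>M)"
    using nn_integral_fst[OF g] by simp
  also have "\<dots> = (\<integral>\<^sup>+ x. pint M {2..<3 + j} ?F ((\<lambda>_. x0)(1 := x)) \<partial>M)"
  proof (rule nn_integral_cong)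
    fix x assume x: "x \<in> space M"
    have "(\<integral>\<^sup>+ y. ?g (x, y) \<partial>M) = pint M {2..<3 + j} ?F (\<lambda>_. x)"
      using pint_insert[of "{3..<3 + j}" 2 ?F "\<lambda>_. x"] F x unfolding i2 by (simp add: space_points)
    \<comment> \<open>The two base points differ only at coordinates that are integrated or erased
      by \<open>restrict\<close>.\<close>
    also have "\<dots> = pint M {2..<3 + j} ?F ((\<lambda>_. x0)(1 := x))"
      unfolding pint_def
    proof (rule nn_integral_cong)
      fix \<omega>
      have "restrict (override_on (\<lambda>_. x) \<omega> {2..<3 + j}) {1..?n} = restrict (override_on ((\<lambda>_. x0)(1 := x)) \<omega> {2..<3 + j}) {1..?n}"
        by (rule restrict_ext) (auto simp: override_on_def)
      then show "?F (override_on (\<lambda>_. x) \<omega> {2..<3 + j}) = ?F (override_on ((\<lambda>_. x0)(1 := x)) \<omega> {2..<3 + j})"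
        by (simp only:)
    qed
    finally show "(\<integral>\<^sup>+ y. ?g (x, y) \<partial>M) = pint M {2..<3 + j} ?F ((\<lambda>_. x0)(1 := x))" .
  qed
  also have "\<dots> = pint M {1..?n} ?F (\<lambda>_. x0)"
    using pint_insert[of "{2..<3 + j}" 1 ?F "\<lambda>_. x0"] F x0 unfolding i1 by (simp add: space_points)
  also have "\<dots> = (\<integral>\<^sup>+\<omega>. indicator N \<omega> \<partial>PiM {1..?n} (\<lambda>_. M))"
    unfolding pint_def
  proof (rule nn_integral_cong)
    fix \<omega> assume "\<omega> \<in> space (PiM {1..?n} (\<lambda>_. M))"
    then have "restrict (override_on (\<lambda>_. x0) \<omega> {1..?n}) {1..?n} = \<omega>"
      by (auto simp: space_PiM PiE_iff extensional_def restrict_def override_on_def fun_eq_iff)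
    then show "?F (override_on (\<lambda>_. x0) \<omega> {1..?n}) = indicator N \<omega>" by simp
  qed
  also have "\<dots> = 0" using N by (simp add: null_setsD1 null_setsD2)
  finally show ?thesis using nn_integral_0_iff_AE[OF g] by simp
qed

lemma AE_PiM_component_finite:
  assumes "finite I" "i \<in> I" "AE x in M. P x"
  shows "AE \<omega> in PiM I (\<lambda>_::nat. M). P (\<omega> i)"
proof -
  interpret product_sigma_finite "\<lambda>_::nat. M" by (rule product_sigma_finite_const)
  from assms(3) obtain N where N: "{x \<in> space M. \<not> P x} \<subseteq> N" "emeasure M N = 0" "N \<in> sets M" by (rule AE_E)
  have m: "(\<lambda>\<omega>. indicator N (\<omega> i) :: ennreal) \<in> borel_measurable (PiM I (\<lambda>_. M))"
    using measurable_compose[OF measurable_component_singleton[OF assms(2)] borel_measurable_indicator[OF N(3)]] .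
  let ?f = "\<lambda>k. if k = i then indicator N else (\<lambda>_. 1 :: ennreal)"
  have "(\<integral>\<^sup>+\<omega>. indicator N (\<omega> i) \<partial>PiM I (\<lambda>_. M)) = (\<integral>\<^sup>+\<omega>. (\<Prod>k\<in>I. ?f k (\<omega> k)) \<partial>PiM I (\<lambda>_. M))"
  proof (rule nn_integral_cong)
    fix \<omega>
    have "(\<Prod>k\<in>I. ?f k (\<omega> k)) = (\<Prod>k\<in>I. if k = i then indicator N (\<omega> i) else 1)" by (intro prod.cong) auto
    then show "indicator N (\<omega> i) = (\<Prod>k\<in>I. ?f k (\<omega> k))" using assms(1,2) by simp
  qed
  also have "\<dots> = (\<Prod>k\<in>I. integral\<^sup>N M (?f k))"
    using assms N(3) by (intro product_nn_integral_prod) auto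
  also have "\<dots> = 0" using assms N by (intro prod_zero) (auto intro!: bexI[of _ i])
  finally have "AE \<omega> in PiM I (\<lambda>_. M). (indicator N (\<omega> i) :: ennreal) = 0"
    using nn_integral_0_iff_AE[OF m] by simp
  from this AE_space show ?thesis
  proof eventually_elim
    case (elim \<omega>)
    then have "\<omega> i \<notin> N" "\<omega> i \<in> space M" using assms(2) by (auto simp: space_PiM split: split_indicator_asm)
    then show ?case using N(1) by auto
  qed
qed

end

section \<open>The two-point function\<close>

lemma conn_sum_cong:
  assumes "\<And>e. e \<in> vpairs V \<Longrightarrow> z e = z' e"
  shows "conn_sum z V = conn_sum z' V"
  unfolding conn_sum_def using assms by (intro sum.cong refl prod.cong) (auto simp: connected_on_def)

lemma phi_eq_conn_sum:
  "phi z n xs = (1 / fact n) * conn_sum (\<lambda>e. z (xs (Min e)) (xs (Max e))) {1..n}"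
  by (simp add: phi_def conn_sum_def conn_graphs_eq)

lemma vpairs_Min_Max:
  assumes "e \<in> vpairs V"
  shows "Min e \<in> V" "Max e \<in> V"
  using assms by (auto simp: vpairs_def min_def max_def)

context finite_measure
begin

text \<open>Common to both halves of the theorem: K is the modulus of \<open>zeta\<close> with c =
  2b, or of \<open>ubar\<close> with c = b. Apart from the corresponding integral assumption, only
  the tree-graph inequality \<open>tree\<close> tells them apart.\<close>

lemma Zhat_bound:
  fixes h :: "'a \<Rightarrow> complex" and z :: "'a \<Rightarrow> 'a \<Rightarrow> complex" and K :: "'a \<Rightarrow> 'a \<Rightarrow> real"
    and a c :: "'a \<Rightarrow> real"
  assumes h: "\<forall>x\<in>space M. cmod (h x) = 1"
    and K: "case_prod K \<in> borel_measurable (M \<Otimes>\<^sub>M M)" "\<And>s t. 0 \<le> K s t"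
    and c: "c \<in> borel_measurable M"
    and a: "a \<in> borel_measurable M" "\<forall>x\<in>space M. 0 \<le> a x"
    and KP: "AE x in M. (\<integral>\<^sup>+ y. ennreal (K x y * exp (a y + c y)) \<partial>M) \<le> ennreal (a x)"
    and tree: "\<And>n. 1 \<le> n \<Longrightarrow> AE xs in PiM {1..n} (\<lambda>_. M).
        cmod (conn_sum (\<lambda>e. z (xs (Min e)) (xs (Max e))) {1..n})
          \<le> (\<Prod>i\<in>{1..n}. exp (c (xs i))) * forest (\<lambda>i j. K (xs i) (xs j)) {1} ({1..n} - {1})"
  shows "AE p in M \<Otimes>\<^sub>M M. case p of (x, y) \<Rightarrow>
            (let R = ennreal (exp (a y + c y)) *
                  (ennreal (K x y * exp (a x + c x)) + (\<Sum>m. chain_term M K (\<lambda>s. a s + c s) x y (Suc m)))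
             in R < \<infinity> \<longrightarrow> summable (Zterm M h z x y) \<and> ennreal (cmod (Zhat M h z x y)) \<le> R)"
proof -
  define G where "G = {x \<in> space M. (\<integral>\<^sup>+ y. ennreal (K x y * exp (a y + c y)) \<partial>M) \<le> ennreal (a x)}"
  define w where "w x y = indicator G x * ennreal (K x y)" for x y
    \<comment> \<open>with the kernel cut off outside \<open>G\<close>, the assumption \<open>KP\<close> holds at every point\<close>
  define e where "e x = ennreal (exp (c x))" for x
  let ?A = "\<lambda>x. ennreal (exp (a x))" and ?ac = "\<lambda>s. a s + c s"
  have eA: "ennreal (exp (?ac x)) = e x * ?A x" for x
    by (simp add: e_def exp_add ennreal_mult mult.commute)
  have ac: "?ac \<in> borel_measurable M" using a c by measurable
  have e: "e \<in> borel_measurable M" unfolding e_def using c by measurable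
  have G: "G \<in> sets M"
  proof -
    have "(\<lambda>(x, y). ennreal (K x y * exp (a y + c y))) \<in> borel_measurable (M \<Otimes>\<^sub>M M)"
      using K(1) a(1) c by measurable
    then have "(\<lambda>x. \<integral>\<^sup>+ y. ennreal (K x y * exp (a y + c y)) \<partial>M) \<in> borel_measurable M"
      by (rule borel_measurable_nn_integral)
    then show ?thesis unfolding G_def using a(1) by measurable
  qed
  have w: "case_prod w \<in> borel_measurable (M \<Otimes>\<^sub>M M)"
    unfolding w_def case_prod_beta' using K(1) G by measurable
  have w_le: "w s t \<le> ennreal (K s t)" for s t by (simp add: w_def indicator_def)
  have KPw: "(\<integral>\<^sup>+ y. w x y * e y * ?A y \<partial>M) \<le> ennreal (a x)" if "x \<in> space M" for x
  proof (cases "x \<in> G")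
    case True
    have "w x y * e y * ?A y = ennreal (K x y * exp (a y + c y))" for y
      using True K by (simp add: w_def ennreal_mult mult.assoc eA)
    then show ?thesis using True by (simp add: G_def)
  qed (simp add: w_def)
  \<comment> \<open>Off the null set the points also lie in G, where the cut-off kernel w agrees
    with K. The exceptional set is fixed as a measurable N because it is going to be integrated over
    the points beyond x and y.\<close>
  define bad where "bad j N \<longleftrightarrow> N \<in> null_sets (PiM {1..j + 2} (\<lambda>_. M)) \<and>
     (\<forall>\<omega>\<in>space (PiM {1..j + 2} (\<lambda>_. M)) - N.
        ennreal (cmod (conn_sum (\<lambda>e. z (\<omega> (Min e)) (\<omega> (Max e))) {1..j + 2}))
          \<le> (\<Prod>i\<in>{1..j + 2}. e (\<omega> i)) * forest (\<lambda>i k. w (\<omega> i) (\<omega> k)) {1} ({1..j + 2} - {1}))" for j N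
  have "\<exists>N. bad j N" for j
  proof -
    have "AE x in M. x \<in> G" using KP AE_space by eventually_elim (simp add: G_def)
    then have "AE \<omega> in PiM {1..j + 2} (\<lambda>_. M). \<omega> i \<in> G" if "i \<in> {1..j + 2}" for i
      using that by (intro AE_PiM_component_finite) auto
    then have "AE \<omega> in PiM {1..j + 2} (\<lambda>_. M). \<forall>i\<in>{1..j + 2}. \<omega> i \<in> G"
      by (intro AE_finite_allI) auto
    moreover have "AE \<omega> in PiM {1..j + 2} (\<lambda>_. M).
        cmod (conn_sum (\<lambda>e. z (\<omega> (Min e)) (\<omega> (Max e))) {1..j + 2})
          \<le> (\<Prod>i\<in>{1..j + 2}. exp (c (\<omega> i))) * forest (\<lambda>i j. K (\<omega> i) (\<omega> j)) {1} ({1..j + 2} - {1})"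
      by (rule tree) simp
    ultimately have "AE \<omega> in PiM {1..j + 2} (\<lambda>_. M).
        ennreal (cmod (conn_sum (\<lambda>e. z (\<omega> (Min e)) (\<omega> (Max e))) {1..j + 2}))
          \<le> (\<Prod>i\<in>{1..j + 2}. e (\<omega> i)) * forest (\<lambda>i k. w (\<omega> i) (\<omega> k)) {1} ({1..j + 2} - {1})"
    proof eventually_elim
      case (elim \<omega>)
      have "forest (\<lambda>i k. w (\<omega> i) (\<omega> k)) {1} ({1..j + 2} - {1}) =
          forest (\<lambda>i k. ennreal (K (\<omega> i) (\<omega> k))) {1} ({1..j + 2} - {1})"
      proof (rule forest_cong)
        fix i k assume "i \<in> {1} \<union> ({1..j + 2} - {1})"
        then have "\<omega> i \<in> G" using elim(1) by auto
        then show "w (\<omega> i) (\<omega> k) = ennreal (K (\<omega> i) (\<omega> k))" by (simp add: w_def)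
      qed auto
      also have "\<dots> = ennreal (forest (\<lambda>i k. K (\<omega> i) (\<omega> k)) {1} ({1..j + 2} - {1}))"
        using K by (intro ennreal_forest[symmetric]) auto
      finally have fw: "forest (\<lambda>i k. w (\<omega> i) (\<omega> k)) {1} ({1..j + 2} - {1}) =
        ennreal (forest (\<lambda>i k. K (\<omega> i) (\<omega> k)) {1} ({1..j + 2} - {1}))" .
      have "(\<Prod>i\<in>{1..j + 2}. e (\<omega> i)) * forest (\<lambda>i k. w (\<omega> i) (\<omega> k)) {1} ({1..j + 2} - {1}) =
        ennreal ((\<Prod>i\<in>{1..j + 2}. exp (c (\<omega> i))) * forest (\<lambda>i k. K (\<omega> i) (\<omega> k)) {1} ({1..j + 2} - {1}))"
      proof -
        have "(\<Prod>i\<in>{1..j + 2}. e (\<omega> i)) = ennreal (\<Prod>i\<in>{1..j + 2}. exp (c (\<omega> i)))"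
          unfolding e_def by (rule prod_ennreal) simp
        moreover have "0 \<le> forest (\<lambda>i k. K (\<omega> i) (\<omega> k)) {1} ({1..j + 2} - {1})"
          using K by (intro forest_nonneg) auto
        ultimately show ?thesis by (simp only: fw ennreal_mult prod_nonneg exp_ge_zero)
      qed
      then show ?case using elim(2) by (simp only: ennreal_leI)
    qed
    then obtain N where "{\<omega> \<in> space (PiM {1..j + 2} (\<lambda>_. M)). \<not> ennreal (cmod (conn_sum (\<lambda>e. z (\<omega> (Min e)) (\<omega> (Max e))) {1..j + 2}))
          \<le> (\<Prod>i\<in>{1..j + 2}. e (\<omega> i)) * forest (\<lambda>i k. w (\<omega> i) (\<omega> k)) {1} ({1..j + 2} - {1})} \<subseteq> N"
      "emeasure (PiM {1..j + 2} (\<lambda>_. M)) N = 0" "N \<in> sets (PiM {1..j + 2} (\<lambda>_. M))" by (rule AE_E)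
    then have "bad j N" unfolding bad_def null_sets_def by blast
    then show ?thesis ..
  qed
  then obtain N where N: "\<And>j. bad j (N j)" by metis
  let ?I = "\<lambda>j xs. indicator (N j) (restrict xs {1..j + 2}) :: ennreal"
  \<comment> \<open>Countably many orders j leave a single null set of pairs, so the whole series
    can be treated for a fixed pair.\<close>
  have "AE p in M \<Otimes>\<^sub>M M. \<forall>j. pint M {3..<3 + j} (?I j) ((\<lambda>_. fst p)(2 := snd p)) = 0"
    using N unfolding bad_def AE_all_countable by (intro allI AE_pint_null) blast
  from this AE_space show ?thesis
  proof eventually_elim
    case (elim p)
    obtain x y where p: "p = (x, y)" by force
    have x: "x \<in> space M" and y: "y \<in> space M" using elim(2) by (auto simp: p space_pair_measure)
    define xs where "xs = (\<lambda>_::nat. x)(2 := y)"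
    have xs: "xs \<in> space (points M)" using x y by (auto simp: xs_def space_points)
    have xs12: "xs 1 = x" "xs 2 = y" by (auto simp: xs_def)
    have null: "pint M {3..<3 + j} (?I j) xs = 0" for j using elim(1) by (simp add: p xs_def)
    define C where "C s = (\<Sum>m. chain_from M K ?ac y m s)" for s
    have chain_meas: "chain_from M K ?ac y m \<in> borel_measurable M" for m
      by (rule chain_from_measurable[OF K(1) ac y])
    have C_meas: "C \<in> borel_measurable M" unfolding C_def[abs_def] using chain_meas by measurable
    have C_eq: "C s = ennreal (K s y) + (\<Sum>m. chain_from M K ?ac y (Suc m) s)" for s
    proof -
      have "(\<lambda>m. chain_from M K ?ac y m s) sums ((\<Sum>m. chain_from M K ?ac y (Suc m) s) + chain_from M K ?ac y 0 s)"
        by (rule sums_Suc) (rule summable_sums[OF summableI])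
      then show ?thesis unfolding C_def by (simp add: sums_iff add.commute)
    qed
    \<comment> \<open>C solves the path equation of the full kernel K; since w is at most K, it is a
      supersolution for the cut-off kernel at every point.\<close>
    have C_super: "w s y + (\<integral>\<^sup>+ t. w s t * e t * ?A t * C t \<partial>M) \<le> C s" if s: "s \<in> space M" for s
    proof -
      have Ks: "K s \<in> borel_measurable M" using measurable_compose[OF measurable_Pair1'[OF s] K(1)] by simp
      have "(\<integral>\<^sup>+ t. w s t * e t * ?A t * C t \<partial>M) \<le>
          (\<integral>\<^sup>+ t. (\<Sum>m. ennreal (K s t) * ennreal (exp (?ac t)) * chain_from M K ?ac y m t) \<partial>M)"
        using w_le by (intro nn_integral_mono) (auto simp: C_def eA mult.assoc intro!: mult_right_mono)
      also have "\<dots> = (\<Sum>m. chain_from M K ?ac y (Suc m) s)"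
        unfolding chain_from.simps using Ks ac chain_meas
        by (intro nn_integral_suminf borel_measurable_times_ennreal) auto
      finally show ?thesis unfolding C_eq using w_le by (intro add_mono)
    qed
    let ?R = "ennreal (exp (a y + c y)) *
                  (ennreal (K x y * exp (a x + c x)) + (\<Sum>m. chain_term M K ?ac x y (Suc m)))"
    have R: "?R = e x * e y * (?A x * ?A y * C x)"
    proof -
      have "(\<Sum>m. chain_term M K ?ac x y (Suc m)) = ennreal (exp (?ac x)) * (\<Sum>m. chain_from M K ?ac y (Suc m) x)"
        by (simp only: chain_term_eq[OF K ac x y] ennreal_suminf_cmult)
      moreover have "ennreal (K x y * exp (a x + c x)) = ennreal (exp (?ac x)) * ennreal (K x y)"
        using K by (simp add: ennreal_mult mult.commute)
      ultimately have "ennreal (K x y * exp (a x + c x)) + (\<Sum>m. chain_term M K ?ac x y (Suc m)) = ennreal (exp (?ac x)) * C x"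
        unfolding C_eq by (simp only: distrib_left)
      then show ?thesis by (simp only: eA mult_ac)
    qed
    define J where "J j = pint M {3..<3 + j}
      (\<lambda>xs. (\<Prod>y\<in>{3..<3 + j}. e (xs y)) * forest (\<lambda>i j. w (xs i) (xs j)) {1} (insert 2 {3..<3 + j})) xs" for j
    have J_sum: "(\<Sum>j. ennreal (1 / fact j) * J j) \<le> ?A x * ?A y * C x"
      using tree_series_le[OF e w a(1) _ KPw C_meas _ xs] a(2) C_super unfolding xs12 J_def by blast
    have Z: "ennreal (cmod (Zterm M h z x y j)) \<le> e x * e y * (ennreal (1 / fact j) * J j)" for j
    proof -
      let ?n = "j + 2"
      let ?B = "\<lambda>xs. (\<Prod>i\<in>{1..?n}. e (xs i)) * forest (\<lambda>i k. w (xs i) (xs k)) {1} ({1..?n} - {1})"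
      let ?H = "\<lambda>xs. (\<Prod>y\<in>{3..<3 + j}. e (xs y)) * forest (\<lambda>i j. w (xs i) (xs j)) {1} (insert 2 {3..<3 + j})"
      have B: "?B \<in> borel_measurable (points M)"
        by (intro borel_measurable_times_ennreal borel_measurable_prod_ennreal measurable_points_component e measurable_forest w) auto
      have H: "?H \<in> borel_measurable (points M)"
        by (intro borel_measurable_times_ennreal borel_measurable_prod_ennreal measurable_points_component e measurable_forest w) auto
      have I: "?I j \<in> borel_measurable (points M)"
      proof -
        have "(\<lambda>xs. restrict xs {1..?n}) \<in> points M \<rightarrow>\<^sub>M PiM {1..?n} (\<lambda>_. M)"
          by (intro measurable_restrict_subset) auto
        moreover have "N j \<in> sets (PiM {1..?n} (\<lambda>_. M))" using N[of j] by (auto simp: bad_def)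
        ultimately show ?thesis by (intro measurable_compose[OF _ borel_measurable_indicator])
      qed
      have "ennreal (cmod (cint_iter M h j 3 (phi z ?n) xs)) \<le> nn_iter M j 3 (\<lambda>xs. ennreal (cmod (phi z ?n xs))) xs"
        using h by (rule norm_cint_iter_le)
      \<comment> \<open>The infinite multiple of the indicator makes the inequality hold at every
        point, and its integral vanishes for the chosen pair.\<close>
      also have "\<dots> \<le> nn_iter M j 3 (\<lambda>xs. ennreal (1 / fact ?n) * ?B xs + top * ?I j xs) xs"
      proof (rule nn_iter_mono)
        fix ys assume ys: "\<And>i. i \<notin> {3..<3 + j} \<Longrightarrow> ys i = xs i" "\<And>i. i \<in> {3..<3 + j} \<Longrightarrow> ys i \<in> space M"
        have ys_space: "ys i \<in> space M" for i using ys xs by (cases "i \<in> {3..<3 + j}") (auto simp: space_points)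
        let ?r = "restrict ys {1..?n}"
        have r: "?r \<in> space (PiM {1..?n} (\<lambda>_. M))" using ys_space by (auto simp: space_PiM)
        show "ennreal (cmod (phi z ?n ys)) \<le> ennreal (1 / fact ?n) * ?B ys + top * ?I j ys"
        proof (cases "?r \<in> N j")
          case True
          then show ?thesis by simp
        next
          case False
          have "conn_sum (\<lambda>e. z (?r (Min e)) (?r (Max e))) {1..?n} = conn_sum (\<lambda>e. z (ys (Min e)) (ys (Max e))) {1..?n}"
            by (intro conn_sum_cong) (simp only: restrict_apply' vpairs_Min_Max)
          moreover have "forest (\<lambda>i k. w (?r i) (?r k)) {1} ({1..?n} - {1}) = forest (\<lambda>i k. w (ys i) (ys k)) {1} ({1..?n} - {1})"
            by (intro forest_cong) auto
          moreover have "(\<Prod>i\<in>{1..?n}. e (?r i)) = (\<Prod>i\<in>{1..?n}. e (ys i))" by (intro prod.cong) auto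
          moreover have "ennreal (cmod (conn_sum (\<lambda>e. z (?r (Min e)) (?r (Max e))) {1..?n}))
              \<le> (\<Prod>i\<in>{1..?n}. e (?r i)) * forest (\<lambda>i k. w (?r i) (?r k)) {1} ({1..?n} - {1})"
            using N[of j] r False unfolding bad_def by blast
          ultimately have 1: "ennreal (cmod (conn_sum (\<lambda>e. z (ys (Min e)) (ys (Max e))) {1..?n})) \<le> ?B ys" by (simp only:)
          have "ennreal (cmod (phi z ?n ys)) = ennreal (1 / fact ?n) * ennreal (cmod (conn_sum (\<lambda>e. z (ys (Min e)) (ys (Max e))) {1..?n}))"
          proof -
            have "cmod (1 / fact m) = 1 / fact m" for m :: nat by (simp add: norm_divide)
            then show ?thesis unfolding phi_eq_conn_sum norm_mult by (simp only: ennreal_mult norm_ge_zero divide_nonneg_nonneg zero_le_one fact_ge_zero)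
          qed
          also have "\<dots> \<le> ennreal (1 / fact ?n) * ?B ys" using 1 by (rule mult_left_mono) simp
          finally show ?thesis by (rule order_trans) simp
        qed
      qed
      also have "\<dots> = pint M {3..<3 + j} (\<lambda>xs. ennreal (1 / fact ?n) * ?B xs + top * ?I j xs) xs"
        by (intro nn_iter_eq_pint borel_measurable_add borel_measurable_times_ennreal[OF borel_measurable_const] B I xs)
      also have "\<dots> = pint M {3..<3 + j} (\<lambda>xs. ennreal (1 / fact ?n) * ?B xs) xs + pint M {3..<3 + j} (\<lambda>xs. top * ?I j xs) xs"
        by (intro pint_add borel_measurable_times_ennreal[OF borel_measurable_const] B I xs)
      also have "pint M {3..<3 + j} (\<lambda>xs. top * ?I j xs) xs = 0"
        using pint_cmult[OF I xs] null by simp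
      also have "pint M {3..<3 + j} (\<lambda>xs. ennreal (1 / fact ?n) * ?B xs) xs = ennreal (1 / fact ?n) * pint M {3..<3 + j} ?B xs"
        by (intro pint_cmult B xs)
      also have "pint M {3..<3 + j} ?B xs = pint M {3..<3 + j} (\<lambda>ys. (e x * e y) * ?H ys) xs"
      proof (rule pint_cong[OF _ xs])
        fix ys assume ys: "\<And>i. i \<notin> {3..<3 + j} \<Longrightarrow> ys i = xs i"
        have "ys 1 = x" "ys 2 = y" using ys[of 1] ys[of 2] xs12 by auto
        moreover have "{1..?n} = insert 1 (insert 2 {3..<3 + j})" by auto
        moreover have "{1..?n} - {1} = insert 2 {3..<3 + j}" by auto
        ultimately show "?B ys = (e x * e y) * ?H ys" by (simp add: mult.assoc)
      qed
      also have "\<dots> = (e x * e y) * J j" unfolding J_def by (intro pint_cmult H xs)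
      finally have "ennreal (cmod (cint_iter M h j 3 (phi z ?n) xs)) \<le> ennreal (1 / fact ?n) * (e x * e y * J j)" by simp
      then have "ennreal (real ((j + 2) * (j + 1))) * ennreal (cmod (cint_iter M h j 3 (phi z ?n) xs))
         \<le> ennreal (real ((j + 2) * (j + 1))) * (ennreal (1 / fact ?n) * (e x * e y * J j))"
        by (rule mult_left_mono) simp
      also have "\<dots> = ennreal (real ((j + 2) * (j + 1)) * (1 / fact ?n)) * (e x * e y * J j)"
        by (subst ennreal_mult) (auto simp: mult.assoc)
      \<comment> \<open>With n = j + 2 the factor n (n - 1) / n! becomes 1 / (n - 2)!, the weight
        appearing in \<open>tree_series_le\<close>.\<close>
      also have "real ((j + 2) * (j + 1)) * (1 / fact ?n) = 1 / fact j"
      proof -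
        have "fact ?n = real ((j + 2) * (j + 1)) * fact j" by (simp add: algebra_simps)
        moreover have "real ((j + 2) * (j + 1)) \<noteq> 0" by (simp only: of_nat_eq_0_iff) simp
        ultimately show ?thesis by (simp only: times_divide_eq_right nonzero_mult_divide_mult_cancel_left not_False_eq_True simp_thms)
      qed
      also have "ennreal (real ((j + 2) * (j + 1))) * ennreal (cmod (cint_iter M h j 3 (phi z ?n) xs)) = ennreal (cmod (Zterm M h z x y j))"
        unfolding Zterm_def norm_mult norm_of_nat xs_def by (rule ennreal_mult[symmetric]) auto
      finally show ?thesis by (simp only: mult_ac)
    qed
    have sum_le: "(\<Sum>j. ennreal (cmod (Zterm M h z x y j))) \<le> ?R"
    proof -
      have "(\<Sum>j. ennreal (cmod (Zterm M h z x y j))) \<le> (\<Sum>j. e x * e y * (ennreal (1 / fact j) * J j))"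
        using Z by (intro suminf_le summableI)
      also have "\<dots> = e x * e y * (\<Sum>j. ennreal (1 / fact j) * J j)" by (simp only: ennreal_suminf_cmult)
      also have "\<dots> \<le> ?R" unfolding R using J_sum by (rule mult_left_mono) simp
      finally show ?thesis .
    qed
    have "summable (Zterm M h z x y) \<and> ennreal (cmod (Zhat M h z x y)) \<le> ?R" if fin: "?R < \<infinity>"
    proof -
      have "(\<Sum>j. ennreal (cmod (Zterm M h z x y j))) \<noteq> top" using sum_le fin by (auto simp: top_unique)
      then have s: "summable (\<lambda>j. cmod (Zterm M h z x y j))" by (intro summable_suminf_not_top) auto
      have "ennreal (cmod (Zhat M h z x y)) \<le> ennreal (\<Sum>j. cmod (Zterm M h z x y j))"
        unfolding Zhat_def using s by (intro ennreal_leI summable_norm)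
      also have "\<dots> = (\<Sum>j. ennreal (cmod (Zterm M h z x y j)))"
        using s by (intro suminf_ennreal2[symmetric]) auto
      finally show ?thesis using sum_le summable_norm_cancel[OF s] by (auto intro: order_trans)
    qed
    then show ?case by (simp only: p prod.case Let_def) blast
  qed
qed

text \<open>The assumption for m = \<open>card X\<close> points is transported along an enumeration
  of X. There are only finitely many X, so the exceptional sets unite to a null set.\<close>

lemma AE_stability_subsets:
  fixes z :: "'a \<Rightarrow> 'a \<Rightarrow> complex" and b :: "'a \<Rightarrow> real"
  assumes sym: "\<And>s t. z s t = z t s"
    and stab: "\<forall>n::nat. AE xs in PiM {1..n} (\<lambda>_. M).
        (\<Prod>i\<in>{1..n}. \<Prod>j\<in>{i<..n}. cmod (1 + z (xs i) (xs j))) \<le> (\<Prod>i\<in>{1..n}. exp (b (xs i)))"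
  shows "AE xs in PiM {1..n} (\<lambda>_. M). \<forall>X\<in>Pow {1..n}.
     (\<Prod>e\<in>vpairs X. cmod (1 + z (xs (Min e)) (xs (Max e)))) \<le> (\<Prod>i\<in>X. exp (b (xs i)))"
proof (intro AE_finite_allI)
  fix X assume X: "X \<in> Pow {1..n}"
  then have finX: "finite X" using finite_subset by auto
  define m where "m = card X"
  obtain \<sigma> where \<sigma>: "bij_betw \<sigma> {1..m} X" using finite_same_card_bij[of "{1..m}" X] finX by (auto simp: m_def)
  then have inj: "inj_on \<sigma> {1..m}" and im: "\<sigma> ` {1..m} = X" by (auto simp: bij_betw_def)
  have "AE xs in PiM {1..n} (\<lambda>_. M). (\<lambda>ys. (\<Prod>i\<in>{1..m}. \<Prod>j\<in>{i<..m}. cmod (1 + z (ys i) (ys j)))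
      \<le> (\<Prod>i\<in>{1..m}. exp (b (ys i)))) (\<lambda>j\<in>{1..m}. xs (\<sigma> j))"
    using X im stab[rule_format, of m] inj by (intro AE_PiM_project) auto
  then show "AE xs in PiM {1..n} (\<lambda>_. M). (\<Prod>e\<in>vpairs X. cmod (1 + z (xs (Min e)) (xs (Max e)))) \<le> (\<Prod>i\<in>X. exp (b (xs i)))"
  proof eventually_elim
    case (elim xs)
    let ?g = "\<lambda>i j. cmod (1 + z (xs i) (xs j))"
    let ?G = "\<lambda>e. ?g (Min e) (Max e)"
    \<comment> \<open>The enumeration of X need not be monotone, so the order of the two points
      under \<open>Min\<close> and \<open>Max\<close> may be reversed; symmetry makes this
      harmless.\<close>
    have G: "?G {i, j} = ?g i j" for i j
      using sym[of "xs i" "xs j"] by (cases "i \<le> j") (auto simp: min_def max_def)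
    have injp: "inj_on (\<lambda>(i, j). {\<sigma> i, \<sigma> j}) (SIGMA i:{1..m}. {i<..m})"
    proof (rule inj_onI, clarify)
      fix i j k l assume *: "i \<in> {1..m}" "j \<in> {i<..m}" "k \<in> {1..m}" "l \<in> {k<..m}" "{\<sigma> i, \<sigma> j} = {\<sigma> k, \<sigma> l}"
      then have "j \<in> {1..m}" "l \<in> {1..m}" by auto
      then have "(i = k \<and> j = l) \<or> (i = l \<and> j = k)"
        using * inj_onD[OF inj] by (metis doubleton_eq_iff)
      then show "i = k \<and> j = l" using * by auto
    qed
    have imp: "(\<lambda>(i, j). {\<sigma> i, \<sigma> j}) ` (SIGMA i:{1..m}. {i<..m}) = vpairs X"
    proof (intro set_eqI iffI)
      fix e assume "e \<in> (\<lambda>(i, j). {\<sigma> i, \<sigma> j}) ` (SIGMA i:{1..m}. {i<..m})"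
      then obtain i j where ij: "e = {\<sigma> i, \<sigma> j}" "i \<in> {1..m}" "j \<in> {1..m}" "i < j" by auto
      then have "\<sigma> i \<noteq> \<sigma> j" using inj_onD[OF inj] by (metis less_irrefl)
      moreover have "\<sigma> i \<in> X" "\<sigma> j \<in> X" using ij im by blast+
      ultimately show "e \<in> vpairs X" using ij(1) by (auto simp: vpairs_def)
    next
      fix e assume "e \<in> vpairs X"
      then obtain p q where pq: "e = {p, q}" "p \<in> X" "q \<in> X" "p \<noteq> q" by (auto simp: vpairs_def)
      then obtain i j where ij: "p = \<sigma> i" "q = \<sigma> j" "i \<in> {1..m}" "j \<in> {1..m}" unfolding im[symmetric] by blast
      consider "i < j" | "j < i" using pq ij by (cases i j rule: linorder_cases) auto
      then show "e \<in> (\<lambda>(i, j). {\<sigma> i, \<sigma> j}) ` (SIGMA i:{1..m}. {i<..m})"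
      proof cases
        case 1
        then have "(i, j) \<in> (SIGMA i:{1..m}. {i<..m})" using ij by auto
        moreover have "e = (\<lambda>(i, j). {\<sigma> i, \<sigma> j}) (i, j)" using pq ij by simp
        ultimately show ?thesis by (rule rev_image_eqI)
      next
        case 2
        then have "(j, i) \<in> (SIGMA i:{1..m}. {i<..m})" using ij by auto
        moreover have "e = (\<lambda>(i, j). {\<sigma> i, \<sigma> j}) (j, i)" using pq ij by auto
        ultimately show ?thesis by (rule rev_image_eqI)
      qed
    qed
    have "(\<Prod>e\<in>vpairs X. ?G e) = (\<Prod>(i, j)\<in>(SIGMA i:{1..m}. {i<..m}). ?g (\<sigma> i) (\<sigma> j))"
      unfolding imp[symmetric] by (subst prod.reindex[OF injp], rule prod.cong[OF refl], clarify) (simp only: comp_def prod.case G)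
    also have "\<dots> = (\<Prod>i\<in>{1..m}. \<Prod>j\<in>{i<..m}. ?g (\<sigma> i) (\<sigma> j))"
      by (subst prod.Sigma) auto
    also have "\<dots> \<le> (\<Prod>i\<in>{1..m}. exp (b (xs (\<sigma> i))))"
    proof -
      have "(\<Prod>i\<in>{1..m}. \<Prod>j\<in>{i<..m}. ?g (\<sigma> i) (\<sigma> j)) =
        (\<Prod>i\<in>{1..m}. \<Prod>j\<in>{i<..m}. cmod (1 + z ((\<lambda>j\<in>{1..m}. xs (\<sigma> j)) i) ((\<lambda>j\<in>{1..m}. xs (\<sigma> j)) j)))"
        by (intro prod.cong) auto
      moreover have "(\<Prod>i\<in>{1..m}. exp (b ((\<lambda>j\<in>{1..m}. xs (\<sigma> j)) i))) = (\<Prod>i\<in>{1..m}. exp (b (xs (\<sigma> i))))"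
        by (intro prod.cong) auto
      ultimately show ?thesis using elim by (simp only:)
    qed
    also have "\<dots> = (\<Prod>i\<in>X. exp (b (xs i)))" unfolding im[symmetric] by (subst prod.reindex[OF inj]) simp
    finally show ?case .
  qed
qed auto

end

theorem mainTheorem3:
  fixes M :: "'a measure" and h :: "'a \<Rightarrow> complex"
    and u :: "'a \<Rightarrow> 'a \<Rightarrow> complex option" and b :: "'a \<Rightarrow> real"
  assumes finM: "finite_measure M"
    and h_meas: "h \<in> borel_measurable M"
    and h_abs: "\<forall>x\<in>space M. cmod (h x) = 1"
    and u_sym: "\<forall>x y. u x y = u y x"
    and zeta_meas: "case_prod (zeta u) \<in> borel_measurable (M \<Otimes>\<^sub>M M)"
    and ubar_meas: "case_prod (ubar u) \<in> borel_measurable (M \<Otimes>\<^sub>M M)"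
    and b_meas: "b \<in> borel_measurable M"
    and b_nonneg: "\<forall>x\<in>space M. 0 \<le> b x"
    and assumption1: "\<forall>n::nat. AE xs in PiM {1..n} (\<lambda>_. M).
        (\<Prod>i\<in>{1..n}. \<Prod>j\<in>{i<..n}. cmod (1 + zeta u (xs i) (xs j)))
          \<le> (\<Prod>i\<in>{1..n}. exp (b (xs i)))"
  shows
    "(\<forall>a. a \<in> borel_measurable M \<and> (\<forall>x\<in>space M. 0 \<le> a x) \<and>
         (AE x in M. (\<integral>\<^sup>+ y. ennreal (cmod (zeta u x y) * exp (a y + 2 * b y)) \<partial>M) \<le> ennreal (a x))
       \<longrightarrow> (AE p in M \<Otimes>\<^sub>M M. case p of (x, y) \<Rightarrow>
            (let R = ennreal (exp (a y + 2 * b y)) *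
                  (ennreal (cmod (zeta u x y) * exp (a x + 2 * b x)) +
                   (\<Sum>m. chain_term M (\<lambda>s t. cmod (zeta u s t)) (\<lambda>s. a s + 2 * b s) x y (Suc m)))
             in R < \<infinity> \<longrightarrow> summable (Zterm M h (zeta u) x y) \<and>
                ennreal (cmod (Zhat M h (zeta u) x y)) \<le> R)))
     \<and>
     (\<forall>a. a \<in> borel_measurable M \<and> (\<forall>x\<in>space M. 0 \<le> a x) \<and>
         (AE x in M. (\<integral>\<^sup>+ y. ennreal (cmod (ubar u x y) * exp (a y + b y)) \<partial>M) \<le> ennreal (a x))
       \<longrightarrow> (AE p in M \<Otimes>\<^sub>M M. case p of (x, y) \<Rightarrow>
            (let R = ennreal (exp (a y + b y)) *
                  (ennreal (cmod (ubar u x y) * exp (a x + b x)) +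
                   (\<Sum>m. chain_term M (\<lambda>s t. cmod (ubar u s t)) (\<lambda>s. a s + b s) x y (Suc m)))
             in R < \<infinity> \<longrightarrow> summable (Zterm M h (zeta u) x y) \<and>
                ennreal (cmod (Zhat M h (zeta u) x y)) \<le> R)))"
proof -
  interpret finite_measure M by (rule finM)
  have zsym: "zeta u s t = zeta u t s" and usym: "ubar u s t = ubar u t s" for s t
    using u_sym by (simp_all add: zeta_def ubar_def)
  note stab = AE_stability_subsets[OF zsym assumption1]
  have z_pair: "zeta u (xs (Min {i, j})) (xs (Max {i, j})) = zeta u (xs i) (xs j)"
    and u_pair: "ubar u (xs (Min {i, j})) (xs (Max {i, j})) = ubar u (xs i) (xs j)" for xs and i j :: nat
    using zsym[of "xs i" "xs j"] usym[of "xs i" "xs j"] by (cases "i \<le> j"; auto simp: min_def max_def)+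
  have tree_zeta: "AE xs in PiM {1..n} (\<lambda>_. M). cmod (conn_sum (\<lambda>e. zeta u (xs (Min e)) (xs (Max e))) {1..n})
      \<le> (\<Prod>i\<in>{1..n}. exp (2 * b (xs i))) * forest (\<lambda>i j. cmod (zeta u (xs i) (xs j))) {1} ({1..n} - {1})"
    if "1 \<le> n" for n
    using stab[of n]
  proof eventually_elim
    case (elim xs)
    then show ?case
      using conn_sum_le_forest_double[of "{1..n}" 1 "\<lambda>e. zeta u (xs (Min e)) (xs (Max e))" "\<lambda>i. b (xs i)"] that
      unfolding z_pair by auto
  qed
  have tree_ubar: "AE xs in PiM {1..n} (\<lambda>_. M). cmod (conn_sum (\<lambda>e. zeta u (xs (Min e)) (xs (Max e))) {1..n})
      \<le> (\<Prod>i\<in>{1..n}. exp (b (xs i))) * forest (\<lambda>i j. cmod (ubar u (xs i) (xs j))) {1} ({1..n} - {1})"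
    if "1 \<le> n" for n
    using stab[of n] AE_space
  proof eventually_elim
    case (elim xs)
    \<comment> \<open>The flow bound asks for a nonnegative value at every label, while b is known
      to be nonnegative only on the space of M; the labels outside {1..n} receive 0.\<close>
    define \<beta> where "\<beta> i = (if i \<in> {1..n} then b (xs i) else 0)" for i
    have prod_\<beta>: "(\<Prod>i\<in>X. exp (\<beta> i)) = (\<Prod>i\<in>X. exp (b (xs i)))" if "X \<subseteq> {1..n}" for X
      using that by (intro prod.cong) (auto simp: \<beta>_def)
    have "0 \<le> \<beta> i" for i using elim(2) b_nonneg by (auto simp: \<beta>_def space_PiM)
    moreover have "(\<Prod>e\<in>vpairs X. cmod (1 + zeta u (xs (Min e)) (xs (Max e)))) \<le> (\<Prod>i\<in>X. exp (\<beta> i))"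
      if "X \<subseteq> {1..n}" for X using elim(1) that by (simp add: prod_\<beta>)
    ultimately have "cmod (conn_sum (\<lambda>e. zeta u (xs (Min e)) (xs (Max e))) {1..n}) \<le> (\<Prod>i\<in>{1..n}. exp (\<beta> i)) *
      forest (\<lambda>i j. cmod (ubar u (xs (Min {i, j})) (xs (Max {i, j})))) {1} ({1..n} - {1})"
      using conn_sum_le_forest_hard_core[of "{1..n}" 1 "\<lambda>e. u (xs (Min e)) (xs (Max e))" \<beta>] that
      unfolding zeta_def ubar_def by auto
    then show ?case unfolding u_pair by (simp add: prod_\<beta>)
  qed
  show ?thesis
  proof ((intro conjI allI impI; elim conjE), goal_cases)
    case (1 a)
    show ?case
    proof (rule Zhat_bound[OF h_abs _ _ _ 1])
      show "(\<lambda>(s, t). cmod (zeta u s t)) \<in> borel_measurable (M \<Otimes>\<^sub>M M)"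
        using zeta_meas by (simp add: case_prod_beta')
    qed (use b_meas tree_zeta in auto)
  next
    case (2 a)
    show ?case
    proof (rule Zhat_bound[OF h_abs _ _ _ 2])
      show "(\<lambda>(s, t). cmod (ubar u s t)) \<in> borel_measurable (M \<Otimes>\<^sub>M M)"
        using ubar_meas by (simp add: case_prod_beta')
    qed (use b_meas tree_ubar in auto)
  qed
qed

end
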